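(* Let $(A=V/L,J_E)$ be a polarized complex abelian variety of dimension $g\ge 1$ and type $(d_1,\dots,d_g)$, with period matrix $\Pi=(E\;Z)$, where $E=\mathrm{diag}(d_1,\dots,d_g)$ and $Z\in\mathbb{H}_g$, with respect to a symplectic basis $\beta=\{\lambda_1,\dots,\lambda_{2g}\}$ of $L$ and the basis $\{\frac1{d_1}\lambda_1,\dots,\frac1{d_g}\lambda_g\}$ of $V$. For an integer $n$ with $1\le n\le \left[\frac{g+1}{2}\right]$ and $n<g$, call a rational form $\omega=\sum_{1\le i<j\le 2g}a_{ij}\,dx_i\wedge dx_j$ ($a_{ij}\in\mathbb{Q}$) *$n$-admissible for $A$* if it satisfies the equations of the criterion stated in the context. Then the following holds. (i) If there is no $n$-admissible $\omega$ for any $n$ with $1\le n\le\left[\frac{g+1}{2}\right]$ and $n<g$, then $A$ is simple. (ii) If $\omega$ is $n$-admissible for some such $n$, let $E_\omega=\gamma^{-1}(\omega)\in NS_{\mathbb{Q}}(A)$ and $f_\omega=\varphi(E_\omega)$. Then $f_\omega$ and $1-f_\omega$ are symmetric idempotents in $\mathrm{End}_{\mathbb{Q}}(A)$, and the abelian subvarieties $A_\omega:=\mathrm{Im}(f_\omega)$ and $A_\omega^c:=\mathrm{Im}(1-f_\omega)$ are complementary subvarieties of $A$; in particular the sum morphism $A_\omega\times A_\omega^c\to A$ is an isogeny. (iii) In the situation of (ii), let $B$ be either of the subvarieties $A_\omega$, $A_\omega^c$, let $h=\dim B$, let $D=\mathrm{diag}(n_1,\dots,n_h)$ where $(n_1,\dots,n_h)$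 is the type of the polarization induced on $B$, and let $P=(P_1\;P_2)$ with $P_1,P_2\in M(2g\times h,\mathbb{Z})$ be the matrix whose columns are the coordinates, with respect to $\beta$, of a symplectic basis $\{u_1,\dots,u_{2h}\}$ of the lattice of $B$. Then the period matrix of $B$ with respect to the bases $\{\frac1{n_1}u_1,\dots,\frac1{n_h}u_h\}$ and $\{u_1,\dots,u_{2h}\}$ is $(D\;W)$, where $W\in\mathbb{H}_h$ is the unique solution of $(E\;Z)\,P_1\,D^{-1}\,W=(E\;Z)\,P_2$. (iv) The procedure which looks for an admissible $\omega$, replaces $A$ by the pair $A_\omega$, $A_\omega^c$ with their induced polarizations and with period matrices computed as in (iii) whenever such an $\omega$ exists, and is then repeated on each of the subvarieties obtained, stops after finitely many steps, and it stops when $A$ is decomposed, up to isogeny, as a product of simple abelian subvarieties (that is, in its Poincaré decomposition).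
   Context: A polarized abelian variety $(A=V/L,J_E)$ of dimension $g$ and type $(d_1,\dots,d_g)$ carries a nondegenerate integral alternating form on $L$ (extended $\mathbb{R}$-linearly to $V$); a basis $\beta=\{\lambda_1,\dots,\lambda_{2g}\}$ of $L$ is symplectic if this form has matrix $J_E=\begin{pmatrix}0&E\\-E&0\end{pmatrix}$ with $E=\mathrm{diag}(d_1,\dots,d_g)$. The period matrix of $A$ with respect to bases $\{v_1,\dots,v_g\}$ of $V$ and $\{\lambda_1,\dots,\lambda_{2g}\}$ of $L$ is the $g\times 2g$ complex matrix $(\Pi_{j,i})$ with $\lambda_i=\sum_j\Pi_{j,i}v_j$. If $v_i=\frac1{d_i}\lambda_i$ for $1\le i\le g$, it has the form $(E\;Z)$ with $Z\in\mathbb{H}_g=\{Z\in M(g\times g,\mathbb{C}): Z^t=Z,\ \mathrm{Im}\,Z>0\}$ (sign convention: for the alternating form $F$ with matrix $J_E$, the form $(x,y)\mapsto F(x,iy)$ is symmetric positive definite). A subvariety carries the polarization induced by restriction. Let $x_1,\dots,x_{2g}$ be the real coordinate functions on $L\otimes\mathbb{R}=V$ associated with $\beta$, and $z_1,\dots,z_g$ the complex coordinate functions associated with the basis of $V$, so that $(z_1,\dots,z_g)^t=(E\;Z)(x_1,\dots,x_{2g})^t$. Identify $H^2(A,\mathbb{Q})$ with $\wedge^2\mathbb{Q}^{2g}$ with basis $\{dx_i\wedge dx_j: 1\le i<j\le 2g\}$. Elements of $NS_{\mathbb{Q}}(A)$ are regarded as rational alternating forms $\mu$ on $L$; the map $\gamma:NS_{\mathbb{Q}}(A)\to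 H^2(A,\mathbb{Q})$, $\gamma(\mu)=-\sum_{i<j}\mu(\lambda_i,\lambda_j)\,dx_i\wedge dx_j$, is injective with image $\{\omega\in\wedge^2\mathbb{Q}^{2g}:\omega\wedge dz_1\wedge\cdots\wedge dz_g=0\}$. Let $\mathcal{L}_0$ be the polarization of $A$ and $\phi_{\mathcal{L}}:A\to\widehat{A}$ the homomorphism induced by $\mathcal{L}$. The map $\varphi:NS_{\mathbb{Q}}(A)\to\mathrm{End}_{\mathbb{Q}}(A)^s$, $\varphi(\mathcal{L})=\phi_{\mathcal{L}_0}^{-1}\phi_{\mathcal{L}}$, is an isomorphism onto the space of elements symmetric under the Rosati involution of $\mathcal{L}_0$. In matrix terms with respect to $\beta$, $\varphi(\mu)$ has rational representation $J_E^{-1}M$, where $M=(\mu(\lambda_i,\lambda_j))_{i,j}$. For $f\in\mathrm{End}_{\mathbb{Q}}(A)=\mathrm{End}(A)\otimes\mathbb{Q}$, $\mathrm{Im}(f)$ denotes the abelian subvariety $\mathrm{Im}(mf)$ for any positive integer $m$ with $mf\in\mathrm{End}(A)$; its lattice is $(\langle\rho_r(f)\rangle\otimes\mathbb{Q})\cap L$, where $\langle\rho_r(f)\rangle$ is spanned by the columns of the rational representation of $f$. Equations of the criterion: put $\theta=\gamma(\mathcal{L}_0)=-\sum_{i=1}^g d_i\,dx_i\wedge dx_{g+i}$. The form $\omega=\sum_{i<j}a_{ij}\,dx_i\wedge dx_j$ with $a_{ij}\in\mathbb{Q}$ is $n$-admissible for $A$ if $\omega\wedge dz_1\wedge\cdots\wedge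 dz_g=0$ and, for every $1\le r\le g$, $\binom{g}{r}\,\omega^{\wedge r}\wedge\theta^{\wedge(g-r)}=\binom{n}{r}\,\theta^{\wedge g}$ (with $\binom{n}{r}=0$ for $r>n$). For example, if $g=2$, $d_1=1$, $d_2=d$, $Z=(z_{ij})$ and $n=1$, these equations read $-d=d\,a_{13}+a_{24}$, $\;0=(z_{11}z_{22}-z_{12}^2)a_{12}-d\,a_{14}z_{11}+d\,a_{13}z_{12}-a_{24}z_{12}+a_{23}z_{22}+d\,a_{34}$, and $0=a_{14}a_{23}-a_{13}a_{24}+a_{12}a_{34}$. *)

theory Defs
  imports
    Complex_Main
    "HOL-Library.FuncSet"
    "HOL-Algebra.Product_Groups"
    "Jordan_Normal_Form.Matrix"
begin

section \<open>Complex vector spaces\<close>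

class complex_vector = real_vector +
  fixes scaleC :: "complex \<Rightarrow> 'a \<Rightarrow> 'a"  (infixr "*\<^sub>C" 75)
  assumes scaleC_add_right: "c *\<^sub>C (x + y) = c *\<^sub>C x + c *\<^sub>C y"
    and scaleC_add_left: "(c + c') *\<^sub>C x = c *\<^sub>C x + c' *\<^sub>C x"
    and scaleC_scaleC: "c *\<^sub>C c' *\<^sub>C x = (c * c') *\<^sub>C x"
    and scaleC_one: "1 *\<^sub>C x = x"
    and scaleR_scaleC: "r *\<^sub>R x = complex_of_real r *\<^sub>C x"

global_interpretation complex_vector: vector_space "scaleC :: complex \<Rightarrow> 'a \<Rightarrow> 'a::complex_vector"
  by unfold_locales (simp_all add: scaleC_add_right scaleC_add_left scaleC_scaleC scaleC_one)

abbreviation cdim :: "'v::complex_vector set \<Rightarrow> nat"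
  where "cdim \<equiv> complex_vector.dim"

definition is_cbasis :: "'v::complex_vector set \<Rightarrow> 'v list \<Rightarrow> bool" where
  "is_cbasis V vs \<longleftrightarrow>
     distinct vs \<and> complex_vector.independent (set vs) \<and> complex_vector.span (set vs) = V"

section \<open>Polarized abelian varieties\<close>

text \<open>
  All complex vector spaces are complex subspaces of one ambient space, so that abelian
  subvarieties are objects of the same kind. The value of a form outside the vector space of the
  variety is irrelevant. Indices run from \<open>0\<close>: the basis \<open>\<lambda>\<^sub>1, \<dots>, \<lambda>\<^sub>2\<^sub>g\<close> is a list \<open>bs\<close>
  with \<open>\<lambda>\<^sub>i = bs ! (i - 1)\<close>, and likewise for types and matrices.
\<close>

record 'v pav =
  pspace :: "'v set"
  plat :: "'v set"
  pform :: "'v \<Rightarrow> 'v \<Rightarrow> real"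

definition is_lattice_basis :: "'v::real_vector set \<Rightarrow> 'v list \<Rightarrow> bool" where
  "is_lattice_basis L bs \<longleftrightarrow> distinct bs \<and> independent (set bs) \<and>
     L = range (\<lambda>c :: nat \<Rightarrow> int. \<Sum>i<length bs. real_of_int (c i) *\<^sub>R bs ! i)"

definition complex_torus :: "'v::complex_vector set \<Rightarrow> 'v set \<Rightarrow> bool" where
  "complex_torus V L \<longleftrightarrow> complex_vector.subspace V \<and> (\<exists>bs. is_lattice_basis L bs \<and> span (set bs) = V)"

definition alternating_form_on :: "'v::real_vector set \<Rightarrow> ('v \<Rightarrow> 'v \<Rightarrow> real) \<Rightarrow> bool" where
  "alternating_form_on V \<mu> \<longleftrightarrow>
     (\<forall>x\<in>V. \<forall>y\<in>V. \<forall>z\<in>V. \<mu> (x + y) z = \<mu> x z + \<mu> y z \<and> \<mu> z (x + y) = \<mu> z x + \<mu> z y) \<and>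
     (\<forall>r. \<forall>x\<in>V. \<forall>y\<in>V. \<mu> (r *\<^sub>R x) y = r * \<mu> x y \<and> \<mu> x (r *\<^sub>R y) = r * \<mu> x y) \<and>
     (\<forall>x\<in>V. \<mu> x x = 0)"

text \<open>Nondegeneracy of the form follows from the last conjunct.\<close>

definition polarized_abelian_variety :: "'v::complex_vector pav \<Rightarrow> bool" where
  "polarized_abelian_variety A \<longleftrightarrow>
     complex_torus (pspace A) (plat A) \<and>
     alternating_form_on (pspace A) (pform A) \<and>
     (\<forall>x\<in>plat A. \<forall>y\<in>plat A. pform A x y \<in> \<int>) \<and>
     (\<forall>x\<in>pspace A. \<forall>y\<in>pspace A. pform A x (\<i> *\<^sub>C y) = pform A y (\<i> *\<^sub>C x)) \<and>
     (\<forall>x\<in>pspace A. x \<noteq> 0 \<longrightarrow> pform A x (\<i> *\<^sub>C x) > 0)"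

text \<open>The matrix \<open>E\<close> (over any semiring) and \<open>J\<^sub>E\<close>.\<close>

definition type_mat :: "nat list \<Rightarrow> 'a::semiring_1 mat" where
  "type_mat ds = mat (length ds) (length ds) (\<lambda>(i, j). if i = j then of_nat (ds ! i) else 0)"

definition J_mat :: "nat list \<Rightarrow> real mat" where
  "J_mat ds = (let g = length ds in
     four_block_mat (0\<^sub>m g g) (type_mat ds) (- type_mat ds) (0\<^sub>m g g))"

definition symplectic_basis :: "'v::complex_vector pav \<Rightarrow> nat list \<Rightarrow> 'v list \<Rightarrow> bool" where
  "symplectic_basis A ds bs \<longleftrightarrow>
     length ds = cdim (pspace A) \<and> length bs = 2 * length ds \<and>
     (\<forall>i<length ds. ds ! i > 0) \<and> (\<forall>i. Suc i < length ds \<longrightarrow> ds ! i dvd ds ! Suc i) \<and>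
     is_lattice_basis (plat A) bs \<and>
     (\<forall>i<length bs. \<forall>j<length bs. pform A (bs ! i) (bs ! j) = J_mat ds $$ (i, j))"

section \<open>Period matrices\<close>

definition siegel_space :: "nat \<Rightarrow> complex mat set" where
  "siegel_space g = {Z \<in> carrier_mat g g. transpose_mat Z = Z \<and>
     (\<forall>x\<in>carrier_vec g. x \<noteq> 0\<^sub>v g \<longrightarrow> x \<bullet> (map_mat Im Z *\<^sub>v x) > 0)}"

definition join_cols :: "'a::zero mat \<Rightarrow> 'a mat \<Rightarrow> 'a mat" where
  "join_cols M N = four_block_mat M N (0\<^sub>m 0 (dim_col M)) (0\<^sub>m 0 (dim_col N))"

abbreviation normal_period_mat :: "nat list \<Rightarrow> complex mat \<Rightarrow> complex mat" where
  "normal_period_mat ds Z \<equiv> join_cols (type_mat ds) Z"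

definition is_period_matrix ::
  "'v::complex_vector pav \<Rightarrow> 'v list \<Rightarrow> 'v list \<Rightarrow> complex mat \<Rightarrow> bool" where
  "is_period_matrix A vs bs PM \<longleftrightarrow>
     is_cbasis (pspace A) vs \<and> is_lattice_basis (plat A) bs \<and>
     PM \<in> carrier_mat (length vs) (length bs) \<and>
     (\<forall>i<length bs. bs ! i = (\<Sum>j<length vs. PM $$ (j, i) *\<^sub>C vs ! j))"

definition normal_basis :: "nat list \<Rightarrow> 'v::real_vector list \<Rightarrow> 'v list" where
  "normal_basis ds bs = map (\<lambda>i. (1 / real (ds ! i)) *\<^sub>R bs ! i) [0..<length ds]"

text \<open>The columns of \<open>P\<close> are the coordinates of \<open>us\<close> with respect to \<open>bs\<close>.\<close>

definition coordinate_matrix :: "'v::real_vector list \<Rightarrow> 'v list \<Rightarrow> int mat \<Rightarrow> bool" where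
  "coordinate_matrix bs us P \<longleftrightarrow> P \<in> carrier_mat (length bs) (length us) \<and>
     (\<forall>k<length us. us ! k = (\<Sum>i<length bs. real_of_int (P $$ (i, k)) *\<^sub>R bs ! i))"

definition type_mat_inv :: "nat list \<Rightarrow> complex mat" where
  "type_mat_inv ns = mat (length ns) (length ns) (\<lambda>(i, j). if i = j then 1 / of_nat (ns ! i) else 0)"

definition induced_period_eq ::
  "nat list \<Rightarrow> complex mat \<Rightarrow> nat list \<Rightarrow> int mat \<Rightarrow> int mat \<Rightarrow> complex mat \<Rightarrow> bool" where
  "induced_period_eq ds Z ns P1 P2 W \<longleftrightarrow>
     W \<in> carrier_mat (length ns) (length ns) \<and>
     normal_period_mat ds Z * map_mat of_int P1 * type_mat_inv ns * W
       = normal_period_mat ds Z * map_mat of_int P2"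

section \<open>Exterior forms and the equations of the criterion\<close>

text \<open>
  A form \<open>\<alpha>\<close> in the exterior algebra on \<open>dx\<^sub>0, dx\<^sub>1, \<dots>\<close> is given by its coefficients: \<open>\<alpha> K\<close>, for a
  finite set \<open>K = {k\<^sub>1 < \<dots> < k\<^sub>r}\<close>, is the coefficient of \<open>dx\<^bsub>k\<^sub>1\<^esub> \<and> \<dots> \<and> dx\<^bsub>k\<^sub>r\<^esub>\<close>.
\<close>

type_synonym ext_form = "nat set \<Rightarrow> complex"

definition shuffle_sign :: "nat set \<Rightarrow> nat set \<Rightarrow> complex" where
  "shuffle_sign I J = (-1) ^ card {(i, j). i \<in> I \<and> j \<in> J \<and> j < i}"

definition wedge :: "ext_form \<Rightarrow> ext_form \<Rightarrow> ext_form" where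
  "wedge \<alpha> \<beta> = (\<lambda>K. \<Sum>I\<in>Pow K. shuffle_sign I (K - I) * \<alpha> I * \<beta> (K - I))"

definition ext_one :: ext_form where
  "ext_one = (\<lambda>K. if K = {} then 1 else 0)"

definition wedge_list :: "ext_form list \<Rightarrow> ext_form" where
  "wedge_list \<alpha>s = foldr wedge \<alpha>s ext_one"

definition wedge_power :: "ext_form \<Rightarrow> nat \<Rightarrow> ext_form" where
  "wedge_power \<alpha> r = wedge_list (replicate r \<alpha>)"

definition dx :: "nat \<Rightarrow> ext_form" where
  "dx i = (\<lambda>K. if K = {i} then 1 else 0)"

definition dz :: "complex mat \<Rightarrow> nat \<Rightarrow> ext_form" where
  "dz PM j = (\<lambda>K. \<Sum>i<dim_col PM. PM $$ (j, i) * dx i K)"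

definition two_form :: "nat \<Rightarrow> (nat \<Rightarrow> nat \<Rightarrow> complex) \<Rightarrow> ext_form" where
  "two_form m a = (\<lambda>K. \<Sum>i<m. \<Sum>j\<in>{i<..<m}. a i j * wedge (dx i) (dx j) K)"

definition rational_two_forms :: "nat \<Rightarrow> ext_form set" where
  "rational_two_forms m = range (\<lambda>a :: nat \<Rightarrow> nat \<Rightarrow> rat. two_form m (\<lambda>i j. of_rat (a i j)))"

definition theta :: "nat list \<Rightarrow> ext_form" where
  "theta ds = (\<lambda>K. - (\<Sum>i<length ds. of_nat (ds ! i) * wedge (dx i) (dx (length ds + i)) K))"

definition admissible :: "nat list \<Rightarrow> complex mat \<Rightarrow> nat \<Rightarrow> ext_form \<Rightarrow> bool" where
  "admissible ds Z n \<omega> \<longleftrightarrow> (let g = length ds; \<theta> = theta ds in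
     \<omega> \<in> rational_two_forms (2 * g) \<and>
     wedge \<omega> (wedge_list (map (dz (normal_period_mat ds Z)) [0..<g])) = (\<lambda>_. 0) \<and>
     (\<forall>r\<in>{1..g}.
        (\<lambda>K. of_nat (g choose r) * wedge (wedge_power \<omega> r) (wedge_power \<theta> (g - r)) K)
          = (\<lambda>K. of_nat (n choose r) * wedge_power \<theta> g K)))"

definition dim_range :: "nat \<Rightarrow> nat set" where
  "dim_range g = {n. 1 \<le> n \<and> n \<le> (g + 1) div 2 \<and> n < g}"

section \<open>Neron-Severi group and symmetric endomorphisms\<close>

text \<open>
  By Appell-Humbert, \<open>NS\<^sub>\<rat>(A)\<close> consists of the alternating forms on \<open>V\<close> that are rational on \<open>L\<close>
  and invariant under \<open>\<i>\<close>. They are taken to vanish outside \<open>V\<close> to make them unique as functions.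
\<close>

definition NS_rat :: "'v::complex_vector pav \<Rightarrow> ('v \<Rightarrow> 'v \<Rightarrow> real) set" where
  "NS_rat A = {\<mu>. alternating_form_on (pspace A) \<mu> \<and>
     (\<forall>x\<in>plat A. \<forall>y\<in>plat A. \<mu> x y \<in> \<rat>) \<and>
     (\<forall>x\<in>pspace A. \<forall>y\<in>pspace A. \<mu> (\<i> *\<^sub>C x) (\<i> *\<^sub>C y) = \<mu> x y) \<and>
     (\<forall>x y. x \<notin> pspace A \<or> y \<notin> pspace A \<longrightarrow> \<mu> x y = 0)}"

definition gamma :: "'v list \<Rightarrow> ('v \<Rightarrow> 'v \<Rightarrow> real) \<Rightarrow> ext_form" where
  "gamma bs \<mu> = (\<lambda>K. - two_form (length bs) (\<lambda>i j. complex_of_real (\<mu> (bs ! i) (bs ! j))) K)"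

definition form_of :: "'v::complex_vector pav \<Rightarrow> 'v list \<Rightarrow> ext_form \<Rightarrow> 'v \<Rightarrow> 'v \<Rightarrow> real" where
  "form_of A bs \<omega> = inv_into (NS_rat A) (gamma bs) \<omega>"

text \<open>
  The dual torus is \<open>Hom\<^sub>\<real>(V, \<real>)\<close> modulo the functionals integral on \<open>L\<close>, a functional \<open>l\<close>
  corresponding to the line bundle with character \<open>exp (2 \<pi> \<i> l)\<close>; the homomorphism \<open>\<phi>\<^sub>\<L>\<close> of a
  line bundle with form \<open>\<mu>\<close> then lifts to \<open>v \<mapsto> \<mu>(v, \<cdot>)\<close>. Homomorphisms are given by their lifts
  to \<open>V\<close>.
\<close>

definition phi_form :: "'v pav \<Rightarrow> ('v \<Rightarrow> 'v \<Rightarrow> real) \<Rightarrow> 'v \<Rightarrow> 'v \<Rightarrow> real" where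
  "phi_form A \<mu> v = (\<lambda>w\<in>pspace A. \<mu> v w)"

definition phi_pol_inv :: "'v pav \<Rightarrow> ('v \<Rightarrow> real) \<Rightarrow> 'v" where
  "phi_pol_inv A = inv_into (pspace A) (phi_form A (pform A))"

definition varphi :: "'v pav \<Rightarrow> ('v \<Rightarrow> 'v \<Rightarrow> real) \<Rightarrow> 'v \<Rightarrow> 'v" where
  "varphi A \<mu> = (\<lambda>v\<in>pspace A. phi_pol_inv A (phi_form A \<mu> v))"

definition End_rat :: "'v::complex_vector pav \<Rightarrow> ('v \<Rightarrow> 'v) set" where
  "End_rat A = {f \<in> pspace A \<rightarrow>\<^sub>E pspace A.
     (\<forall>x\<in>pspace A. \<forall>y\<in>pspace A. f (x + y) = f x + f y) \<and>
     (\<forall>c. \<forall>x\<in>pspace A. f (c *\<^sub>C x) = c *\<^sub>C f x) \<and>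
     (\<exists>m::nat. m > 0 \<and> (\<forall>x\<in>plat A. real m *\<^sub>R f x \<in> plat A))}"

text \<open>\<open>f \<mapsto> \<phi>\<^sub>0\<^sup>-\<^sup>1 f\<^sup>^ \<phi>\<^sub>0\<close>, where the dual \<open>f\<^sup>^\<close> of \<open>f\<close> is precomposition with \<open>f\<close>.\<close>

definition rosati :: "'v pav \<Rightarrow> ('v \<Rightarrow> 'v) \<Rightarrow> 'v \<Rightarrow> 'v" where
  "rosati A f = (\<lambda>v\<in>pspace A. phi_pol_inv A (\<lambda>w\<in>pspace A. phi_form A (pform A) v (f w)))"

definition symmetric_idempotent :: "'v::complex_vector pav \<Rightarrow> ('v \<Rightarrow> 'v) \<Rightarrow> bool" where
  "symmetric_idempotent A f \<longleftrightarrow>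
     f \<in> End_rat A \<and> rosati A f = f \<and> compose (pspace A) f f = f"

definition one_minus :: "'v::complex_vector pav \<Rightarrow> ('v \<Rightarrow> 'v) \<Rightarrow> 'v \<Rightarrow> 'v" where
  "one_minus A f = (\<lambda>v\<in>pspace A. v - f v)"

section \<open>Abelian subvarieties\<close>

text \<open>
  An abelian subvariety is a complex subtorus: a complex subspace in which \<open>L\<close> cuts out a full
  lattice, here with the restricted polarization.
\<close>

definition abelian_subvariety :: "'v::complex_vector pav \<Rightarrow> 'v pav \<Rightarrow> bool" where
  "abelian_subvariety A B \<longleftrightarrow>
     pspace B \<subseteq> pspace A \<and> plat B = plat A \<inter> pspace B \<and> pform B = pform A \<and>
     complex_torus (pspace B) (plat B)"

definition simple_variety :: "'v::complex_vector pav \<Rightarrow> bool" where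
  "simple_variety A \<longleftrightarrow> pspace A \<noteq> {0} \<and>
     (\<forall>B. abelian_subvariety A B \<longrightarrow> pspace B = {0} \<or> pspace B = pspace A)"

text \<open>
  The image of \<open>m f\<close>; its vector space does not depend on \<open>m\<close>, and its lattice consists of the
  elements of \<open>L\<close> in that space.
\<close>

definition Im_variety :: "'v pav \<Rightarrow> ('v \<Rightarrow> 'v) \<Rightarrow> 'v pav" where
  "Im_variety A f = A\<lparr>pspace := f ` pspace A, plat := plat A \<inter> f ` pspace A\<rparr>"

text \<open>
  The symmetric idempotent \<open>\<epsilon>\<^sub>Y = \<iota> \<phi>\<^bsub>\<iota>*\<L>\<^esub>\<^sup>-\<^sup>1 \<iota>\<^sup>^ \<phi>\<^sub>\<L>\<close> of an abelian subvariety \<open>\<iota> : Y \<rightarrow> A\<close> (its norm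
  endomorphism divided by its exponent). The subvariety complementary to \<open>Y\<close> is the image of
  \<open>1 - \<epsilon>\<^sub>Y\<close>.
\<close>

definition norm_idempotent :: "'v pav \<Rightarrow> 'v pav \<Rightarrow> 'v \<Rightarrow> 'v" where
  "norm_idempotent A Y = (\<lambda>v\<in>pspace A. phi_pol_inv Y (restrict (phi_form A (pform A) v) (pspace Y)))"

definition complementary_subvarieties ::
  "'v::complex_vector pav \<Rightarrow> 'v pav \<Rightarrow> 'v pav \<Rightarrow> bool" where
  "complementary_subvarieties A Y Y' \<longleftrightarrow> abelian_subvariety A Y \<and> abelian_subvariety A Y' \<and>
     Y' = Im_variety A (one_minus A (norm_idempotent A Y)) \<and>
     Y = Im_variety A (one_minus A (norm_idempotent A Y'))"

definition A_omega :: "'v::complex_vector pav \<Rightarrow> 'v list \<Rightarrow> ext_form \<Rightarrow> 'v pav" where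
  "A_omega A bs \<omega> = Im_variety A (varphi A (form_of A bs \<omega>))"

definition A_omega_c :: "'v::complex_vector pav \<Rightarrow> 'v list \<Rightarrow> ext_form \<Rightarrow> 'v pav" where
  "A_omega_c A bs \<omega> = Im_variety A (one_minus A (varphi A (form_of A bs \<omega>)))"

section \<open>Isogenies\<close>

definition torus_group :: "'v::ab_group_add pav \<Rightarrow> 'v set monoid" where
  "torus_group A = \<lparr>carrier = pspace A, monoid.mult = (+), one = 0\<rparr> Mod plat A"

definition isogeny ::
  "('a, 'c) monoid_scheme \<Rightarrow> ('b, 'd) monoid_scheme \<Rightarrow> ('a \<Rightarrow> 'b) \<Rightarrow> bool" where
  "isogeny G H h \<longleftrightarrow>
     h \<in> hom G H \<and> h ` carrier G = carrier H \<and> finite (kernel G H h)"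

definition product_torus :: "'v::ab_group_add pav list \<Rightarrow> (nat \<Rightarrow> 'v set) monoid" where
  "product_torus Bs = product_group {..<length Bs} (\<lambda>i. torus_group (Bs ! i))"

text \<open>
  The sum morphism \<open>B\<^sub>0 \<times> \<dots> \<times> B\<^sub>k \<rightarrow> A\<close>, \<open>(x\<^sub>i + L\<^sub>i)\<^sub>i \<mapsto> \<Sum> x\<^sub>i + L\<close>. It is induced by addition of vectors,
  so it is a morphism of complex tori as soon as it is well defined.
\<close>

definition sum_morphism :: "'v::ab_group_add pav \<Rightarrow> 'v pav list \<Rightarrow> (nat \<Rightarrow> 'v set) \<Rightarrow> 'v set" where
  "sum_morphism A Bs X =
     {(\<Sum>i<length Bs. x i) + l | x l. (\<forall>i<length Bs. x i \<in> X i) \<and> l \<in> plat A}"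

definition sum_is_isogeny :: "'v::ab_group_add pav \<Rightarrow> 'v pav list \<Rightarrow> bool" where
  "sum_is_isogeny A Bs \<longleftrightarrow> isogeny (product_torus Bs) (torus_group A) (sum_morphism A Bs)"

section \<open>The decomposition procedure\<close>

text \<open>
  A state of the procedure is a list of polarized abelian varieties, each with its type, a
  symplectic basis of its lattice and the right half of its period matrix. The choice of the
  piece, of the admissible form and of the symplectic bases is left open.
\<close>

type_synonym 'v piece = "'v pav \<times> nat list \<times> 'v list \<times> complex mat"

definition computed_piece ::
  "nat list \<Rightarrow> 'v list \<Rightarrow> complex mat \<Rightarrow> 'v::complex_vector piece \<Rightarrow> bool" where
  "computed_piece ds bs Z = (\<lambda>(B, ns, us, W).
     symplectic_basis B ns us \<and>
     (\<exists>P1 P2. P1 \<in> carrier_mat (length bs) (length ns) \<and> P2 \<in> carrier_mat (length bs) (length ns) \<and>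
        coordinate_matrix bs us (join_cols P1 P2) \<and> induced_period_eq ds Z ns P1 P2 W))"

inductive split_step :: "'v::complex_vector piece list \<Rightarrow> 'v piece list \<Rightarrow> bool" where
  split: "\<lbrakk>n \<in> dim_range (length ds); admissible ds Z n \<omega>;
     fst p = A_omega B bs \<omega>; fst q = A_omega_c B bs \<omega>;
     computed_piece ds bs Z p; computed_piece ds bs Z q\<rbrakk>
   \<Longrightarrow> split_step (xs @ [(B, ds, bs, Z)] @ ys) (xs @ [p, q] @ ys)"

definition stopped :: "'v piece list \<Rightarrow> bool" where
  "stopped S \<longleftrightarrow> (\<forall>(B, ds, bs, Z)\<in>set S.
     \<not> (\<exists>n\<in>dim_range (length ds). \<exists>\<omega>. admissible ds Z n \<omega>))"

end

theory Submission
  imports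
    Defs
    "HOL-Computational_Algebra.Fundamental_Theorem_Algebra"
    "Jordan_Normal_Form.Char_Poly"
begin

text \<open>
  A form \<open>\<mu>\<close> in the Neron-Severi space corresponds to the endomorphism \<open>f\<close> with \<open>F(f x, y) = \<mu>(x, y)\<close>,
  where \<open>F\<close> is the polarization; \<open>f\<close> is self-adjoint for the Hermitian form attached to \<open>F\<close>. In a unitary
  eigenbasis of \<open>f\<close> with eigenvalues \<open>t\<^sub>k\<close> the two forms become \<open>\<theta> = -\<Sum> E\<^sub>k\<close> and
  \<open>\<omega> = -\<Sum> t\<^sub>k E\<^sub>k\<close> with commuting \<open>E\<^sub>k\<close> of square zero, so that
  \<open>(x \<theta> - \<omega>)\<^sup>g = g! \<Prod>(t\<^sub>k - x) E\<^sub>1 \<cdots> E\<^sub>g\<close>. The equations of the criterion say that this is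
  \<open>x\<^bsup>g-n\<^esup> (x - 1)\<^sup>n \<theta>\<^sup>g\<close>, that is, that \<open>f\<close> is an idempotent of rank \<open>n\<close>. Symmetric idempotents
  correspond to pairs of complementary subvarieties through orthogonal projection, and one member of
  a complementary pair has dimension at most \<open>g / 2\<close>. The procedure refines an \<open>F\<close>-orthogonal
  decomposition into nonzero pieces, of which there are at most \<open>g\<close>.
\<close>

section \<open>The exterior algebra as a ring\<close>

text \<open>Some inputs lie behind the overview. An admissible form is only a family of rational
  coefficients; that it comes from an element of \<open>NS_rat\<close> at all is
  \<open>gamma_surjective\<close>, where the vanishing of the product with all dz forces invariance
  under multiplication by i. The scalar x in x\<theta> - \<omega> is a numerical parameter:
  evaluated at an eigenvalue it shows that an admissible form has only the eigenvalues 0 and 1, and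
  compared coefficientwise it recovers all equations of the criterion from an idempotent. The
  eigenvectors need not be rational; rationality is regained from symplectic bases of lattices,
  whose expansion formula has only the denominators d_k. Such bases are therefore constructed for
  every subvariety, which also keeps the procedure from getting stuck for want of a basis. Isogenies
  are obtained from one positive integer N with N L inside the sum of the lattices of the
  pieces.\<close>

typedef extalg = "{\<alpha> :: ext_form. \<forall>K. infinite K \<longrightarrow> \<alpha> K = 0}"
  morphisms coeff_of form_to_ext
  by (rule exI[of _ "\<lambda>_. 0"]) simp

lemma coeff_of_infinite [simp]: "infinite K \<Longrightarrow> coeff_of a K = 0"
  using coeff_of[of a] by simp

text \<open>The sum over the infinite set \<open>Pow K\<close> is 0 by convention. Hence
  \<open>ext_one\<close> is a unit only for forms that vanish at infinite index sets, and
  \<open>extalg\<close> consists of exactly these.\<close>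

lemma wedge_infinite: "infinite K \<Longrightarrow> wedge \<alpha> \<beta> K = 0"
  by (simp add: wedge_def finite_Pow_iff)

lemma extalg_eqI:
  assumes "\<And>K. finite K \<Longrightarrow> coeff_of a K = coeff_of b K"
  shows "a = b"
proof -
  have "coeff_of a K = coeff_of b K" for K
    by (cases "finite K") (simp_all add: assms)
  then show ?thesis by (metis coeff_of_inject ext)
qed

text \<open>Inversions between two sets are counted pair by pair, so the sign is multiplicative
  under disjoint unions in either argument.\<close>

lemma shuffle_sign_Un_left:
  assumes "finite I" "finite H" "finite R" "I \<inter> H = {}"
  shows "shuffle_sign (I \<union> H) R = shuffle_sign I R * shuffle_sign H R"
proof -
  have eq: "{(i, j). i \<in> I \<union> H \<and> j \<in> R \<and> j < i}
      = {(i, j). i \<in> I \<and> j \<in> R \<and> j < i} \<union> {(i, j). i \<in> H \<and> j \<in> R \<and> j < i}" by auto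
  have 1: "finite {(i, j). i \<in> I \<and> j \<in> R \<and> j < i}"
    by (rule finite_subset[of _ "I \<times> R"]) (use assms in auto)
  have 2: "finite {(i, j). i \<in> H \<and> j \<in> R \<and> j < i}"
    by (rule finite_subset[of _ "H \<times> R"]) (use assms in auto)
  have "card {(i, j). i \<in> I \<union> H \<and> j \<in> R \<and> j < i}
      = card {(i, j). i \<in> I \<and> j \<in> R \<and> j < i} + card {(i, j). i \<in> H \<and> j \<in> R \<and> j < i}"
    unfolding eq by (rule card_Un_disjoint[OF 1 2]) (use assms in auto)
  then show ?thesis unfolding shuffle_sign_def by (simp add: power_add)
qed

lemma shuffle_sign_Un_right:
  assumes "finite I" "finite H" "finite R" "I \<inter> H = {}"
  shows "shuffle_sign R (I \<union> H) = shuffle_sign R I * shuffle_sign R H"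
proof -
  have eq: "{(i, j). i \<in> R \<and> j \<in> I \<union> H \<and> j < i}
      = {(i, j). i \<in> R \<and> j \<in> I \<and> j < i} \<union> {(i, j). i \<in> R \<and> j \<in> H \<and> j < i}" by auto
  have 1: "finite {(i, j). i \<in> R \<and> j \<in> I \<and> j < i}"
    by (rule finite_subset[of _ "R \<times> I"]) (use assms in auto)
  have 2: "finite {(i, j). i \<in> R \<and> j \<in> H \<and> j < i}"
    by (rule finite_subset[of _ "R \<times> H"]) (use assms in auto)
  have "card {(i, j). i \<in> R \<and> j \<in> I \<union> H \<and> j < i}
      = card {(i, j). i \<in> R \<and> j \<in> I \<and> j < i} + card {(i, j). i \<in> R \<and> j \<in> H \<and> j < i}"
    unfolding eq by (rule card_Un_disjoint[OF 1 2]) (use assms in auto)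
  then show ?thesis unfolding shuffle_sign_def by (simp add: power_add)
qed

text \<open>Both sides are sums over the ordered partitions of K into three sets H, G, R, and either
  way the sign is the product of the three pairwise signs.\<close>

lemma wedge_assoc_aux:
  assumes K: "finite K"
  shows "wedge (wedge \<alpha> \<beta>) \<gamma> K = wedge \<alpha> (wedge \<beta> \<gamma>) K"
proof -
  let ?s = "shuffle_sign"
  have fin: "finite I" if "I \<subseteq> K" for I using that K finite_subset by blast
  have "wedge (wedge \<alpha> \<beta>) \<gamma> K
     = (\<Sum>I\<in>Pow K. \<Sum>H\<in>Pow I. ?s I (K - I) * (?s H (I - H) * \<alpha> H * \<beta> (I - H)) * \<gamma> (K - I))"
    unfolding wedge_def by (simp add: sum_distrib_left sum_distrib_right)
  also have "\<dots> = (\<Sum>(I, H)\<in>Sigma (Pow K) Pow.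
       ?s I (K - I) * (?s H (I - H) * \<alpha> H * \<beta> (I - H)) * \<gamma> (K - I))"
    by (rule sum.Sigma) (use K fin in auto)
  also have "\<dots> = (\<Sum>(H, G)\<in>Sigma (Pow K) (\<lambda>H. Pow (K - H)).
       ?s H (K - H) * \<alpha> H * (?s G (K - H - G) * \<beta> G * \<gamma> (K - H - G)))"
  proof (rule sum.reindex_bij_witness[where i = "\<lambda>(H, G). (H \<union> G, H)" and j = "\<lambda>(I, H). (H, I - H)"])
    fix p assume "p \<in> Sigma (Pow K) Pow"
    then obtain I H where p: "p = (I, H)" "I \<subseteq> K" "H \<subseteq> I" by auto
    define G R where "G = I - H" and "R = K - I"
    have s: "I = H \<union> G" "K - H = G \<union> R" "K - H - G = R" "H \<inter> G = {}" "G \<inter> R = {}" "I - H = G" "K - I = R"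
      using p by (auto simp: G_def R_def)
    have f: "finite G" "finite H" "finite R" using p fin K unfolding G_def R_def by (meson finite_Diff finite_subset)+
    have "?s (H \<union> G) R * ?s H G = ?s H (G \<union> R) * ?s G R"
      using s f by (simp add: shuffle_sign_Un_left shuffle_sign_Un_right)
    then have "?s I R * (?s H G * \<alpha> H * \<beta> G) * \<gamma> R = ?s H (G \<union> R) * \<alpha> H * (?s G R * \<beta> G * \<gamma> R)"
      unfolding s(1) by (metis (no_types, lifting) mult.assoc mult.left_commute)
    then show "(case case p of (I, H) \<Rightarrow> (H, I - H) of (H, G) \<Rightarrow>
         ?s H (K - H) * \<alpha> H * (?s G (K - H - G) * \<beta> G * \<gamma> (K - H - G))) =
      (case p of (I, H) \<Rightarrow> ?s I (K - I) * (?s H (I - H) * \<alpha> H * \<beta> (I - H)) * \<gamma> (K - I))"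
      unfolding p(1) prod.case s(6,7) s(3) unfolding s(2) by (rule sym)
  qed auto
  also have "\<dots> = (\<Sum>H\<in>Pow K. \<Sum>G\<in>Pow (K - H).
       ?s H (K - H) * \<alpha> H * (?s G (K - H - G) * \<beta> G * \<gamma> (K - H - G)))"
    by (rule sum.Sigma[symmetric]) (use K fin in auto)
  also have "\<dots> = wedge \<alpha> (wedge \<beta> \<gamma>) K"
    unfolding wedge_def by (simp add: sum_distrib_left)
  finally show ?thesis .
qed

lemma wedge_ext_one_left: "finite K \<Longrightarrow> wedge ext_one \<alpha> K = \<alpha> K"
proof -
  assume K: "finite K"
  have "wedge ext_one \<alpha> K = (\<Sum>I\<in>{{}}. shuffle_sign I (K - I) * ext_one I * \<alpha> (K - I))"
    unfolding wedge_def by (rule sum.mono_neutral_right) (use K in \<open>auto simp: ext_one_def\<close>)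
  then show ?thesis by (simp add: ext_one_def shuffle_sign_def)
qed

lemma wedge_ext_one_right: "finite K \<Longrightarrow> wedge \<alpha> ext_one K = \<alpha> K"
proof -
  assume K: "finite K"
  have "wedge \<alpha> ext_one K = (\<Sum>I\<in>{K}. shuffle_sign I (K - I) * \<alpha> I * ext_one (K - I))"
    unfolding wedge_def by (rule sum.mono_neutral_right) (use K in \<open>auto simp: ext_one_def\<close>)
  then show ?thesis by (simp add: ext_one_def shuffle_sign_def)
qed

text \<open>The ring is not commutative, as the dx anticommute; commutation of two-forms is proved
  separately.\<close>

instantiation extalg :: ring_1
begin

definition "0 = form_to_ext (\<lambda>_. 0)"
definition "1 = form_to_ext ext_one"
definition "a + b = form_to_ext (\<lambda>K. coeff_of a K + coeff_of b K)"
definition "a - b = form_to_ext (\<lambda>K. coeff_of a K - coeff_of b K)"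
definition "- a = form_to_ext (\<lambda>K. - coeff_of a K)"
definition "a * b = form_to_ext (wedge (coeff_of a) (coeff_of b))"

lemma coeff_of_simps [simp]:
  "coeff_of 0 = (\<lambda>_. 0)"
  "coeff_of 1 = ext_one"
  "coeff_of (a + b) = (\<lambda>K. coeff_of a K + coeff_of b K)"
  "coeff_of (a - b) = (\<lambda>K. coeff_of a K - coeff_of b K)"
  "coeff_of (- a) = (\<lambda>K. - coeff_of a K)"
  "coeff_of (a * b) = wedge (coeff_of a) (coeff_of b)"
  unfolding zero_extalg_def one_extalg_def plus_extalg_def minus_extalg_def uminus_extalg_def
    times_extalg_def
  by (simp_all add: form_to_ext_inverse wedge_infinite ext_one_def)

instance
proof
  fix a b c :: extalg
  show "a * b * c = a * (b * c)" by (rule extalg_eqI) (simp add: wedge_assoc_aux)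
  show "1 * a = a" by (rule extalg_eqI) (simp add: wedge_ext_one_left)
  show "a * 1 = a" by (rule extalg_eqI) (simp add: wedge_ext_one_right)
  show "(a + b) * c = a * c + b * c"
    by (rule extalg_eqI) (simp add: wedge_def algebra_simps sum.distrib)
  show "a * (b + c) = a * b + a * c"
    by (rule extalg_eqI) (simp add: wedge_def algebra_simps sum.distrib)
  show "(0::extalg) \<noteq> 1"
  proof
    assume "(0::extalg) = 1"
    then have "coeff_of 0 {} = coeff_of 1 {}" by simp
    then show False by (simp add: ext_one_def)
  qed
qed (rule extalg_eqI; simp)+

end

section \<open>Scalars, basis forms and monomials\<close>

definition ext_const :: "complex \<Rightarrow> extalg" where
  "ext_const c = form_to_ext (\<lambda>K. if K = {} then c else 0)"

lemma coeff_of_const: "coeff_of (ext_const c) = (\<lambda>K. if K = {} then c else 0)"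
  unfolding ext_const_def by (rule form_to_ext_inverse) auto

lemma coeff_of_const_mult [simp]: "coeff_of (ext_const c * a) = (\<lambda>K. c * coeff_of a K)"
proof
  fix K
  show "coeff_of (ext_const c * a) K = c * coeff_of a K"
  proof (cases "finite K")
    case True
    have "wedge (coeff_of (ext_const c)) (coeff_of a) K
        = (\<Sum>I\<in>{{}}. shuffle_sign I (K - I) * coeff_of (ext_const c) I * coeff_of a (K - I))"
      unfolding wedge_def
      by (rule sum.mono_neutral_right) (use True in \<open>auto simp: coeff_of_const\<close>)
    then show ?thesis by (simp add: coeff_of_const shuffle_sign_def)
  qed (simp add: wedge_infinite)
qed

text \<open>Scalars enter as forms of degree 0 instead of through a module structure; being central,
  they can be moved to the front of any product.\<close>

lemma ext_const_commute: "a * ext_const c = ext_const c * a"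
proof (rule extalg_eqI)
  fix K :: "nat set" assume K: "finite K"
  have "wedge (coeff_of a) (coeff_of (ext_const c)) K
      = (\<Sum>I\<in>{K}. shuffle_sign I (K - I) * coeff_of a I * coeff_of (ext_const c) (K - I))"
    unfolding wedge_def
    by (rule sum.mono_neutral_right) (use K in \<open>auto simp: coeff_of_const\<close>)
  also have "\<dots> = c * coeff_of a K"
    by (simp add: coeff_of_const shuffle_sign_def)
  finally show "coeff_of (a * ext_const c) K = coeff_of (ext_const c * a) K"
    unfolding coeff_of_const_mult by simp
qed

lemma ext_const_left_commute: "a * (ext_const c * b) = ext_const c * (a * b)"
  by (metis ext_const_commute mult.assoc)

lemma ext_const_simps:
  "ext_const 0 = 0" "ext_const 1 = 1" "ext_const (c + d) = ext_const c + ext_const d"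
  "ext_const (- c) = - ext_const c" "ext_const (c - d) = ext_const c - ext_const d"
  "ext_const (c * d) = ext_const c * ext_const d"
proof -
  show "ext_const (c * d) = ext_const c * ext_const d"
    by (rule extalg_eqI) (simp only: coeff_of_const_mult, simp add: coeff_of_const)
qed (rule extalg_eqI; simp add: coeff_of_const ext_one_def)+

lemma ext_const_of_nat: "ext_const (of_nat n) = of_nat n"
  by (induction n) (simp_all add: ext_const_simps)

lemma ext_const_sum: "ext_const (sum f A) = (\<Sum>i\<in>A. ext_const (f i))"
  by (induction A rule: infinite_finite_induct) (simp_all add: ext_const_simps)

lemma coeff_of_sum: "coeff_of (sum f A) K = (\<Sum>i\<in>A. coeff_of (f i) K)"
  by (induction A rule: infinite_finite_induct) simp_all

lemma coeff_of_prod_list: "coeff_of (prod_list as) = wedge_list (map coeff_of as)"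
  by (induction as) (simp_all add: wedge_list_def)

lemma coeff_of_power: "coeff_of (a ^ r) = wedge_power (coeff_of a) r"
  by (induction r) (simp_all add: wedge_power_def wedge_list_def)

definition ext_dx :: "nat \<Rightarrow> extalg" where
  "ext_dx i = form_to_ext (dx i)"

lemma coeff_of_dx [simp]: "coeff_of (ext_dx i) = dx i"
  unfolding ext_dx_def by (rule form_to_ext_inverse) (auto simp: dx_def)

text \<open>The conjunct \<open>finite S\<close> makes the function a member of
  \<open>extalg\<close> for every S.\<close>

definition monomial_at :: "nat set \<Rightarrow> complex \<Rightarrow> extalg" where
  "monomial_at S c = form_to_ext (\<lambda>K. if K = S \<and> finite S then c else 0)"

lemma coeff_of_monomial: "finite S \<Longrightarrow> coeff_of (monomial_at S c) = (\<lambda>K. if K = S then c else 0)"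
  unfolding monomial_at_def by (subst form_to_ext_inverse) auto

lemma ext_dx_times_monomial:
  assumes "finite S"
  shows "ext_dx i * monomial_at S c =
    (if i \<in> S then 0 else monomial_at (insert i S) (shuffle_sign {i} S * c))"
proof (rule extalg_eqI)
  fix K :: "nat set" assume K: "finite K"
  have sum0: "wedge (dx i) (\<lambda>K. if K = S then c else 0) K
     = (\<Sum>I\<in>Pow K. if I = {i} \<and> K - {i} = S then shuffle_sign {i} S * c else 0)"
    unfolding wedge_def dx_def by (rule sum.cong) auto
  also have "\<dots> = (if {i} \<in> Pow K \<and> K - {i} = S then shuffle_sign {i} S * c else 0)"
    using K by (cases "K - {i} = S") (simp_all)
  also have "\<dots> = (if i \<notin> S \<and> K = insert i S then shuffle_sign {i} S * c else 0)"
    by (rule if_cong) auto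
  finally show "coeff_of (ext_dx i * monomial_at S c) K = coeff_of
    (if i \<in> S then 0 else monomial_at (insert i S) (shuffle_sign {i} S * c)) K"
    using assms by (simp add: coeff_of_monomial)
qed

lemma ext_dx_monomial: "ext_dx i = monomial_at {i} 1"
  by (rule extalg_eqI) (simp add: coeff_of_monomial dx_def)

lemma ext_dx_square: "ext_dx i * ext_dx i = 0"
  by (subst (2) ext_dx_monomial) (simp add: ext_dx_times_monomial)

lemma shuffle_sign_singletons: "shuffle_sign {i} {j} = (if j < i then -1 else 1)"
proof -
  have "{(a, b). a \<in> {i} \<and> b \<in> {j} \<and> b < a} = (if j < i then {(i, j)} else {})" by auto
  then show ?thesis unfolding shuffle_sign_def by simp
qed

lemma ext_dx_anticommute: "ext_dx i * ext_dx j = - (ext_dx j * ext_dx i)"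
proof (cases "i = j")
  case True then show ?thesis by (simp add: ext_dx_square)
next
  case False
  have "ext_dx i * ext_dx j = monomial_at {i, j} (shuffle_sign {i} {j})"
    using False by (subst (2) ext_dx_monomial) (simp add: ext_dx_times_monomial)
  moreover have "ext_dx j * ext_dx i = monomial_at {i, j} (shuffle_sign {j} {i})"
    using False by (subst (2) ext_dx_monomial) (simp add: ext_dx_times_monomial insert_commute)
  moreover have "monomial_at {i, j} (- c) = - monomial_at {i, j} c" for c
    by (rule extalg_eqI) (simp add: coeff_of_monomial)
  ultimately show ?thesis using False
    by (auto simp: shuffle_sign_singletons)
qed

text \<open>The constant is a product of shuffle signs. Its value is left open, because the lemma
  serves to show that \<theta>^g is nonzero.\<close>

lemma prod_list_dx:
  "distinct is \<Longrightarrow> \<exists>c. c \<noteq> 0 \<and> prod_list (map ext_dx is) = monomial_at (set is) c"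
proof (induction "is")
  case Nil
  have "(1 :: extalg) = monomial_at {} 1"
    by (rule extalg_eqI) (simp add: coeff_of_monomial ext_one_def)
  then show ?case by (intro exI[of _ 1]) simp
next
  case (Cons i "is")
  then obtain c where "c \<noteq> 0" "prod_list (map ext_dx is) = monomial_at (set is) c" by auto
  with Cons.prems show ?case
    by (intro exI[of _ "shuffle_sign {i} (set is) * c"])
      (simp add: ext_dx_times_monomial, simp add: shuffle_sign_def)
qed

lemma monomial_at_nonzero: "finite S \<Longrightarrow> c \<noteq> 0 \<Longrightarrow> monomial_at S c \<noteq> 0"
  by (metis coeff_of_monomial coeff_of_simps(1))

section \<open>Linear forms and two-forms with constant coefficients\<close>

definition one_form :: "nat \<Rightarrow> (nat \<Rightarrow> complex) \<Rightarrow> extalg" where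
  "one_form N c = (\<Sum>i<N. ext_const (c i) * ext_dx i)"

definition ext_two_form :: "nat \<Rightarrow> (nat \<Rightarrow> nat \<Rightarrow> complex) \<Rightarrow> extalg" where
  "ext_two_form N a = (\<Sum>i<N. \<Sum>j\<in>{i<..<N}. ext_const (a i j) * (ext_dx i * ext_dx j))"

lemma coeff_of_two_form: "coeff_of (ext_two_form N a) = two_form N a"
  by (rule ext) (simp add: ext_two_form_def two_form_def coeff_of_sum coeff_of_const_mult
     del: coeff_of_simps(6), simp)

lemma ext_two_form_linear:
  "ext_two_form N (\<lambda>i j. a i j + b i j) = ext_two_form N a + ext_two_form N b"
  "ext_two_form N (\<lambda>i j. c * a i j) = ext_const c * ext_two_form N a"
  "ext_two_form N (\<lambda>i j. - a i j) = - ext_two_form N a"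
  by (simp_all add: ext_two_form_def ext_const_simps sum.distrib sum_negf distrib_right
     sum_distrib_left mult.assoc)

lemma ext_two_form_sum:
  "ext_two_form N (\<lambda>i j. \<Sum>k\<in>S. a k i j) = (\<Sum>k\<in>S. ext_two_form N (a k))"
proof (induction S rule: infinite_finite_induct)
  case (insert x F)
  then show ?case by (simp add: ext_two_form_linear)
qed (simp_all add: ext_two_form_def ext_const_simps)

text \<open>Pairs the entry at (i, j) with the one at (j, i). This turns double sums over all index
  pairs into the shape of \<open>ext_two_form\<close>, which runs over i < j.\<close>

lemma sum_off_diagonal:
  fixes f :: "nat \<Rightarrow> nat \<Rightarrow> 'a::ab_group_add"
  assumes "\<And>i. i < N \<Longrightarrow> f i i = 0"
  shows "(\<Sum>i<N. \<Sum>j<N. f i j) = (\<Sum>i<N. \<Sum>j\<in>{i<..<N}. f i j + f j i)"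
proof -
  have "(\<Sum>i<N. \<Sum>j<N. f i j) = (\<Sum>i<N. (\<Sum>j\<in>{i<..<N}. f i j) + (\<Sum>j\<in>{..<i}. f i j))"
  proof (rule sum.cong[OF refl])
    fix i assume i: "i \<in> {..<N}"
    then have "{..<N} = insert i ({i<..<N} \<union> {..<i})" by auto
    moreover have "(\<Sum>j\<in>{i<..<N} \<union> {..<i}. f i j) = (\<Sum>j\<in>{i<..<N}. f i j) + (\<Sum>j\<in>{..<i}. f i j)"
      by (rule sum.union_disjoint) auto
    ultimately have "(\<Sum>j<N. f i j) = f i i + ((\<Sum>j\<in>{i<..<N}. f i j) + (\<Sum>j\<in>{..<i}. f i j))"
      by (simp del: sum.lessThan_Suc)
    then show "(\<Sum>j<N. f i j) = (\<Sum>j\<in>{i<..<N}. f i j) + (\<Sum>j\<in>{..<i}. f i j)"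
      using assms i by simp
  qed
  moreover have "(\<Sum>i<N. \<Sum>j\<in>{..<i}. f i j) = (\<Sum>j<N. \<Sum>i\<in>{j<..<N}. f i j)"
    by (subst (1 2) sum.Sigma; (simp; fail)?)
      (rule sum.reindex_bij_witness[where i = prod.swap and j = prod.swap]; auto)
  ultimately show ?thesis by (simp add: sum.distrib)
qed

lemma one_form_mult:
  "one_form N c * one_form N d = ext_two_form N (\<lambda>i j. c i * d j - c j * d i)"
proof -
  have "one_form N c * one_form N d
      = (\<Sum>i<N. \<Sum>j<N. ext_const (c i * d j) * (ext_dx i * ext_dx j))"
    unfolding one_form_def sum_product
    by (intro sum.cong refl)
      (simp only: ext_const_simps(6) mult.assoc ext_const_left_commute[of "ext_dx _"])
  also have "\<dots> = (\<Sum>i<N. \<Sum>j\<in>{i<..<N}. ext_const (c i * d j) * (ext_dx i * ext_dx j)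
       + ext_const (c j * d i) * (ext_dx j * ext_dx i))"
    by (rule sum_off_diagonal) (simp add: ext_dx_square)
  also have "\<dots> = ext_two_form N (\<lambda>i j. c i * d j - c j * d i)"
    unfolding ext_two_form_def
  proof (intro sum.cong refl)
    fix i j
    show "ext_const (c i * d j) * (ext_dx i * ext_dx j) + ext_const (c j * d i) * (ext_dx j * ext_dx i)
      = ext_const (c i * d j - c j * d i) * (ext_dx i * ext_dx j)"
      by (subst ext_dx_anticommute[of j i]) (simp add: ext_const_simps(5) left_diff_distrib)
  qed
  finally show ?thesis .
qed

lemma one_form_square: "one_form N c * one_form N c = 0"
  by (simp add: one_form_mult ext_two_form_def ext_const_simps mult.commute)

lemma one_form_linear:
  "one_form N (\<lambda>i. c i + d i) = one_form N c + one_form N d"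
  "one_form N (\<lambda>i. x * c i) = ext_const x * one_form N c"
  by (simp_all add: one_form_def ext_const_simps sum.distrib distrib_right sum_distrib_left mult.assoc)

lemma one_form_sum: "one_form N (\<lambda>i. \<Sum>k\<in>S. c k i) = (\<Sum>k\<in>S. one_form N (c k))"
proof (induction S rule: infinite_finite_induct)
  case (insert x F) then show ?case by (simp add: one_form_linear)
qed (simp_all add: one_form_def ext_const_simps)

text \<open>Polarization of \<open>one_form_square\<close>, applied to the sum of the two linear
  forms.\<close>

lemma one_form_anticommute: "one_form N c * one_form N d = - (one_form N d * one_form N c)"
proof -
  have "0 = one_form N (\<lambda>i. c i + d i) * one_form N (\<lambda>i. c i + d i)"
    by (simp only: one_form_square)
  also have "\<dots> = one_form N c * one_form N d + one_form N d * one_form N c"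
    by (simp add: one_form_linear algebra_simps one_form_square)
  finally show ?thesis by (metis eq_neg_iff_add_eq_0)
qed

lemma ext_dx_one_form: "i < N \<Longrightarrow> ext_dx i = one_form N (\<lambda>j. if j = i then 1 else 0)"
proof -
  assume "i < N"
  have "one_form N (\<lambda>j. if j = i then 1 else 0) = (\<Sum>j<N. if j = i then ext_dx i else 0)"
    unfolding one_form_def by (intro sum.cong) (auto simp: ext_const_simps)
  then show ?thesis using \<open>i < N\<close> by simp
qed

text \<open>The factor belonging to \<open>c\<close> is moved to the right by anticommutation until
  it meets its own copy, where the square vanishes.\<close>

lemma one_form_times_prod_list:
  assumes "c \<in> set cs"
  shows "one_form N c * prod_list (map (one_form N) cs) = 0"
  using assms
proof (induction cs)
  case (Cons d cs)
  show ?case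
  proof (cases "d = c")
    case True
    then show ?thesis by (simp add: mult.assoc[symmetric] one_form_square)
  next
    case False
    then have "one_form N c * prod_list (map (one_form N) cs) = 0" using Cons by simp
    moreover have "one_form N c * prod_list (map (one_form N) (d # cs))
        = - (one_form N d * (one_form N c * prod_list (map (one_form N) cs)))"
      by (simp add: mult.assoc[symmetric] one_form_anticommute[of N c d])
    ultimately show ?thesis by simp
  qed
qed simp

section \<open>Powers of sums of commuting elements\<close>

lemma commuting_power_add_square_zero:
  fixes a e :: "'a::ring_1"
  assumes "a * e = e * a" "e * e = 0"
  shows "(a + e) ^ Suc m = a ^ Suc m + of_nat (Suc m) * (a ^ m * e)"
proof (induction m)
  case (Suc m)
  have ae: "a * (a ^ m * e) = a ^ Suc m * e" by (simp only: power_Suc mult.assoc)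
  have ee: "e * (a ^ m * e) = 0"
  proof -
    have "e * (a ^ m * e) = a ^ m * (e * e)"
      using power_commuting_commutes[OF assms(1), of m] by (metis mult.assoc)
    then show ?thesis by (simp add: assms)
  qed
  have c: "e * a ^ Suc m = a ^ Suc m * e"
    using power_commuting_commutes[OF assms(1), of "Suc m"] by (rule sym)
  have n: "x * (of_nat (Suc m) * y) = of_nat (Suc m) * (x * y)" for x y :: 'a
    by (metis mult.assoc mult_of_nat_commute)
  have "(a + e) ^ Suc (Suc m) = (a + e) * (a ^ Suc m + of_nat (Suc m) * (a ^ m * e))"
    unfolding Suc[symmetric] by (rule power_Suc)
  also have "\<dots> = a * a ^ Suc m + e * a ^ Suc m
     + (of_nat (Suc m) * (a * (a ^ m * e)) + of_nat (Suc m) * (e * (a ^ m * e)))"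
    unfolding distrib_left distrib_right n by (simp only: add.assoc add.left_commute add.commute)
  also have "\<dots> = a ^ Suc (Suc m) + (1 + of_nat (Suc m)) * (a ^ Suc m * e)"
    unfolding ae ee c by (simp only: power_Suc[of a "Suc m"] distrib_right mult_1 mult_zero_right add_0_right add.assoc)
  also have "1 + of_nat (Suc m) = (of_nat (Suc (Suc m)) :: 'a)" by simp
  finally show ?case .
qed simp

text \<open>Only products of distinct E_k survive, and each of the m! orderings contributes the same
  product. The vanishing of the next power is proved along with it, because in the induction step it
  removes the (m+1)-st power of the old sum.\<close>

lemma commuting_sum_power:
  fixes E :: "nat \<Rightarrow> extalg"
  assumes com: "\<And>i j. E i * E j = E j * E i" and sq: "\<And>i. E i * E i = 0"
  shows "(\<Sum>k<m. ext_const (s k) * E k) ^ m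
           = ext_const (fact m * (\<Prod>k<m. s k)) * prod_list (map E [0..<m])
       \<and> (\<Sum>k<m. ext_const (s k) * E k) ^ Suc m = 0"
proof (induction m)
  case 0 then show ?case by (simp add: ext_const_simps)
next
  case (Suc m)
  define a where "a = (\<Sum>k<m. ext_const (s k) * E k)"
  define e where "e = ext_const (s m) * E m"
  have ee: "e * e = 0" unfolding e_def
    by (simp add: mult.assoc ext_const_left_commute[of "E m"] sq)
  have "ext_const (s k) * E k * e = e * (ext_const (s k) * E k)" for k unfolding e_def
    by (metis com ext_const_left_commute mult.assoc)
  then have ae: "a * e = e * a"
    unfolding a_def by (simp add: sum_distrib_left sum_distrib_right)
  have IH: "a ^ m = ext_const (fact m * (\<Prod>k<m. s k)) * prod_list (map E [0..<m])" "a ^ Suc m = 0"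
    using Suc unfolding a_def by auto
  have S: "(\<Sum>k<Suc m. ext_const (s k) * E k) = a + e" by (simp add: a_def e_def)
  have "(a + e) ^ Suc m = of_nat (Suc m) * (a ^ m * e)"
    using commuting_power_add_square_zero[OF ae ee, of m] IH by simp
  also have "\<dots> = ext_const (of_nat (Suc m)) * (ext_const (fact m * (\<Prod>k<m. s k)) *
      (prod_list (map E [0..<m]) * (ext_const (s m) * E m)))"
    unfolding IH ext_const_of_nat e_def by (simp only: mult.assoc)
  also have "\<dots> = ext_const (of_nat (Suc m) * (fact m * (\<Prod>k<m. s k)) * s m) *
      (prod_list (map E [0..<m]) * E m)"
    by (simp only: ext_const_left_commute[of "prod_list (map E [0..<m])"] ext_const_simps mult.assoc)
  also have "of_nat (Suc m) * (fact m * (\<Prod>k<m. s k)) * s m = fact (Suc m) * (\<Prod>k<Suc m. s k)"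
    by (simp only: fact_Suc prod.lessThan_Suc mult.assoc of_nat_mult)
  also have "prod_list (map E [0..<m]) * E m = prod_list (map E [0..<Suc m])"
    by simp
  finally have 1: "(a + e) ^ Suc m
      = ext_const (fact (Suc m) * (\<Prod>k<Suc m. s k)) * prod_list (map E [0..<Suc m])" .
  have "a ^ Suc (Suc m) = 0" using IH(2) by (metis mult_zero_right power_Suc)
  then have "(a + e) ^ Suc (Suc m) = 0"
    using commuting_power_add_square_zero[OF ae ee, of "Suc m"] IH(2) by simp
  with 1 show ?case by (simp only: S)
qed

text \<open>In a noncommutative ring the binomial formula holds for a commuting pair; it will be
  applied to x\<theta> and -\<omega>.\<close>

lemma commuting_binomial:
  fixes a b :: "'a::ring_1"
  assumes ab: "a * b = b * a"
  shows "(a + b) ^ m = (\<Sum>r\<le>m. of_nat (m choose r) * (b ^ r * a ^ (m - r)))"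
proof (induction m)
  case (Suc m)
  let ?t = "\<lambda>r. b ^ r * a ^ (Suc m - r)"
  have ba: "a * b ^ r = b ^ r * a" for r
    using power_commuting_commutes[of b a r] ab by simp
  have n: "x * (of_nat k * y) = of_nat k * (x * y)" for x y :: 'a and k
    by (metis mult.assoc mult_of_nat_commute)
  have "(a + b) ^ Suc m = (\<Sum>r\<le>m. of_nat (m choose r) * (a * (b ^ r * a ^ (m - r))))
       + (\<Sum>r\<le>m. of_nat (m choose r) * (b * (b ^ r * a ^ (m - r))))"
    unfolding power_Suc Suc distrib_right sum_distrib_left n
    by (simp only: distrib_left sum.distrib)
  also have "(\<Sum>r\<le>m. of_nat (m choose r) * (a * (b ^ r * a ^ (m - r)))) = (\<Sum>r\<le>m. of_nat (m choose r) * ?t r)"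
  proof (intro sum.cong refl)
    fix r assume "r \<in> {..m}"
    then have "?t r = b ^ r * (a * a ^ (m - r))" by (simp add: Suc_diff_le)
    moreover have "a * (b ^ r * a ^ (m - r)) = b ^ r * (a * a ^ (m - r))"
      by (simp only: mult.assoc[symmetric] ba)
    ultimately show "of_nat (m choose r) * (a * (b ^ r * a ^ (m - r))) = of_nat (m choose r) * ?t r"
      by (simp only:)
  qed
  also have "\<dots> = (\<Sum>r\<le>Suc m. of_nat (m choose r) * ?t r)" by (simp add: binomial_eq_0)
  also have "\<dots> = ?t 0 + (\<Sum>r\<le>m. of_nat (m choose Suc r) * ?t (Suc r))"
    by (subst sum.atMost_Suc_shift) simp
  also have "(\<Sum>r\<le>m. of_nat (m choose r) * (b * (b ^ r * a ^ (m - r))))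
      = (\<Sum>r\<le>m. of_nat (m choose r) * ?t (Suc r))"
    by (simp only: power_Suc mult.assoc diff_Suc_Suc)
  finally have "(a + b) ^ Suc m = ?t 0 + ((\<Sum>r\<le>m. of_nat (m choose Suc r) * ?t (Suc r))
      + (\<Sum>r\<le>m. of_nat (m choose r) * ?t (Suc r)))"
    by (simp only: add.assoc)
  also have "(\<Sum>r\<le>m. of_nat (m choose Suc r) * ?t (Suc r)) + (\<Sum>r\<le>m. of_nat (m choose r) * ?t (Suc r))
      = (\<Sum>r\<le>m. of_nat (Suc m choose Suc r) * ?t (Suc r))"
    unfolding binomial_Suc_Suc of_nat_add distrib_right sum.distrib by (rule add.commute)
  also have "?t 0 + \<dots> = (\<Sum>r\<le>Suc m. of_nat (Suc m choose r) * ?t r)"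
    unfolding sum.atMost_Suc_shift by (simp only: binomial_n_0 of_nat_1 mult_1)
  finally show ?case .
qed simp

section \<open>Lattices\<close>

text \<open>Set version of \<open>is_lattice_basis\<close>: membership is integrality of
  coordinates, which suits induction over the basis. The lattice 0 has the empty basis.\<close>

definition zbasis :: "'v::real_vector set \<Rightarrow> 'v set \<Rightarrow> bool" where
  "zbasis L B \<longleftrightarrow> finite B \<and> independent B \<and>
     (\<forall>x. x \<in> L \<longleftrightarrow> x \<in> span B \<and> (\<forall>b\<in>B. representation B x b \<in> \<int>))"

lemma representation_sum_basis:
  assumes "finite B" "independent B" "b \<in> B"
  shows "representation B (\<Sum>x\<in>B. c x *\<^sub>R x) b = c b"
proof -
  have "representation B (\<Sum>x\<in>B. c x *\<^sub>R x) b = (\<Sum>x\<in>B. c x * representation B x b)"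
    using assms
    by (subst real_vector.representation_sum)
      (auto intro: sum.cong real_vector.span_scale real_vector.span_base simp: real_vector.representation_scale real_vector.span_base)
  also have "\<dots> = (\<Sum>x\<in>B. if x = b then c b else 0)"
    using assms by (intro sum.cong) (auto simp: real_vector.representation_basis)
  finally show ?thesis using assms by simp
qed

lemma sum_representation:
  assumes "finite B" "independent B" "x \<in> span B"
  shows "(\<Sum>b\<in>B. representation B x b *\<^sub>R b) = x"
  using assms by (intro real_vector.sum_representation_eq) auto

lemma zbasis_range:
  assumes "finite B" "independent B"
  shows "zbasis L B \<longleftrightarrow> L = range (\<lambda>c :: 'v::real_vector \<Rightarrow> int. \<Sum>b\<in>B. real_of_int (c b) *\<^sub>R b)"
    (is "_ \<longleftrightarrow> L = ?R")
proof -
  have "x \<in> ?R \<longleftrightarrow> x \<in> span B \<and> (\<forall>b\<in>B. representation B x b \<in> \<int>)" for x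
  proof
    assume "x \<in> ?R"
    then obtain c where x: "x = (\<Sum>b\<in>B. real_of_int (c b) *\<^sub>R b)" by auto
    show "x \<in> span B \<and> (\<forall>b\<in>B. representation B x b \<in> \<int>)"
      unfolding x
      by (auto simp: representation_sum_basis[OF assms]
          intro: real_vector.span_sum real_vector.span_scale real_vector.span_base)
  next
    assume r: "x \<in> span B \<and> (\<forall>b\<in>B. representation B x b \<in> \<int>)"
    have "x = (\<Sum>b\<in>B. real_of_int \<lfloor>representation B x b\<rfloor> *\<^sub>R b)"
      using r by (subst sum_representation[symmetric, of B x]) (auto intro!: sum.cong simp: assms)
    then show "x \<in> ?R" by (intro range_eqI[where x = "\<lambda>b. \<lfloor>representation B x b\<rfloor>"])
  qed
  then have R: "?R = {x. x \<in> span B \<and> (\<forall>b\<in>B. representation B x b \<in> \<int>)}" by blast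
  show ?thesis unfolding R zbasis_def using assms by blast
qed

lemma is_lattice_basis_iff: "is_lattice_basis L bs \<longleftrightarrow> distinct bs \<and> zbasis L (set bs)"
proof (cases "distinct bs \<and> independent (set bs)")
  case True
  then have d: "distinct bs" and i: "independent (set bs)" by auto
  have bij: "bij_betw ((!) bs) {..<length bs} (set bs)"
    by (rule bij_betw_nth[OF d]) auto
  have re: "(\<Sum>b\<in>set bs. real_of_int (c b) *\<^sub>R b)
      = (\<Sum>i<length bs. real_of_int (c (bs ! i)) *\<^sub>R bs ! i)" for c
    by (rule sum.reindex_bij_betw[OF bij, symmetric])
  have "range (\<lambda>c :: 'a \<Rightarrow> int. \<Sum>b\<in>set bs. real_of_int (c b) *\<^sub>R b)
      = range (\<lambda>c :: nat \<Rightarrow> int. \<Sum>i<length bs. real_of_int (c i) *\<^sub>R bs ! i)" (is "?A = ?B")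
  proof
    show "?A \<subseteq> ?B"
    proof
      fix x assume "x \<in> ?A"
      then obtain c where "x = (\<Sum>i<length bs. real_of_int (c (bs ! i)) *\<^sub>R bs ! i)" unfolding re by auto
      then show "x \<in> ?B" by (intro range_eqI[where x = "\<lambda>i. c (bs ! i)"])
    qed
    show "?B \<subseteq> ?A"
    proof
      fix x assume "x \<in> ?B"
      then obtain c where x: "x = (\<Sum>i<length bs. real_of_int (c i) *\<^sub>R bs ! i)" by auto
      let ?c = "c \<circ> inv_into {..<length bs} ((!) bs)"
      have "x = (\<Sum>b\<in>set bs. real_of_int (?c b) *\<^sub>R b)"
        unfolding re x using bij
        by (intro sum.cong) (auto simp: bij_betw_def inv_into_f_f)
      then show "x \<in> ?A" by blast
    qed
  qed
  then show ?thesis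
    using True by (simp add: is_lattice_basis_def zbasis_range[OF finite_set i])
qed (auto simp: is_lattice_basis_def zbasis_def)

lemma zbasis_subset: "zbasis L B \<Longrightarrow> B \<subseteq> L"
  by (auto simp: zbasis_def real_vector.span_base real_vector.representation_basis)

lemma zbasis_span: "zbasis L B \<Longrightarrow> L \<subseteq> span B"
  by (auto simp: zbasis_def)

definition add_subgroup :: "'v::real_vector set \<Rightarrow> bool" where
  "add_subgroup M \<longleftrightarrow> 0 \<in> M \<and> (\<forall>x\<in>M. \<forall>y\<in>M. x - y \<in> M)"

lemma add_subgroup_closed:
  assumes "add_subgroup M"
  shows "0 \<in> M" "x \<in> M \<Longrightarrow> y \<in> M \<Longrightarrow> x - y \<in> M" "x \<in> M \<Longrightarrow> - x \<in> M" "x \<in> M \<Longrightarrow> y \<in> M \<Longrightarrow> x + y \<in> M"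
proof -
  show 0: "0 \<in> M" and d: "x \<in> M \<Longrightarrow> y \<in> M \<Longrightarrow> x - y \<in> M" for x y using assms by (auto simp: add_subgroup_def)
  show m: "x \<in> M \<Longrightarrow> - x \<in> M" for x using d[of 0 x] 0 by simp
  show "x \<in> M \<Longrightarrow> y \<in> M \<Longrightarrow> x + y \<in> M" using d[of x "- y"] m by simp
qed

lemma add_subgroup_scale_nat: "add_subgroup M \<Longrightarrow> x \<in> M \<Longrightarrow> real n *\<^sub>R x \<in> M"
  by (induction n) (auto simp: scaleR_add_left add_subgroup_closed)

lemma add_subgroup_scale_int: "add_subgroup M \<Longrightarrow> x \<in> M \<Longrightarrow> real_of_int k *\<^sub>R x \<in> M"
  using add_subgroup_scale_nat[of M x "nat k"] add_subgroup_closed(3)[OF _ add_subgroup_scale_nat[of M x "nat (- k)"]]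
  by (cases "k \<ge> 0") auto

lemma add_subgroup_sum: "add_subgroup M \<Longrightarrow> (\<And>i. i \<in> I \<Longrightarrow> f i \<in> M) \<Longrightarrow> sum f I \<in> M"
  by (induction I rule: infinite_finite_induct) (auto simp: add_subgroup_closed)

lemma zbasis_add_subgroup: "zbasis L B \<Longrightarrow> add_subgroup L"
  by (auto simp: zbasis_def add_subgroup_def real_vector.span_zero real_vector.span_diff
     real_vector.representation_diff real_vector.representation_zero)

text \<open>Since u lies outside the span of M, the sum Zu + M is direct. The same step extends
  bases for subgroups of lattices and for hyperbolic pairs.\<close>

lemma zbasis_insert:
  fixes u :: "'a::real_vector"
  assumes "zbasis M C" "u \<notin> span C"
    and L: "\<And>x. x \<in> L \<longleftrightarrow> (\<exists>q::int. x - real_of_int q *\<^sub>R u \<in> M)"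
  shows "zbasis L (insert u C)"
proof -
  have C: "finite C" "independent C" using assms by (auto simp: zbasis_def)
  have i: "independent (insert u C)"
    using real_vector.independent_insertI[OF assms(2) C(2)] .
  have uC: "u \<notin> C" using assms(2) real_vector.span_base by blast
  have M: "M = range (\<lambda>c :: 'a \<Rightarrow> int. \<Sum>b\<in>C. real_of_int (c b) *\<^sub>R b)"
    using assms(1) zbasis_range[OF C] by simp
  have "L = range (\<lambda>c :: 'a \<Rightarrow> int. \<Sum>b\<in>insert u C. real_of_int (c b) *\<^sub>R b)" (is "_ = ?R")
  proof (intro Set.set_eqI iffI)
    fix x assume "x \<in> L"
    then obtain q c where "x - real_of_int q *\<^sub>R u = (\<Sum>b\<in>C. real_of_int (c b) *\<^sub>R b)"
      using L M by auto
    then have x: "x = real_of_int q *\<^sub>R u + (\<Sum>b\<in>C. real_of_int (c b) *\<^sub>R b)"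
      by (simp add: algebra_simps)
    have "(\<Sum>b\<in>C. real_of_int ((c(u := q)) b) *\<^sub>R b) = (\<Sum>b\<in>C. real_of_int (c b) *\<^sub>R b)"
      by (rule sum.cong) (use uC in auto)
    then have "x = (\<Sum>b\<in>insert u C. real_of_int ((c(u := q)) b) *\<^sub>R b)"
      using x C uC by simp
    then show "x \<in> ?R" by blast
  next
    fix x assume "x \<in> ?R"
    then obtain c :: "'a \<Rightarrow> int" where "x = (\<Sum>b\<in>insert u C. real_of_int (c b) *\<^sub>R b)" by auto
    then have "x - real_of_int (c u) *\<^sub>R u = (\<Sum>b\<in>C. real_of_int (c b) *\<^sub>R b)"
      using C uC by simp
    then show "x \<in> L" unfolding L M by blast
  qed
  then show ?thesis using zbasis_range[OF _ i] C by simp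
qed

text \<open>Induction on B: the b-coordinates of M form a subgroup of the integers, generated by its
  least positive element k unless it is 0. A vector u of M attaining k, added to a basis of the
  kernel \<open>M'\<close>, gives a basis of M.\<close>

lemma subgroup_of_lattice_has_basis:
  assumes "finite B" "independent B"
    and "add_subgroup M" "\<And>x. x \<in> M \<Longrightarrow> x \<in> span B \<and> (\<forall>b\<in>B. representation B x b \<in> \<int>)"
  shows "\<exists>C. zbasis M C"
  using assms
proof (induction B arbitrary: M rule: finite_induct)
  case empty
  then have "M = {0}" using add_subgroup_closed(1)[of M] by auto
  then have "zbasis M {}" by (auto simp: zbasis_def real_vector.independent_empty)
  then show ?case by blast
next
  case (insert b B)
  let ?r = "representation (insert b B)"
  have iB: "independent B" using insert.prems(1) real_vector.independent_mono by blast
  have MB: "x \<in> span (insert b B)" "c \<in> insert b B \<Longrightarrow> ?r x c \<in> \<int>" if "x \<in> M" for x c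
    using insert.prems(3)[OF that] by auto
  define M' where "M' = {x \<in> M. ?r x b = 0}"
  have M'B: "x \<in> span B" if "x \<in> span (insert b B)" "?r x b = 0" for x
  proof -
    have "x = (\<Sum>c\<in>insert b B. ?r x c *\<^sub>R c)"
      using insert.hyps insert.prems that by (intro sum_representation[symmetric]) auto
    also have "\<dots> = (\<Sum>c\<in>B. ?r x c *\<^sub>R c)" using insert.hyps that by simp
    also have "\<dots> \<in> span B" by (intro real_vector.span_sum real_vector.span_scale real_vector.span_base)
    finally show ?thesis .
  qed
  have rb: "?r x b = 0" if "x \<in> span B" for x
    using real_vector.representation_extend[OF insert.prems(1) that] insert.hyps
    by (metis real_vector.representation_ne_zero subset_insertI)
  have sg: "add_subgroup M'"
    using add_subgroup_closed[OF insert.prems(2)] MB insert.prems(1)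
    unfolding add_subgroup_def M'_def
    by (auto simp: real_vector.representation_diff real_vector.representation_zero)
  have "\<exists>C. zbasis M' C"
  proof (rule insert.IH[OF iB sg])
    fix x assume "x \<in> M'"
    then have x: "x \<in> M" "?r x b = 0" by (auto simp: M'_def)
    have s: "x \<in> span B" using M'B MB x by blast
    then have "representation B x c \<in> \<int>" if "c \<in> B" for c
      using real_vector.representation_extend[OF insert.prems(1) s] MB(2)[OF x(1)] that
      by (metis insertCI subset_insertI)
    with s show "x \<in> span B \<and> (\<forall>c\<in>B. representation B x c \<in> \<int>)" by blast
  qed
  then obtain C where C: "zbasis M' C" by blast
  show ?case
  proof (cases "M' = M")
    case True then show ?thesis using C by blast
  next
    case False
    then obtain v where v: "v \<in> M" "?r v b \<noteq> 0" by (auto simp: M'_def)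
    then obtain kv where kv: "?r v b = real_of_int kv" using MB(2)[OF v(1), of b] by (auto elim: Ints_cases)
    define P where "P k \<longleftrightarrow> k > 0 \<and> (\<exists>x\<in>M. ?r x b = real k)" for k :: nat
    have "\<exists>k. P k"
    proof (cases "kv > 0")
      case True
      then have "P (nat kv)" unfolding P_def using v kv by (intro conjI bexI[of _ v]) auto
      then show ?thesis ..
    next
      case False
      have "?r (- v) b = - ?r v b" using MB(1)[OF v(1)] insert.prems(1) by (simp add: real_vector.representation_neg)
      then have "P (nat (- kv))" unfolding P_def using v kv False
        by (intro conjI bexI[of _ "- v"]) (auto simp: add_subgroup_closed[OF insert.prems(2)])
      then show ?thesis ..
    qed
    define k where "k = (LEAST k. P k)"
    have Pk: "P k" and kmin: "\<And>j. P j \<Longrightarrow> k \<le> j"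
      using \<open>\<exists>k. P k\<close> unfolding k_def by (auto intro: LeastI Least_le)
    then obtain u where u: "u \<in> M" "?r u b = real k" "k > 0" by (auto simp: P_def)
    have "span C \<subseteq> span B"
      using zbasis_subset[OF C] M'B MB unfolding M'_def
      by (intro real_vector.span_minimal) auto
    then have "u \<notin> span C" using rb u by auto
    moreover have "x \<in> M \<longleftrightarrow> (\<exists>q::int. x - real_of_int q *\<^sub>R u \<in> M')" for x
    proof
      assume x: "x \<in> M"
      then obtain kx where kx: "?r x b = real_of_int kx" using MB(2)[OF x, of b] by (auto elim: Ints_cases)
      define q r where "q = kx div int k" and "r = kx mod int k"
      have "kx = q * int k + r" by (simp add: q_def r_def)
      have y: "x - real_of_int q *\<^sub>R u \<in> M"
        using add_subgroup_closed(2)[OF insert.prems(2) x add_subgroup_scale_int[OF insert.prems(2) u(1)]] .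
      have "?r (x - real_of_int q *\<^sub>R u) b = ?r x b - real_of_int q * ?r u b"
        using MB(1)[OF x] MB(1)[OF u(1)] insert.prems(1)
        by (simp add: real_vector.representation_diff real_vector.representation_scale real_vector.span_scale)
      also have "\<dots> = real_of_int r"
        unfolding kx u \<open>kx = _\<close> by simp
      finally have r: "?r (x - real_of_int q *\<^sub>R u) b = real_of_int r" .
      have "0 \<le> r" "r < int k" using u(3) by (simp_all add: r_def)
      have "r = 0"
      proof (rule ccontr)
        assume "r \<noteq> 0"
        then have "P (nat r)" unfolding P_def using \<open>0 \<le> r\<close> r y by (intro conjI bexI[OF _ y]) auto
        then show False using kmin[of "nat r"] \<open>r < int k\<close> \<open>0 \<le> r\<close> by linarith
      qed
      then show "\<exists>q::int. x - real_of_int q *\<^sub>R u \<in> M'" using y r unfolding M'_def by auto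
    next
      assume "\<exists>q::int. x - real_of_int q *\<^sub>R u \<in> M'"
      then obtain q :: int where "x - real_of_int q *\<^sub>R u \<in> M" by (auto simp: M'_def)
      then have "(x - real_of_int q *\<^sub>R u) + real_of_int q *\<^sub>R u \<in> M"
        using add_subgroup_closed(4)[OF insert.prems(2)] add_subgroup_scale_int[OF insert.prems(2) u(1)] by blast
      then show "x \<in> M" by simp
    qed
    ultimately have "zbasis M (insert u C)" by (intro zbasis_insert[OF C])
    then show ?thesis by blast
  qed
qed

lemma zbasis_subgroup:
  assumes "zbasis L B" "add_subgroup M" "M \<subseteq> L"
  obtains C where "zbasis M C"
  using subgroup_of_lattice_has_basis[of B M] assms by (meson subsetD zbasis_def)

lemma zbasis_card_le:
  assumes "zbasis L B" "zbasis M C" "M \<subseteq> span B"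
  shows "card C \<le> card B"
  using assms zbasis_subset[OF assms(2)] real_vector.independent_span_bound[of B C]
  by (auto simp: zbasis_def)

text \<open>The classes of (1/N)L modulo L are represented by the vectors with coordinates c/N, 0
  \<le> c < N. The finiteness of the kernel of the sum morphism rests on this.\<close>

lemma zbasis_finite_quotient:
  assumes "zbasis L B" "N > 0"
  shows "\<exists>R. finite R \<and> (\<forall>x. real N *\<^sub>R x \<in> L \<longrightarrow> (\<exists>r\<in>R. x - r \<in> L))"
proof -
  have B: "finite B" "independent B" using assms by (auto simp: zbasis_def)
  define R where "R = (\<lambda>c :: 'a \<Rightarrow> int. \<Sum>b\<in>B. (real_of_int (c b) / real N) *\<^sub>R b) ` (B \<rightarrow>\<^sub>E {0..<int N})"
  have "\<exists>r\<in>R. x - r \<in> L" if x: "real N *\<^sub>R x \<in> L" for x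
  proof -
    obtain c :: "'a \<Rightarrow> int" where c: "real N *\<^sub>R x = (\<Sum>b\<in>B. real_of_int (c b) *\<^sub>R b)"
      using x assms(1) zbasis_range[OF B, of L] by auto
    define q r where "q b = c b div int N" and "r = (\<lambda>b\<in>B. c b mod int N)" for b
    have qr: "real_of_int (c b) = real_of_int (q b) * real N + real_of_int (r b)" if "b \<in> B" for b
    proof -
      have "c b = q b * int N + r b" using that by (simp add: q_def r_def)
      then show ?thesis by (metis of_int_add of_int_mult of_int_of_nat_eq)
    qed
    have "x = (1 / real N) *\<^sub>R (real N *\<^sub>R x)" using assms(2) by simp
    also have "\<dots> = (\<Sum>b\<in>B. (real_of_int (q b) + real_of_int (r b) / real N) *\<^sub>R b)"
      unfolding c scaleR_sum_right
      by (intro sum.cong refl) (use assms(2) in \<open>simp add: qr add_divide_distrib\<close>)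
    finally have "x - (\<Sum>b\<in>B. (real_of_int (r b) / real N) *\<^sub>R b) = (\<Sum>b\<in>B. real_of_int (q b) *\<^sub>R b)"
      by (simp add: scaleR_add_left sum.distrib)
    also have "\<dots> \<in> L" using assms(1) zbasis_range[OF B, of L] by auto
    finally have "x - (\<Sum>b\<in>B. (real_of_int (r b) / real N) *\<^sub>R b) \<in> L" .
    moreover have "r \<in> B \<rightarrow>\<^sub>E {0..<int N}" using assms(2) by (auto simp: r_def)
    ultimately show ?thesis unfolding R_def by blast
  qed
  moreover have "finite R" unfolding R_def using B by (intro finite_imageI finite_PiE) auto
  ultimately show ?thesis by blast
qed

section \<open>Symplectic bases\<close>

locale alternating_form =
  fixes V :: "'v::real_vector set" and F :: "'v \<Rightarrow> 'v \<Rightarrow> real"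
  assumes subV: "subspace V" and altF: "alternating_form_on V F"
begin

lemma V_closed: "0 \<in> V" "x \<in> V \<Longrightarrow> y \<in> V \<Longrightarrow> x + y \<in> V" "x \<in> V \<Longrightarrow> y \<in> V \<Longrightarrow> x - y \<in> V"
  "x \<in> V \<Longrightarrow> r *\<^sub>R x \<in> V" "x \<in> V \<Longrightarrow> - x \<in> V"
  using subV by (auto simp: real_vector.subspace_0 real_vector.subspace_add real_vector.subspace_diff
      real_vector.subspace_scale real_vector.subspace_neg)

lemma V_sum: "(\<And>i. i \<in> I \<Longrightarrow> f i \<in> V) \<Longrightarrow> sum f I \<in> V"
  using subV by (rule real_vector.subspace_sum)

lemma F_add: "x \<in> V \<Longrightarrow> y \<in> V \<Longrightarrow> z \<in> V \<Longrightarrow> F (x + y) z = F x z + F y z"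
  "x \<in> V \<Longrightarrow> y \<in> V \<Longrightarrow> z \<in> V \<Longrightarrow> F z (x + y) = F z x + F z y"
  using altF by (auto simp: alternating_form_on_def)

lemma F_scale: "x \<in> V \<Longrightarrow> y \<in> V \<Longrightarrow> F (r *\<^sub>R x) y = r * F x y"
  "x \<in> V \<Longrightarrow> y \<in> V \<Longrightarrow> F x (r *\<^sub>R y) = r * F x y"
  using altF by (auto simp: alternating_form_on_def)

lemma F_self: "x \<in> V \<Longrightarrow> F x x = 0"
  using altF by (auto simp: alternating_form_on_def)

lemma F_minus: "x \<in> V \<Longrightarrow> y \<in> V \<Longrightarrow> F (- x) y = - F x y"
  "x \<in> V \<Longrightarrow> y \<in> V \<Longrightarrow> F x (- y) = - F x y"
  using F_scale[of x y "-1"] by auto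

lemma F_diff: "x \<in> V \<Longrightarrow> y \<in> V \<Longrightarrow> z \<in> V \<Longrightarrow> F (x - y) z = F x z - F y z"
  "x \<in> V \<Longrightarrow> y \<in> V \<Longrightarrow> z \<in> V \<Longrightarrow> F z (x - y) = F z x - F z y"
  using F_add[of x "- y" z] F_minus[of y z] F_minus[of z y] V_closed(5) by auto

lemma F_zero: "x \<in> V \<Longrightarrow> F 0 x = 0" "x \<in> V \<Longrightarrow> F x 0 = 0"
  using F_scale[of x x 0] by auto

lemma F_skew: "x \<in> V \<Longrightarrow> y \<in> V \<Longrightarrow> F x y = - F y x"
proof -
  assume V: "x \<in> V" "y \<in> V"
  then have "F (x + y) (x + y) = (F x x + F x y) + (F y x + F y y)"
    by (simp only: F_add V_closed)
  then have "F (x + y) (x + y) = F x y + F y x" using V by (simp add: F_self)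
  then show ?thesis using F_self[of "x + y"] V V_closed(2)[of x y] by simp
qed

lemma F_sum: "(\<And>i. i \<in> I \<Longrightarrow> f i \<in> V) \<Longrightarrow> y \<in> V \<Longrightarrow> F (sum f I) y = (\<Sum>i\<in>I. F (f i) y)"
  "(\<And>i. i \<in> I \<Longrightarrow> f i \<in> V) \<Longrightarrow> y \<in> V \<Longrightarrow> F y (sum f I) = (\<Sum>i\<in>I. F y (f i))"
proof -
  have "(\<forall>i\<in>I. f i \<in> V) \<and> y \<in> V \<longrightarrow> F (sum f I) y = (\<Sum>i\<in>I. F (f i) y) \<and> F y (sum f I) = (\<Sum>i\<in>I. F y (f i))"
    by (induction I rule: infinite_finite_induct) (auto simp: F_zero F_add V_sum)
  then show "(\<And>i. i \<in> I \<Longrightarrow> f i \<in> V) \<Longrightarrow> y \<in> V \<Longrightarrow> F (sum f I) y = (\<Sum>i\<in>I. F (f i) y)"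
    "(\<And>i. i \<in> I \<Longrightarrow> f i \<in> V) \<Longrightarrow> y \<in> V \<Longrightarrow> F y (sum f I) = (\<Sum>i\<in>I. F y (f i))" by blast+
qed

lemma F_span_zero:
  assumes "C \<subseteq> V" "x \<in> V" "\<And>c. c \<in> C \<Longrightarrow> F x c = 0" "v \<in> span C"
  shows "F x v = 0"
proof -
  have "subspace {v \<in> V. F x v = 0}"
    by (rule real_vector.subspaceI) (use assms in \<open>auto simp: V_closed F_add F_scale F_zero\<close>)
  then have "span C \<subseteq> {v \<in> V. F x v = 0}"
    by (rule real_vector.span_minimal[rotated]) (use assms in auto)
  then show ?thesis using assms by auto
qed

text \<open>A pair \<open>x, y\<close> whose pairing \<open>d\<close> is the least positive value of the form splits off: \<open>d\<close> divides
  every \<open>F x z\<close> and \<open>F z y\<close>, and every value on the orthogonal complement of \<open>x, y\<close>, because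
  otherwise division with remainder gives a smaller positive value.\<close>

lemma symplectic_basis_exists:
  assumes "card B = m" "zbasis L B" "L \<subseteq> V"
    and "\<And>x y. x \<in> L \<Longrightarrow> y \<in> L \<Longrightarrow> \<exists>k::int. F x y = of_int (k * int d0)"
    and "\<And>x. x \<in> L \<Longrightarrow> x \<noteq> 0 \<Longrightarrow> \<exists>y\<in>L. F x y \<noteq> 0"
  shows "\<exists>ds xs ys. length xs = length ds \<and> length ys = length ds \<and> distinct (xs @ ys) \<and>
     zbasis L (set (xs @ ys)) \<and> (\<forall>i<length ds. ds ! i > 0 \<and> d0 dvd ds ! i) \<and>
     (\<forall>i. Suc i < length ds \<longrightarrow> ds ! i dvd ds ! Suc i) \<and>
     (\<forall>i<length ds. \<forall>j<length ds. F (xs ! i) (xs ! j) = 0 \<and> F (ys ! i) (ys ! j) = 0 \<and>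
        F (xs ! i) (ys ! j) = (if i = j then real (ds ! i) else 0))"
  using assms
proof (induction m arbitrary: L B d0 rule: less_induct)
  case (less m)
  note sg = zbasis_add_subgroup[OF less.prems(2)]
  note sc = add_subgroup_closed[OF sg] add_subgroup_scale_int[OF sg]
  have LV: "x \<in> V" if "x \<in> L" for x using less.prems(3) that by blast
  show ?case
  proof (cases "L = {0}")
    case True
    then have "zbasis L {}" by (auto simp: zbasis_def real_vector.independent_empty)
    then show ?thesis by (intro exI[of _ "[]"]) simp
  next
    case False
    then obtain x0 where "x0 \<in> L" "x0 \<noteq> 0" using sc(1) by blast
    then obtain y0 where y0: "y0 \<in> L" "F x0 y0 \<noteq> 0" using less.prems(5) by blast
    have int: "\<exists>k::int. F x y = of_int k" if "x \<in> L" "y \<in> L" for x y using less.prems(4)[OF that] by blast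
    define P where "P d \<longleftrightarrow> d > 0 \<and> (\<exists>x\<in>L. \<exists>y\<in>L. F x y = real d)" for d :: nat
    obtain k0 where k0: "F x0 y0 = of_int k0" using int \<open>x0 \<in> L\<close> y0 by blast
    have "P (nat \<bar>k0\<bar>)"
    proof (cases "k0 > 0")
      case True then show ?thesis unfolding P_def using k0 \<open>x0 \<in> L\<close> y0 by (intro conjI bexI[of _ x0] bexI[of _ y0]) auto
    next
      case False
      then show ?thesis unfolding P_def using k0 \<open>x0 \<in> L\<close> y0
        by (intro conjI bexI[of _ "- x0"] bexI[of _ y0]) (auto simp: F_minus LV sc)
    qed
    then have "\<exists>d. P d" ..
    define d where "d = (LEAST d. P d)"
    have Pd: "P d" and dmin: "\<And>j. P j \<Longrightarrow> d \<le> j"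
      using \<open>\<exists>d. P d\<close> unfolding d_def by (auto intro: LeastI Least_le)
    then obtain x y where xy: "x \<in> L" "y \<in> L" "F x y = real d" "d > 0" by (auto simp: P_def)
    have small: "r = 0" if "u \<in> L" "v \<in> L" "F u v = of_int r" "0 \<le> r" "r < int d" for u v and r :: int
    proof (rule ccontr)
      assume "r \<noteq> 0"
      then have "P (nat r)" unfolding P_def using that by (intro conjI bexI[OF _ that(1)] bexI[OF _ that(2)]) auto
      then show False using dmin[of "nat r"] that by linarith
    qed
    have fx: "\<exists>a::int. F x z = of_int a * real d" if z: "z \<in> L" for z
    proof -
      obtain k where k: "F x z = of_int k" using int xy z by blast
      have kk: "real_of_int k = of_int (k div int d) * real d + of_int (k mod int d)"
        by (metis div_mult_mod_eq of_int_add of_int_mult of_int_of_nat_eq)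
      have "F x (z - of_int (k div int d) *\<^sub>R y) = of_int (k mod int d)"
        using kk by (simp add: F_diff F_scale LV V_closed xy z k)
      then have "k mod int d = 0"
        using small xy z sc by (metis (no_types, lifting) of_nat_0_less_iff pos_mod_bound pos_mod_sign)
      then show ?thesis using k kk by (intro exI[of _ "k div int d"]) simp
    qed
    have fy: "\<exists>a::int. F z y = of_int a * real d" if z: "z \<in> L" for z
    proof -
      obtain k where k: "F z y = of_int k" using int xy z by blast
      have kk: "real_of_int k = of_int (k div int d) * real d + of_int (k mod int d)"
        by (metis div_mult_mod_eq of_int_add of_int_mult of_int_of_nat_eq)
      have "F (z - of_int (k div int d) *\<^sub>R x) y = of_int (k mod int d)"
        using kk by (simp add: F_diff F_scale LV V_closed xy z k)
      then have "k mod int d = 0"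
        using small xy z sc by (metis (no_types, lifting) of_nat_0_less_iff pos_mod_bound pos_mod_sign)
      then show ?thesis using k kk by (intro exI[of _ "k div int d"]) simp
    qed
    define L' where "L' = {z \<in> L. F x z = 0 \<and> F z y = 0}"
    have sg': "add_subgroup L'"
      using sc xy unfolding add_subgroup_def L'_def by (auto simp: F_diff F_zero LV)
    have L'L: "L' \<subseteq> L" by (auto simp: L'_def)
    have decomp: "\<exists>a c::int. z - of_int a *\<^sub>R y - of_int c *\<^sub>R x \<in> L'" if z: "z \<in> L" for z
    proof -
      obtain a c :: int where ac: "F x z = of_int a * real d" "F z y = of_int c * real d"
        using fx[OF z] fy[OF z] by blast
      have "z - of_int a *\<^sub>R y - of_int c *\<^sub>R x \<in> L'"
        using sc xy z ac unfolding L'_def by (auto simp: F_diff F_scale LV V_closed F_self)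
      then show ?thesis by blast
    qed
    \<comment> \<open>Stated for every basis C of \<open>L'\<close>, since it is used twice: for an
      arbitrary one to see that the rank drops, and for the symplectic one supplied by the induction
      hypothesis.\<close>
    have extend: "x \<notin> span C \<and> y \<notin> span (insert x C) \<and> zbasis L (insert y (insert x C))"
      if C: "zbasis L' C" for C
    proof -
      have CL: "C \<subseteq> L'" using zbasis_subset[OF C] .
      have CV: "C \<subseteq> V" using CL L'L LV by auto
      have Fxs: "F x v = 0" "F v y = 0" if v: "v \<in> span C" for v
      proof -
        show "F x v = 0" by (rule F_span_zero[OF CV _ _ v]) (use CL xy LV in \<open>auto simp: L'_def\<close>)
        have "F y v = 0"
          by (rule F_span_zero[OF CV _ _ v])
            (use CL xy LV in \<open>auto simp: L'_def F_skew[of y]\<close>)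
        moreover have "v \<in> V" using v CV subV by (metis real_vector.span_minimal subsetD)
        ultimately show "F v y = 0" using F_skew[of v y] xy LV by simp
      qed
      have xC: "x \<notin> span C" using Fxs(2)[of x] xy by auto
      have yC: "y \<notin> span (insert x C)"
      proof
        assume "y \<in> span (insert x C)"
        then obtain k where k: "y - k *\<^sub>R x \<in> span C" by (auto simp: real_vector.span_breakdown_eq)
        have "F x (y - k *\<^sub>R x) = real d" using xy LV V_closed by (simp add: F_diff F_scale F_self)
        then show False using Fxs(1)[OF k] xy by simp
      qed
      have z1: "zbasis {w. \<exists>q::int. w - real_of_int q *\<^sub>R x \<in> L'} (insert x C)"
        by (rule zbasis_insert[OF C xC]) simp
      have z2: "zbasis L (insert y (insert x C))"
      proof (rule zbasis_insert[OF z1 yC])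
        fix z
        show "z \<in> L \<longleftrightarrow> (\<exists>q::int. z - real_of_int q *\<^sub>R y \<in> {w. \<exists>q::int. w - real_of_int q *\<^sub>R x \<in> L'})"
        proof
          assume "z \<in> L" then show "\<exists>q::int. z - real_of_int q *\<^sub>R y \<in> {w. \<exists>q::int. w - real_of_int q *\<^sub>R x \<in> L'}"
            using decomp by blast
        next
          assume "\<exists>q::int. z - real_of_int q *\<^sub>R y \<in> {w. \<exists>q::int. w - real_of_int q *\<^sub>R x \<in> L'}"
          then obtain a c :: int where "z - of_int a *\<^sub>R y - of_int c *\<^sub>R x \<in> L" using L'L by blast
          then have "(z - of_int a *\<^sub>R y - of_int c *\<^sub>R x) + (of_int a *\<^sub>R y + of_int c *\<^sub>R x) \<in> L"
            by (intro sc(4,5) xy(1,2))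
          then show "z \<in> L" by simp
        qed
      qed
      show ?thesis using xC yC z2 by blast
    qed
    obtain C where C: "zbasis L' C" using zbasis_subgroup[OF less.prems(2) sg' L'L] .
    note xC = extend[OF C, THEN conjunct1] and yC = extend[OF C, THEN conjunct2, THEN conjunct1]
      and z2 = extend[OF C, THEN conjunct2, THEN conjunct2]
    have "finite C" "x \<notin> C" "y \<notin> insert x C"
      using C xC yC real_vector.span_base by (auto simp: zbasis_def intro: real_vector.span_base)
    then have "Suc (Suc (card C)) \<le> m"
      using zbasis_card_le[OF less.prems(2) z2 zbasis_span[OF less.prems(2)]] less.prems(1) by simp
    then have c1: "card C < m" by simp
    \<comment> \<open>This is the assumption on \<open>d0\<close> with \<open>d\<close> in its
      place. Passing it to the recursive call makes \<open>d\<close> divide every later entry, which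
      gives the divisibility chain.\<close>
    have c2: "\<exists>k::int. F z w = of_int (k * int d)" if "z \<in> L'" "w \<in> L'" for z w
    proof -
      have zw: "z \<in> L" "w \<in> L" "F x w = 0" "F z y = 0" using that by (auto simp: L'_def)
      obtain k where k: "F z w = of_int k" using int zw by blast
      have kk: "real_of_int k = of_int (k div int d) * real d + of_int (k mod int d)"
        by (metis div_mult_mod_eq of_int_add of_int_mult of_int_of_nat_eq)
      \<comment> \<open>The values of F on \<open>L'\<close> alone offer no pairing equal to d to
        reduce by. Adding x on the left and subtracting a multiple of y on the right brings in F x y
        = d.\<close>
      have "F (x + z) (w - of_int (k div int d) *\<^sub>R y) = of_int (k mod int d)"
        using kk by (simp add: F_add F_diff F_scale LV V_closed xy zw k)
      then have "k mod int d = 0"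
        using small[of "x + z" "w - of_int (k div int d) *\<^sub>R y"] xy zw sc by (simp)
      then show ?thesis using k kk by (intro exI[of _ "k div int d"]) simp
    qed
    have c3: "\<exists>w\<in>L'. F z w \<noteq> 0" if zz: "z \<in> L'" "z \<noteq> 0" for z
    proof -
      have z: "z \<in> L" "F x z = 0" "F z y = 0" "F z x = 0" using zz F_skew[of z x] LV xy by (auto simp: L'_def)
      obtain w where w: "w \<in> L" "F z w \<noteq> 0" using less.prems(5)[OF z(1) zz(2)] by blast
      obtain a c :: int where ac: "w - of_int a *\<^sub>R y - of_int c *\<^sub>R x \<in> L'" using decomp[OF w(1)] by blast
      have "F z (w - of_int a *\<^sub>R y - of_int c *\<^sub>R x) = F z w"
        using LV[OF z(1)] LV[OF w(1)] LV[OF xy(1)] LV[OF xy(2)] z(3,4)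
        by (simp add: F_diff F_scale V_closed)
      then show ?thesis using ac w(2) by (intro bexI[OF _ ac]) simp
    qed
    have c4: "L' \<subseteq> V" using L'L LV by blast
    have "\<exists>ds xs ys. length xs = length ds \<and> length ys = length ds \<and>
      distinct (xs @ ys) \<and> zbasis L' (set (xs @ ys)) \<and> (\<forall>i<length ds. ds ! i > 0 \<and> d dvd ds ! i) \<and>
      (\<forall>i. Suc i < length ds \<longrightarrow> ds ! i dvd ds ! Suc i) \<and>
      (\<forall>i<length ds. \<forall>j<length ds. F (xs ! i) (xs ! j) = 0 \<and> F (ys ! i) (ys ! j) = 0 \<and>
        F (xs ! i) (ys ! j) = (if i = j then real (ds ! i) else 0))"
      by (rule less.IH[OF c1 refl C c4]) (rule c2, assumption+, rule c3, assumption+)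
    then obtain ds xs ys where IHc: "length xs = length ds \<and> length ys = length ds \<and>
      distinct (xs @ ys) \<and> zbasis L' (set (xs @ ys)) \<and> (\<forall>i<length ds. ds ! i > 0 \<and> d dvd ds ! i) \<and>
      (\<forall>i. Suc i < length ds \<longrightarrow> ds ! i dvd ds ! Suc i) \<and>
      (\<forall>i<length ds. \<forall>j<length ds. F (xs ! i) (xs ! j) = 0 \<and> F (ys ! i) (ys ! j) = 0 \<and>
        F (xs ! i) (ys ! j) = (if i = j then real (ds ! i) else 0))"
      by blast
    then have IH: "length xs = length ds" "length ys = length ds"
      "distinct (xs @ ys)" "zbasis L' (set (xs @ ys))" "\<forall>i<length ds. ds ! i > 0 \<and> d dvd ds ! i"
      "\<forall>i. Suc i < length ds \<longrightarrow> ds ! i dvd ds ! Suc i"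
      "\<forall>i<length ds. \<forall>j<length ds. F (xs ! i) (xs ! j) = 0 \<and> F (ys ! i) (ys ! j) = 0 \<and>
        F (xs ! i) (ys ! j) = (if i = j then real (ds ! i) else 0)"
      by blast+
    have sub: "set xs \<subseteq> L'" "set ys \<subseteq> L'" using zbasis_subset[OF IH(4)] by auto
    note E = extend[OF IH(4)]
    have zb: "zbasis L (set ((x # xs) @ (y # ys)))" using E by (simp add: insert_commute)
    have "x \<notin> set (xs @ ys)" "y \<notin> insert x (set (xs @ ys))"
      using E real_vector.span_base[of x "set (xs @ ys)"] real_vector.span_base[of y "insert x (set (xs @ ys))"] by auto
    then have dist: "distinct ((x # xs) @ (y # ys))" using IH(3) by auto
    obtain k :: int where "F x y = of_int (k * int d0)" using less.prems(4) xy by blast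
    then have "int d = k * int d0" using xy(3) by (metis of_int_eq_iff of_int_of_nat_eq)
    then have "int d0 dvd int d" by simp
    then have d0: "d0 dvd d" using int_dvd_int_iff by blast
    have o: "F x v = 0" "F v x = 0" "F y v = 0" "F v y = 0" if "v \<in> L'" for v
      using that xy LV F_skew[of v x] F_skew[of y v] by (auto simp: L'_def)
    have val: "\<forall>i<length (d # ds). \<forall>j<length (d # ds). F ((x # xs) ! i) ((x # xs) ! j) = 0 \<and>
        F ((y # ys) ! i) ((y # ys) ! j) = 0 \<and>
        F ((x # xs) ! i) ((y # ys) ! j) = (if i = j then real ((d # ds) ! i) else 0)"
    proof (intro allI impI)
      fix i j assume ij: "i < length (d # ds)" "j < length (d # ds)"
      have m: "xs ! i \<in> L'" "ys ! i \<in> L'" if "i < length ds" for i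
        using that sub IH(1,2) nth_mem by (metis subsetD)+
      show "F ((x # xs) ! i) ((x # xs) ! j) = 0 \<and> F ((y # ys) ! i) ((y # ys) ! j) = 0 \<and>
        F ((x # xs) ! i) ((y # ys) ! j) = (if i = j then real ((d # ds) ! i) else 0)"
        using ij IH(7) o m xy LV by (cases i; cases j) (auto simp: F_self)
    qed
    have dv: "\<forall>i. Suc i < length (d # ds) \<longrightarrow> (d # ds) ! i dvd (d # ds) ! Suc i"
    proof (intro allI impI)
      fix i assume "Suc i < length (d # ds)"
      then show "(d # ds) ! i dvd (d # ds) ! Suc i" using IH(5,6) by (cases i) auto
    qed
    have pos: "\<forall>i<length (d # ds). (d # ds) ! i > 0 \<and> d0 dvd (d # ds) ! i"
    proof (intro allI impI)
      fix i assume "i < length (d # ds)"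
      then show "(d # ds) ! i > 0 \<and> d0 dvd (d # ds) ! i"
        using IH(5) xy(4) d0 by (cases i) (auto intro: dvd_trans)
    qed
    show ?thesis
      by (rule exI[of _ "d # ds"], rule exI[of _ "x # xs"], rule exI[of _ "y # ys"])
        (use IH(1,2) zb dist val dv pos in simp)
  qed
qed

end

section \<open>Hermitian forms\<close>

lemma scaleC_Complex: "Complex a b *\<^sub>C x = a *\<^sub>R x + b *\<^sub>R (\<i> *\<^sub>C x)" for x :: "'v::complex_vector"
proof -
  have "Complex a b = complex_of_real a + complex_of_real b * \<i>" by (simp add: complex_eq_iff)
  then show ?thesis
    by (simp add: scaleC_add_left scaleR_scaleC scaleC_scaleC)
qed

lemma scaleC_Re_Im: "c *\<^sub>C x = Re c *\<^sub>R x + Im c *\<^sub>R (\<i> *\<^sub>C x)" for x :: "'v::complex_vector"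
  using scaleC_Complex[of "Re c" "Im c" x] by simp

lemma scaleC_scaleR: "c *\<^sub>C (r *\<^sub>R x) = r *\<^sub>R (c *\<^sub>C x)" for x :: "'v::complex_vector"
  by (simp add: scaleR_scaleC scaleC_scaleC mult.commute)

lemma i_i_scaleC: "\<i> *\<^sub>C \<i> *\<^sub>C x = - x" for x :: "'v::complex_vector"
  by (simp add: scaleC_scaleC)

lemma complex_subspace_imp_real: "complex_vector.subspace V \<Longrightarrow> subspace V"
  by (simp add: real_vector.subspace_def complex_vector.subspace_def scaleR_scaleC)

lemma real_span_le_complex_span: "span S \<subseteq> complex_vector.span S"
  by (intro real_vector.span_minimal complex_subspace_imp_real complex_vector.subspace_span
      complex_vector.span_superset)

locale hermitian_form =
  fixes V :: "'v::complex_vector set" and F :: "'v \<Rightarrow> 'v \<Rightarrow> real"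
  assumes complex_subspace: "complex_vector.subspace V"
    and alt: "alternating_form_on V F"
    and sym: "x \<in> V \<Longrightarrow> y \<in> V \<Longrightarrow> F x (\<i> *\<^sub>C y) = F y (\<i> *\<^sub>C x)"
    and pos: "x \<in> V \<Longrightarrow> x \<noteq> 0 \<Longrightarrow> F x (\<i> *\<^sub>C x) > 0"
begin

sublocale alternating_form V F
  by unfold_locales (use complex_subspace complex_subspace_imp_real alt in auto)

lemma V_scaleC: "x \<in> V \<Longrightarrow> c *\<^sub>C x \<in> V"
  using complex_subspace complex_vector.subspace_scale by blast

lemma F_i_i: "x \<in> V \<Longrightarrow> y \<in> V \<Longrightarrow> F (\<i> *\<^sub>C x) (\<i> *\<^sub>C y) = F x y"
  using sym[of "\<i> *\<^sub>C x" y] F_skew[of x y] by (simp add: V_scaleC i_i_scaleC F_minus)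

lemma F_i_left: "x \<in> V \<Longrightarrow> y \<in> V \<Longrightarrow> F (\<i> *\<^sub>C x) y = - F x (\<i> *\<^sub>C y)"
  using F_skew[of "\<i> *\<^sub>C x" y] sym[of x y] by (simp add: V_scaleC)

lemma F_nondegenerate: "x \<in> V \<Longrightarrow> (\<And>y. y \<in> V \<Longrightarrow> F x y = 0) \<Longrightarrow> x = 0"
  using pos[of x] V_scaleC[of x \<i>] by fastforce

lemma F_eqI: "x \<in> V \<Longrightarrow> x' \<in> V \<Longrightarrow> (\<And>y. y \<in> V \<Longrightarrow> F x y = F x' y) \<Longrightarrow> x = x'"
  using F_nondegenerate[of "x - x'"] by (simp add: F_diff V_closed)

lemma hermitian_form_subspace:
  assumes "W \<subseteq> V" "complex_vector.subspace W"
  shows "hermitian_form W F"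
proof
  show "alternating_form_on W F" using alt assms(1) unfolding alternating_form_on_def by (meson subsetD)
qed (use subsetD[OF assms(1)] assms(2) sym pos in auto)

end

text \<open>The vectors \<open>e k\<close> are orthonormal for the Hermitian form with imaginary part \<open>F\<close>.\<close>

locale unitary_basis = hermitian_form V F for V :: "'v::complex_vector set" and F +
  fixes n :: nat and e :: "nat \<Rightarrow> 'v"
  assumes e_V: "k < n \<Longrightarrow> e k \<in> V"
    and e_e: "k < n \<Longrightarrow> l < n \<Longrightarrow> F (e k) (e l) = 0"
    and e_ie: "k < n \<Longrightarrow> l < n \<Longrightarrow> F (e k) (\<i> *\<^sub>C e l) = (if k = l then 1 else 0)"
    and e_expand: "x \<in> V \<Longrightarrow> x = (\<Sum>k<n. F x (\<i> *\<^sub>C e k) *\<^sub>R e k + F (e k) x *\<^sub>R (\<i> *\<^sub>C e k))"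
begin

text \<open>The Hermitian product of x with e_k, in the version that is linear in its first argument
  and has real part F x (i y) and imaginary part F y x.\<close>

definition zeta :: "nat \<Rightarrow> 'v \<Rightarrow> complex" where
  "zeta k x = Complex (F x (\<i> *\<^sub>C e k)) (F (e k) x)"

lemma zeta_add: "k < n \<Longrightarrow> x \<in> V \<Longrightarrow> y \<in> V \<Longrightarrow> zeta k (x + y) = zeta k x + zeta k y"
  by (simp add: zeta_def F_add e_V V_scaleC complex_eq_iff)

lemma zeta_scale: "k < n \<Longrightarrow> x \<in> V \<Longrightarrow> zeta k (c *\<^sub>C x) = c * zeta k x"
proof -
  assume k: "k < n" "x \<in> V"
  have c: "c *\<^sub>C x = Re c *\<^sub>R x + Im c *\<^sub>R (\<i> *\<^sub>C x)"
    by (rule scaleC_Re_Im)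
  have "F (\<i> *\<^sub>C x) (\<i> *\<^sub>C e k) = - F (e k) x" using k F_i_i[of x "e k"] F_skew[of x "e k"] e_V by simp
  moreover have "F (e k) (\<i> *\<^sub>C x) = F x (\<i> *\<^sub>C e k)" using k sym e_V by simp
  ultimately show ?thesis using k unfolding c
    by (simp add: zeta_def F_add F_scale e_V V_scaleC V_closed complex_eq_iff)
qed

lemma zeta_e: "k < n \<Longrightarrow> l < n \<Longrightarrow> zeta k (e l) = (if k = l then 1 else 0)"
  by (auto simp: zeta_def e_e e_ie complex_eq_iff)

lemma zeta_expand: "x \<in> V \<Longrightarrow> x = (\<Sum>k<n. zeta k x *\<^sub>C e k)"
  unfolding zeta_def scaleC_Complex by (rule e_expand)

lemma zeta_sum: "k < n \<Longrightarrow> (\<And>i. i \<in> I \<Longrightarrow> f i \<in> V) \<Longrightarrow> zeta k (sum f I) = (\<Sum>i\<in>I. zeta k (f i))"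
proof (induction I rule: infinite_finite_induct)
  case (insert x I) then show ?case by (simp add: zeta_add V_sum)
qed (auto simp: zeta_def F_zero e_V V_scaleC complex_eq_iff)

lemma e_inj: "inj_on e {..<n}"
proof (rule inj_onI)
  fix k l assume "k \<in> {..<n}" "l \<in> {..<n}" "e k = e l"
  then show "k = l" using zeta_e[of k l] zeta_e[of k k] by (auto split: if_splits)
qed

lemma e_independent: "complex_vector.independent (e ` {..<n})"
proof (rule complex_vector.independent_if_scalars_zero)
  fix f x assume 0: "(\<Sum>x\<in>e ` {..<n}. f x *\<^sub>C x) = 0" and "x \<in> e ` {..<n}"
  then obtain k where k: "k < n" "x = e k" by auto
  have "0 = zeta k 0" using k by (simp add: zeta_def F_zero e_V V_scaleC complex_eq_iff)
  also have "\<dots> = zeta k (\<Sum>l<n. f (e l) *\<^sub>C e l)" using 0 by (simp add: sum.reindex[OF e_inj])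
  also have "\<dots> = (\<Sum>l<n. f (e l) * (if k = l then 1 else 0))"
    using k by (subst zeta_sum) (auto simp: V_scaleC e_V zeta_scale zeta_e intro!: sum.cong)
  also have "\<dots> = (\<Sum>l<n. if k = l then f (e l) else 0)" by (intro sum.cong) auto
  also have "\<dots> = f x" using k by simp
  finally show "f x = 0" by simp
qed simp

lemma e_span: "complex_vector.span (e ` {..<n}) = V"
proof
  show "complex_vector.span (e ` {..<n}) \<subseteq> V"
    by (rule complex_vector.span_minimal) (use e_V complex_subspace in auto)
  show "V \<subseteq> complex_vector.span (e ` {..<n})"
  proof
    fix x assume "x \<in> V"
    then have "x = (\<Sum>k<n. zeta k x *\<^sub>C e k)" by (rule zeta_expand)
    also have "\<dots> \<in> complex_vector.span (e ` {..<n})"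
      by (intro complex_vector.span_sum complex_vector.span_scale complex_vector.span_base) auto
    finally show "x \<in> complex_vector.span (e ` {..<n})" .
  qed
qed

lemma cdim_eq: "cdim V = n"
  using complex_vector.dim_span_eq_card_independent[OF e_independent] card_image[OF e_inj]
  by (simp add: e_span)

text \<open>In the real coordinates p_k = F x (i e_k) and q_k = F e_k x the form is the sum of the
  p_k \<and> q_k; the two-forms \<open>Ek\<close> come from this formula.\<close>

lemma F_right: "x \<in> V \<Longrightarrow> y \<in> V \<Longrightarrow> F x y = (\<Sum>k<n. F x (\<i> *\<^sub>C e k) * F (e k) y - F (e k) x * F y (\<i> *\<^sub>C e k))"
proof -
  assume x: "x \<in> V" and y: "y \<in> V"
  have "F x y = F x (\<Sum>k<n. F y (\<i> *\<^sub>C e k) *\<^sub>R e k + F (e k) y *\<^sub>R (\<i> *\<^sub>C e k))"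
    using e_expand[OF y] by simp
  also have "\<dots> = (\<Sum>k<n. F x (F y (\<i> *\<^sub>C e k) *\<^sub>R e k + F (e k) y *\<^sub>R (\<i> *\<^sub>C e k)))"
    using x by (intro F_sum) (auto simp: V_closed e_V V_scaleC)
  also have "\<dots> = (\<Sum>k<n. F x (\<i> *\<^sub>C e k) * F (e k) y - F (e k) x * F y (\<i> *\<^sub>C e k))"
    using x F_skew[of x "e _"] by (intro sum.cong) (auto simp: V_closed e_V V_scaleC F_add F_scale)
  finally show ?thesis .
qed

lemma riesz:
  assumes add: "\<And>x y. x \<in> V \<Longrightarrow> y \<in> V \<Longrightarrow> l (x + y) = l x + l y"
    and scale: "\<And>r x. x \<in> V \<Longrightarrow> l (r *\<^sub>R x) = r * l x"
  shows "\<exists>v\<in>V. \<forall>y\<in>V. F v y = l y"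
proof -
  \<comment> \<open>The coefficients are forced by \<open>e_expand\<close>: the one at e_k is F v (i
    e_k) = l (i e_k), the one at i e_k is F e_k v = - l e_k.\<close>
  let ?v = "\<Sum>k<n. l (\<i> *\<^sub>C e k) *\<^sub>R e k - l (e k) *\<^sub>R (\<i> *\<^sub>C e k)"
  have lsum: "l (sum f I) = (\<Sum>i\<in>I. l (f i))" if "\<And>i. i \<in> I \<Longrightarrow> f i \<in> V" for f and I :: "nat set"
    using that
  proof (induction I rule: infinite_finite_induct)
    case (insert x I) then show ?case by (simp add: add V_sum)
  qed (use scale[of 0 0] V_closed in auto)
  have "F ?v y = l y" if y: "y \<in> V" for y
  proof -
    have "F ?v y = (\<Sum>k<n. l (\<i> *\<^sub>C e k) * F (e k) y - l (e k) * F (\<i> *\<^sub>C e k) y)"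
      using y by (subst F_sum) (auto simp: V_closed V_scaleC e_V F_diff F_scale)
    also have "\<dots> = (\<Sum>k<n. l (F y (\<i> *\<^sub>C e k) *\<^sub>R e k + F (e k) y *\<^sub>R (\<i> *\<^sub>C e k)))"
      using y F_skew[of "\<i> *\<^sub>C e _" y]
      by (intro sum.cong) (auto simp: V_closed V_scaleC e_V add scale)
    also have "\<dots> = l (\<Sum>k<n. F y (\<i> *\<^sub>C e k) *\<^sub>R e k + F (e k) y *\<^sub>R (\<i> *\<^sub>C e k))"
      by (rule lsum[symmetric]) (auto simp: V_closed V_scaleC e_V)
    finally show ?thesis using e_expand[OF y] by simp
  qed
  moreover have "?v \<in> V" by (intro V_sum) (auto simp: V_closed V_scaleC e_V)
  ultimately show ?thesis by blast
qed

end

text \<open>The matrix of f in a finite basis has an eigenvalue, because its characteristic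
  polynomial has positive degree and hence a complex root.\<close>

lemma exists_eigenvector:
  fixes V :: "'v::complex_vector set"
  assumes "finite T" "complex_vector.span T = V" "V \<noteq> {0}"
    and fV: "\<And>x. x \<in> V \<Longrightarrow> f x \<in> V"
    and add: "\<And>x y. x \<in> V \<Longrightarrow> y \<in> V \<Longrightarrow> f (x + y) = f x + f y"
    and scale: "\<And>c x. x \<in> V \<Longrightarrow> f (c *\<^sub>C x) = c *\<^sub>C f x"
  shows "\<exists>x\<in>V. x \<noteq> 0 \<and> (\<exists>c. f x = c *\<^sub>C x)"
proof -
  obtain B where B: "B \<subseteq> V" "complex_vector.independent B" "V \<subseteq> complex_vector.span B"
    using complex_vector.maximal_independent_subset[of V] by blast
  have finB: "finite B"
    using complex_vector.independent_span_bound[OF assms(1) B(2)] B(1) assms(2) by blast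
  have sub: "complex_vector.subspace V" using assms(2) complex_vector.subspace_span by blast
  have spanB: "complex_vector.span B = V"
    using B complex_vector.span_minimal[OF B(1) sub] by blast
  obtain vs where vs: "set vs = B" "distinct vs" using finB finite_distinct_list by blast
  define m where "m = length vs"
  have "B \<noteq> {}" using spanB assms(3) by auto
  then have m: "m > 0" unfolding m_def using vs by auto
  have vsV: "vs ! j \<in> V" if "j < m" for j using that vs(1) B(1) by (auto simp: m_def)
  have sumB: "(\<Sum>b\<in>B. g b) = (\<Sum>i<m. g (vs ! i))" for g :: "'v \<Rightarrow> 'v"
    using sum.reindex_bij_betw[OF bij_betw_nth[OF vs(2) refl refl], of g] vs(1) by (simp add: m_def)
  let ?r = "complex_vector.representation B"
  define A where "A = mat m m (\<lambda>(i, j). ?r (f (vs ! j)) (vs ! i))"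
  have A: "A \<in> carrier_mat m m" by (simp add: A_def)
  have "degree (char_poly A) = m" using degree_monic_char_poly[OF A] by simp
  then have "\<not> constant (poly (char_poly A))" using m by (simp add: constant_degree)
  then obtain k where "poly (char_poly A) k = 0" using fundamental_theorem_of_algebra by blast
  then have "eigenvalue A k" using eigenvalue_root_char_poly[OF A] by simp
  then obtain v where "eigenvector A v k" by (auto simp: eigenvalue_def)
  then have v: "v \<in> carrier_vec m" "v \<noteq> 0\<^sub>v m" "A *\<^sub>v v = k \<cdot>\<^sub>v v"
    using A by (auto simp: eigenvector_def)
  let ?x = "\<Sum>j<m. v $ j *\<^sub>C vs ! j"
  have sumV: "(\<And>i. i \<in> I \<Longrightarrow> g i \<in> V) \<Longrightarrow> sum g I \<in> V" for g and I :: "nat set"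
    using sub by (rule complex_vector.subspace_sum)
  have scV: "x \<in> V \<Longrightarrow> c *\<^sub>C x \<in> V" for c x using sub by (rule complex_vector.subspace_scale)
  have f0: "f 0 = 0" using scale[of 0 0] complex_vector.subspace_0[OF sub] by simp
  have fsum: "f (sum g I) = (\<Sum>i\<in>I. f (g i))" if "\<And>i. i \<in> I \<Longrightarrow> g i \<in> V" for g and I :: "nat set"
    using that
  proof (induction I rule: infinite_finite_induct)
    case (insert x I) then show ?case by (simp add: add sumV)
  qed (auto simp: f0)
  have exp: "f (vs ! j) = (\<Sum>i<m. A $$ (i, j) *\<^sub>C vs ! i)" if "j < m" for j
  proof -
    have "f (vs ! j) = (\<Sum>b\<in>B. ?r (f (vs ! j)) b *\<^sub>C b)"
      using complex_vector.sum_representation_eq[OF B(2) _ finB subset_refl] fV vsV that spanB by simp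
    then show ?thesis using that by (simp add: sumB A_def)
  qed
  have "f ?x = (\<Sum>j<m. v $ j *\<^sub>C f (vs ! j))"
    by (subst fsum) (auto simp: scV vsV scale)
  also have "\<dots> = (\<Sum>j<m. \<Sum>i<m. (A $$ (i, j) * v $ j) *\<^sub>C vs ! i)"
    by (intro sum.cong refl) (simp add: exp complex_vector.scale_sum_right scaleC_scaleC mult.commute)
  also have "\<dots> = (\<Sum>i<m. (\<Sum>j<m. A $$ (i, j) * v $ j) *\<^sub>C vs ! i)"
    by (subst sum.swap) (simp add: complex_vector.scale_sum_left)
  also have "\<dots> = (\<Sum>i<m. (k * v $ i) *\<^sub>C vs ! i)"
  proof (intro sum.cong refl)
    fix i assume i: "i \<in> {..<m}"
    have "(\<Sum>j<m. A $$ (i, j) * v $ j) = (A *\<^sub>v v) $ i"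
      using i v(1) A by (auto simp: scalar_prod_def lessThan_atLeast0 intro!: sum.cong)
    then show "(\<Sum>j<m. A $$ (i, j) * v $ j) *\<^sub>C vs ! i = (k * v $ i) *\<^sub>C vs ! i"
      using i v by simp
  qed
  also have "\<dots> = k *\<^sub>C ?x" by (simp add: complex_vector.scale_sum_right scaleC_scaleC)
  finally have "f ?x = k *\<^sub>C ?x" .
  moreover have "?x \<in> V" by (intro sumV scV vsV) auto
  moreover have "?x \<noteq> 0"
  proof
    assume 0: "?x = 0"
    obtain j where j: "j < m" "v $ j \<noteq> 0" using v(1,2) by (metis carrier_vecD eq_vecI index_zero_vec)
    let ?c = "\<lambda>b. v $ (inv_into {..<m} ((!) vs) b)"
    have bij: "bij_betw ((!) vs) {..<m} B" using bij_betw_nth[OF vs(2)] vs(1) m_def by blast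
    have "(\<Sum>b\<in>B. ?c b *\<^sub>C b) = ?x"
      unfolding sumB using bij by (intro sum.cong) (auto simp: bij_betw_def inv_into_f_f)
    then have "?c (vs ! j) = 0"
      using complex_vector.independentD[OF B(2) finB subset_refl, of ?c "vs ! j"] 0 j vs(1) by (auto simp: m_def)
    then show False using j bij by (auto simp: bij_betw_def inv_into_f_f)
  qed
  ultimately show ?thesis by blast
qed

text \<open>Induction on a bound for the number of generators. A unit eigenvector u is split off;
  its Hermitian complement W is preserved by the self-adjoint f and has a basis with at most m
  elements.\<close>

lemma spectral_theorem:
  fixes V :: "'v::complex_vector set"
  assumes "finite T" "card T \<le> m" "V \<subseteq> complex_vector.span T" "hermitian_form V F"
    and "\<And>x. x \<in> V \<Longrightarrow> f x \<in> V"
    and "\<And>x y. x \<in> V \<Longrightarrow> y \<in> V \<Longrightarrow> f (x + y) = f x + f y"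
    and "\<And>c x. x \<in> V \<Longrightarrow> f (c *\<^sub>C x) = c *\<^sub>C f x"
    and "\<And>x y. x \<in> V \<Longrightarrow> y \<in> V \<Longrightarrow> F (f x) y = F x (f y)"
  shows "\<exists>n e t. unitary_basis V F n e \<and> (\<forall>k<n. f (e k) = t k *\<^sub>R e k)"
  using assms
proof (induction m arbitrary: V T)
  case 0
  interpret hermitian_form V F by (rule 0(4))
  have V: "V = {0}" using 0 V_closed(1) by auto
  have "unitary_basis V F 0 (\<lambda>_. 0)"
    by unfold_locales (simp_all add: V)
  then show ?case by auto
next
  case (Suc m)
  interpret hermitian_form V F by (rule Suc.prems(4))
  note fV = Suc.prems(5) and fadd = Suc.prems(6) and fscale = Suc.prems(7) and fself = Suc.prems(8)
  show ?case
  proof (cases "V = {0}")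
    case True
    have "unitary_basis V F 0 (\<lambda>_. 0)"
      by unfold_locales (simp_all add: True)
    then show ?thesis by auto
  next
    case False
    obtain B where B: "B \<subseteq> V" "complex_vector.independent B" "V \<subseteq> complex_vector.span B"
      using complex_vector.maximal_independent_subset[of V] by blast
    have finB: "finite B" "card B \<le> card T"
      using complex_vector.independent_span_bound[OF Suc.prems(1) B(2)] B(1) Suc.prems(3) by auto
    have spanB: "complex_vector.span B = V"
      using B complex_vector.span_minimal[OF B(1) complex_subspace] by blast
    obtain x c where x: "x \<in> V" "x \<noteq> 0" "f x = c *\<^sub>C x"
      using exists_eigenvector[OF finB(1) spanB False fV fadd fscale] by blast
    define s where "s = sqrt (F x (\<i> *\<^sub>C x))"
    have s: "s > 0" "s * s = F x (\<i> *\<^sub>C x)" using pos[OF x(1,2)] by (auto simp: s_def)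
    define u where "u = (1 / s) *\<^sub>R x"
    have uV: "u \<in> V" using x by (simp add: u_def V_closed)
    have uu: "F u (\<i> *\<^sub>C u) = 1"
      using x s by (simp add: u_def scaleC_scaleR F_scale V_closed V_scaleC flip: s(2))
    have fu: "f u = c *\<^sub>C u"
      using x fscale[OF x(1), of "complex_of_real (1 / s)"] by (simp add: u_def scaleR_scaleC scaleC_scaleC mult.commute)
    have cu: "c *\<^sub>C u = Re c *\<^sub>R u + Im c *\<^sub>R (\<i> *\<^sub>C u)"
      by (rule scaleC_Re_Im)
    \<comment> \<open>Self-adjointness at the pair (u, u) gives - Im c = Im c, so the eigenvalue is
      real.\<close>
    have "F (c *\<^sub>C u) u = F u (c *\<^sub>C u)" using fself[OF uV uV] fu by simp
    then have "Im c * F (\<i> *\<^sub>C u) u = Im c * F u (\<i> *\<^sub>C u)"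
      unfolding cu using uV by (simp add: F_add F_scale V_closed V_scaleC F_self)
    then have "Im c = 0" using uu uV by (simp add: F_i_left)
    then have fu': "f u = Re c *\<^sub>R u" using fu cu by simp
    \<comment> \<open>The two conditions say that the real and the imaginary part of the Hermitian
      product with u vanish, so that W is a complex subspace.\<close>
    define W where "W = {w \<in> V. F u w = 0 \<and> F u (\<i> *\<^sub>C w) = 0}"
    have subW: "complex_vector.subspace W"
    proof (rule complex_vector.subspaceI)
      fix w c assume "w \<in> W"
      then have w: "w \<in> V" "F u w = 0" "F u (\<i> *\<^sub>C w) = 0" by (auto simp: W_def)
      have "c *\<^sub>C w = Re c *\<^sub>R w + Im c *\<^sub>R (\<i> *\<^sub>C w)"
        by (rule scaleC_Re_Im)
      then have "F u (c *\<^sub>C w) = 0" for c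
        using w uV scaleC_Complex[of "Re c" "Im c" w] by (simp add: F_add F_scale V_closed V_scaleC)
      then show "c *\<^sub>C w \<in> W" using w by (auto simp: W_def V_scaleC scaleC_scaleC)
    qed (use uV V_scaleC in \<open>auto simp: W_def V_closed F_zero F_add scaleC_add_right\<close>)
    have WV: "W \<subseteq> V" by (auto simp: W_def)
    have uW: "u \<notin> W" using uu by (simp add: W_def)
    obtain C where C: "C \<subseteq> W" "complex_vector.independent C" "W \<subseteq> complex_vector.span C"
      using complex_vector.maximal_independent_subset[of W] by blast
    have "complex_vector.span C \<subseteq> W" using complex_vector.span_minimal[OF C(1) subW] .
    then have "u \<notin> complex_vector.span C" using uW by blast
    then have ind: "complex_vector.independent (insert u C)" and uC: "u \<notin> C"
      using complex_vector.independent_insertI C(2) complex_vector.span_base by auto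
    have "insert u C \<subseteq> complex_vector.span T" using uV C(1) WV Suc.prems(3) by blast
    then have fc: "finite (insert u C)" "card (insert u C) \<le> card T"
      using complex_vector.independent_span_bound[OF Suc.prems(1) ind] by auto
    then have finC: "finite C" "card C \<le> m" using uC Suc.prems(2) by auto
    have fW: "f w \<in> W" if "w \<in> W" for w
    proof -
      have w: "w \<in> V" "F u w = 0" "F u (\<i> *\<^sub>C w) = 0" using that by (auto simp: W_def)
      have "F u (f w) = Re c * F u w" using fself[OF uV w(1)] uV w by (simp add: fu' F_scale)
      moreover have "F u (\<i> *\<^sub>C f w) = Re c * F u (\<i> *\<^sub>C w)"
        using fself[OF uV V_scaleC[OF w(1)], of \<i>] uV w by (simp add: fu' F_scale fscale V_scaleC)
      ultimately show ?thesis using w fV by (simp add: W_def)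
    qed
    have "\<exists>n e t. unitary_basis W F n e \<and> (\<forall>k<n. f (e k) = t k *\<^sub>R e k)"
      by (rule Suc.IH[OF finC C(3) hermitian_form_subspace[OF WV subW]])
        (use fW subsetD[OF WV] fadd fscale fself in auto)
    then obtain n e t where e: "unitary_basis W F n e" and t: "\<And>k. k < n \<Longrightarrow> f (e k) = t k *\<^sub>R e k" by blast
    interpret W: unitary_basis W F n e by (rule e)
    have eW: "e k \<in> V" "F u (e k) = 0" "F u (\<i> *\<^sub>C e k) = 0" if "k < n" for k
      using W.e_V[OF that] by (auto simp: W_def)
    let ?e = "e(n := u)" and ?t = "t(n := Re c)"
    have "unitary_basis V F (Suc n) ?e"
    proof
      fix k l assume kl: "k < Suc n" "l < Suc n"
      show "?e k \<in> V" using kl eW uV by (auto simp: less_Suc_eq)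
      show "F (?e k) (?e l) = 0"
        using kl eW uV W.e_e F_skew[OF eW(1) uV] F_self by (auto simp: less_Suc_eq)
      show "F (?e k) (\<i> *\<^sub>C ?e l) = (if k = l then 1 else 0)"
        using kl eW uV W.e_ie sym[OF eW(1) uV] uu by (auto simp: less_Suc_eq)
    next
      fix y assume y: "y \<in> V"
      define p q where "p = F y (\<i> *\<^sub>C u)" and "q = F u y"
      define w where "w = y - p *\<^sub>R u - q *\<^sub>R (\<i> *\<^sub>C u)"
      have "F u w = 0" using y uV uu by (simp add: w_def F_diff F_scale V_closed V_scaleC F_self q_def)
      moreover have "F u (\<i> *\<^sub>C w) = 0"
      proof -
        have "\<i> *\<^sub>C w = \<i> *\<^sub>C y - p *\<^sub>R (\<i> *\<^sub>C u) + q *\<^sub>R u"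
          by (simp add: w_def complex_vector.scale_right_diff_distrib scaleC_scaleR i_i_scaleC)
        then show ?thesis using y uV uu sym[OF y uV]
          by (simp add: F_diff F_add F_scale V_closed V_scaleC F_self p_def)
      qed
      ultimately have wW: "w \<in> W" using y uV by (simp add: W_def w_def V_closed V_scaleC)
      have c: "F w (\<i> *\<^sub>C e k) = F y (\<i> *\<^sub>C e k)" "F (e k) w = F (e k) y" if "k < n" for k
        using that y uV eW F_skew[OF eW(1) uV] F_i_i[OF uV eW(1)] F_i_left[OF uV] sym[OF eW(1) uV]
        by (simp_all add: w_def F_diff F_scale V_closed V_scaleC)
      have "w = (\<Sum>k<n. F y (\<i> *\<^sub>C e k) *\<^sub>R e k + F (e k) y *\<^sub>R (\<i> *\<^sub>C e k))"
        using W.e_expand[OF wW] c by simp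
      then show "y = (\<Sum>k<Suc n. F y (\<i> *\<^sub>C ?e k) *\<^sub>R ?e k + F (?e k) y *\<^sub>R (\<i> *\<^sub>C ?e k))"
        by (simp add: w_def p_def q_def algebra_simps)
    qed
    moreover have "\<forall>k<Suc n. f (?e k) = ?t k *\<^sub>R ?e k"
      using t fu' by (auto simp: less_Suc_eq)
    ultimately show ?thesis by blast
  qed
qed

section \<open>Polarized abelian varieties and their subvarieties\<close>

lemma zbasis_span_eq: "zbasis L B \<Longrightarrow> span B = span L"
  by (simp add: real_vector.span_eq zbasis_span subset_trans[OF zbasis_subset real_vector.span_superset])

locale pav =
  fixes A :: "'v::complex_vector pav"
  assumes pav: "polarized_abelian_variety A"
begin

sublocale hermitian_form "pspace A" "pform A"
  using pav unfolding polarized_abelian_variety_def complex_torus_def by unfold_locales auto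

lemma lattice_basis_span: "is_lattice_basis (plat A) bs \<Longrightarrow> span (set bs) = pspace A"
  using pav unfolding polarized_abelian_variety_def complex_torus_def
  by (metis is_lattice_basis_iff zbasis_span_eq)

lemma obtain_zbasis: obtains B where "zbasis (plat A) B" "span B = pspace A"
  using pav unfolding polarized_abelian_variety_def complex_torus_def
  by (metis is_lattice_basis_iff)

lemma lattice_subgroup: "add_subgroup (plat A)"
  using obtain_zbasis zbasis_add_subgroup by blast

lemma lattice_subset: "plat A \<subseteq> pspace A"
  using obtain_zbasis zbasis_span by metis

lemma form_integral: "x \<in> plat A \<Longrightarrow> y \<in> plat A \<Longrightarrow> pform A x y \<in> \<int>"
  using pav unfolding polarized_abelian_variety_def by blast

lemma finite_complex_span:
  obtains T where "finite T" "pspace A \<subseteq> complex_vector.span T"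
  using obtain_zbasis real_span_le_complex_span zbasis_def by metis

lemma form_spectral:
  assumes "\<And>x. x \<in> pspace A \<Longrightarrow> f x \<in> pspace A"
    and "\<And>x y. x \<in> pspace A \<Longrightarrow> y \<in> pspace A \<Longrightarrow> f (x + y) = f x + f y"
    and "\<And>c x. x \<in> pspace A \<Longrightarrow> f (c *\<^sub>C x) = c *\<^sub>C f x"
    and "\<And>x y. x \<in> pspace A \<Longrightarrow> y \<in> pspace A \<Longrightarrow> pform A (f x) y = pform A x (f y)"
  obtains e t where "unitary_basis (pspace A) (pform A) (cdim (pspace A)) e"
    "\<And>k. k < cdim (pspace A) \<Longrightarrow> f (e k) = t k *\<^sub>R e k"
proof -
  obtain T where "finite T" "pspace A \<subseteq> complex_vector.span T" by (rule finite_complex_span)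
  from spectral_theorem[OF this(1) order_refl this(2) hermitian_form_axioms assms]
  obtain n e t where *: "unitary_basis (pspace A) (pform A) n e" "\<forall>k<n. f (e k) = t k *\<^sub>R e k"
    by blast
  then have "cdim (pspace A) = n" by (simp add: unitary_basis.cdim_eq)
  then show ?thesis using that * by blast
qed

lemma obtain_unitary_basis:
  obtains e where "unitary_basis (pspace A) (pform A) (cdim (pspace A)) e"
  by (rule form_spectral[of "\<lambda>x. x"]) auto

lemma phi_form_inj: "inj_on (phi_form A (pform A)) (pspace A)"
proof (rule inj_onI)
  fix x y assume x: "x \<in> pspace A" and y: "y \<in> pspace A"
    and "phi_form A (pform A) x = phi_form A (pform A) y"
  then have "pform A x z = pform A y z" if "z \<in> pspace A" for z
    using that unfolding phi_form_def by (metis restrict_apply)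
  then show "x = y" using F_eqI x y by blast
qed

lemma phi_pol_inv_eq:
  assumes "v \<in> pspace A" "\<And>w. w \<in> pspace A \<Longrightarrow> pform A v w = l w"
  shows "phi_pol_inv A (restrict l (pspace A)) = v"
proof -
  have "restrict l (pspace A) = phi_form A (pform A) v"
    using assms by (auto simp: phi_form_def)
  then show ?thesis using phi_form_inj assms(1) by (simp add: phi_pol_inv_def inv_into_f_f)
qed

text \<open>Surjectivity of v \<mapsto> F(v, .) onto real functionals. Together with
  \<open>phi_form_inj\<close> it makes the \<open>inv_into\<close> in \<open>phi_pol_inv\<close> a
  genuine inverse on the functionals that occur.\<close>

lemma form_riesz:
  assumes "\<And>x y. x \<in> pspace A \<Longrightarrow> y \<in> pspace A \<Longrightarrow> l (x + y) = l x + l y"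
    and "\<And>r x. x \<in> pspace A \<Longrightarrow> l (r *\<^sub>R x) = r * l x"
  shows "\<exists>v\<in>pspace A. \<forall>y\<in>pspace A. pform A v y = l y"
proof -
  obtain e where "unitary_basis (pspace A) (pform A) (cdim (pspace A)) e" by (rule obtain_unitary_basis)
  then show ?thesis by (rule unitary_basis.riesz) (use assms in auto)
qed

end

lemma abelian_subvariety_pav:
  assumes "pav A" "abelian_subvariety A B"
  shows "pav B"
proof
  interpret pav A by fact
  have sub: "pspace B \<subseteq> pspace A" "plat B = plat A \<inter> pspace B" "pform B = pform A"
    "complex_torus (pspace B) (plat B)"
    using assms(2) by (auto simp: abelian_subvariety_def)
  show "polarized_abelian_variety B"
    unfolding polarized_abelian_variety_def
    using sub alt form_integral sym pos
    by (auto simp: alternating_form_on_def subset_iff)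
qed

lemma abelian_subvariety_trans:
  "abelian_subvariety A B \<Longrightarrow> abelian_subvariety B C \<Longrightarrow> abelian_subvariety A C"
  by (auto simp: abelian_subvariety_def)

lemma (in pav) abelian_subvariety_refl: "abelian_subvariety A A"
  using pav lattice_subset by (auto simp: abelian_subvariety_def polarized_abelian_variety_def)

text \<open>Positivity passes to every complex subspace, so the Riesz argument applies inside W; v
  is the orthogonal projection of z.\<close>

lemma (in pav) orthogonal_vector_exists:
  assumes "complex_vector.subspace W" "W \<subseteq> pspace A" "z \<in> pspace A"
  shows "\<exists>v\<in>W. \<forall>y\<in>W. pform A v y = pform A z y"
proof -
  obtain T where T: "finite T" "pspace A \<subseteq> complex_vector.span T" by (rule finite_complex_span)
  have hW: "hermitian_form W (pform A)" by (rule hermitian_form_subspace) fact+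
  have WT: "W \<subseteq> complex_vector.span T" using T assms(2) by blast
  \<comment> \<open>Applied to the identity, the spectral theorem just supplies an orthonormal
    basis.\<close>
  have "\<exists>n e t. unitary_basis W (pform A) n e \<and> (\<forall>k<n. (\<lambda>x. x) (e k) = t k *\<^sub>R e k)"
    by (rule spectral_theorem[OF T(1) order_refl WT hW]) auto
  then obtain n e where "unitary_basis W (pform A) n e" by blast
  then show ?thesis
    by (rule unitary_basis.riesz) (use assms(2,3) in \<open>auto simp: F_add F_scale subset_iff\<close>)
qed

section \<open>Symplectic bases and normalized period matrices\<close>

lemma is_cbasisI:
  assumes sub: "complex_vector.subspace V" and V: "\<And>j. j < length vs \<Longrightarrow> vs ! j \<in> V"
    and ind: "\<And>c j. (\<Sum>j<length vs. c j *\<^sub>C vs ! j) = 0 \<Longrightarrow> j < length vs \<Longrightarrow> c j = 0"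
    and span: "\<And>x. x \<in> V \<Longrightarrow> \<exists>c. x = (\<Sum>j<length vs. c j *\<^sub>C vs ! j)"
  shows "is_cbasis V vs"
proof -
  have dist: "distinct vs"
  proof (rule ccontr)
    assume "\<not> distinct vs"
    then obtain i j where ij: "i < length vs" "j < length vs" "i \<noteq> j" "vs ! i = vs ! j"
      by (auto simp: distinct_conv_nth)
    have "(\<Sum>k<length vs. (if k = i then 1 else if k = j then -1 else 0) *\<^sub>C vs ! k)
        = (\<Sum>k<length vs. (if k = i then vs ! i else 0) + (if k = j then - (vs ! i) else 0))"
      by (rule sum.cong) (use ij in \<open>auto simp: scaleC_one\<close>)
    also have "\<dots> = 0" using ij by (simp add: sum.distrib)
    finally show False using ind[of "\<lambda>k. if k = i then 1 else if k = j then -1 else 0" i] ij by simp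
  qed
  have bij: "bij_betw ((!) vs) {..<length vs} (set vs)" by (rule bij_betw_nth[OF dist]) auto
  have "complex_vector.independent (set vs)"
  proof (rule complex_vector.independent_if_scalars_zero)
    fix f x assume "(\<Sum>x\<in>set vs. f x *\<^sub>C x) = 0" "x \<in> set vs"
    moreover from \<open>x \<in> set vs\<close> obtain j where "j < length vs" "x = vs ! j" by (auto simp: in_set_conv_nth)
    ultimately show "f x = 0"
      using ind[of "\<lambda>j. f (vs ! j)" j] sum.reindex_bij_betw[OF bij, of "\<lambda>x. f x *\<^sub>C x"] by simp
  qed simp
  moreover have "complex_vector.span (set vs) = V"
  proof
    show "complex_vector.span (set vs) \<subseteq> V"
      by (rule complex_vector.span_minimal[OF _ sub]) (use V in \<open>auto simp: in_set_conv_nth\<close>)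
    show "V \<subseteq> complex_vector.span (set vs)"
    proof
      fix x assume "x \<in> V"
      then obtain c where "x = (\<Sum>j<length vs. c j *\<^sub>C vs ! j)" using span by blast
      then show "x \<in> complex_vector.span (set vs)"
        by (auto intro!: complex_vector.span_sum complex_vector.span_scale intro: complex_vector.span_base)
    qed
  qed
  ultimately show ?thesis using dist by (simp add: is_cbasis_def)
qed

lemma is_cbasisD:
  assumes "is_cbasis V vs"
  shows "j < length vs \<Longrightarrow> vs ! j \<in> V"
    and "(\<Sum>j<length vs. c j *\<^sub>C vs ! j) = 0 \<Longrightarrow> j < length vs \<Longrightarrow> c j = 0"
    and "x \<in> V \<Longrightarrow> \<exists>c. x = (\<Sum>j<length vs. c j *\<^sub>C vs ! j)"
    and "cdim V = length vs"
proof -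
  have *: "distinct vs" "complex_vector.independent (set vs)" "complex_vector.span (set vs) = V"
    using assms by (auto simp: is_cbasis_def)
  have bij: "bij_betw ((!) vs) {..<length vs} (set vs)" by (rule bij_betw_nth[OF *(1)]) auto
  show "vs ! j \<in> V" if "j < length vs" using *(3) complex_vector.span_base[OF nth_mem[OF that]] by simp
  show "cdim V = length vs"
    using *(3) complex_vector.dim_span_eq_card_independent[OF *(2)] distinct_card[OF *(1)] by simp
  show "\<exists>c. x = (\<Sum>j<length vs. c j *\<^sub>C vs ! j)" if "x \<in> V"
  proof -
    have "x = (\<Sum>b\<in>set vs. complex_vector.representation (set vs) x b *\<^sub>C b)"
      using complex_vector.sum_representation_eq[OF *(2), of x "set vs"] that *(3) by simp
    then show ?thesis
      using sum.reindex_bij_betw[OF bij, of "\<lambda>b. complex_vector.representation (set vs) x b *\<^sub>C b"]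
      by (intro exI[of _ "\<lambda>j. complex_vector.representation (set vs) x (vs ! j)"]) simp
  qed
  assume 0: "(\<Sum>j<length vs. c j *\<^sub>C vs ! j) = 0" and j: "j < length vs"
  let ?c = "\<lambda>b. c (inv_into {..<length vs} ((!) vs) b)"
  have "(\<Sum>b\<in>set vs. ?c b *\<^sub>C b) = (\<Sum>j<length vs. c j *\<^sub>C vs ! j)"
    using sum.reindex_bij_betw[OF bij, of "\<lambda>b. ?c b *\<^sub>C b", symmetric] bij
    by (auto intro!: sum.cong simp: bij_betw_def inv_into_f_f)
  then have "?c (vs ! j) = 0"
    using complex_vector.independentD[OF *(2) finite_set subset_refl, of ?c "vs ! j"] 0 j by auto
  then show "c j = 0" using j bij by (auto simp: bij_betw_def inv_into_f_f)
qed

lemma is_cbasis_unique: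
  assumes "is_cbasis V vs" "(\<Sum>j<length vs. c j *\<^sub>C vs ! j) = (\<Sum>j<length vs. d j *\<^sub>C vs ! j)" "j < length vs"
  shows "c j = d j"
proof -
  have "(\<Sum>j<length vs. (c j - d j) *\<^sub>C vs ! j) = 0"
    using assms(2) by (simp add: complex_vector.scale_left_diff_distrib sum_subtractf)
  then show ?thesis using is_cbasisD(2)[OF assms(1), of "\<lambda>j. c j - d j"] assms(3) by auto
qed

lemma join_cols_dims [simp]: "dim_row (join_cols M N) = dim_row M" "dim_col (join_cols M N) = dim_col M + dim_col N"
  by (simp_all add: join_cols_def)

lemma join_cols_carrier [simp]:
  "M \<in> carrier_mat g a \<Longrightarrow> N \<in> carrier_mat g b \<Longrightarrow> join_cols M N \<in> carrier_mat g (a + b)"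
  by (auto intro!: carrier_matI)

lemma join_cols_index:
  "M \<in> carrier_mat g a \<Longrightarrow> N \<in> carrier_mat g b \<Longrightarrow> i < g \<Longrightarrow> j < a + b \<Longrightarrow>
     join_cols M N $$ (i, j) = (if j < a then M $$ (i, j) else N $$ (i, j - a))"
  by (auto simp: join_cols_def)

lemma type_mat_carrier [simp]: "type_mat ds \<in> carrier_mat (length ds) (length ds)"
  by (simp add: type_mat_def)

lemma J_mat_index:
  assumes "i < length ds" "j < length ds"
  shows "J_mat ds $$ (i, j) = 0" "J_mat ds $$ (length ds + i, length ds + j) = 0"
    "J_mat ds $$ (i, length ds + j) = (if i = j then real (ds ! i) else 0)"
  using assms by (simp_all add: J_mat_def Let_def type_mat_def)

lemma J_mat_index':
  assumes "i < length ds" "j < length ds"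
  shows "J_mat ds $$ (length ds + i, j) = (if i = j then - real (ds ! i) else 0)"
  using assms by (simp add: J_mat_def Let_def type_mat_def)

text \<open>The dimension is derived inside the locale as \<open>cdim_g\<close>. Thus the locale can
  be entered in \<open>exists_symplectic_basis\<close>, where the statement about the dimension is
  still to be proved.\<close>

locale symplectic_pav = pav A for A :: "'v::complex_vector pav" +
  fixes ds :: "nat list" and bs :: "'v list"
  assumes length_bs: "length bs = 2 * length ds"
    and ds_pos: "i < length ds \<Longrightarrow> ds ! i > 0"
    and basis: "is_lattice_basis (plat A) bs"
    and F_xx: "i < length ds \<Longrightarrow> j < length ds \<Longrightarrow> pform A (bs ! i) (bs ! j) = 0"
    and F_yy: "i < length ds \<Longrightarrow> j < length ds \<Longrightarrow>
        pform A (bs ! (length ds + i)) (bs ! (length ds + j)) = 0"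
    and F_xy: "i < length ds \<Longrightarrow> j < length ds \<Longrightarrow>
        pform A (bs ! i) (bs ! (length ds + j)) = (if i = j then real (ds ! i) else 0)"
begin

definition "g = length ds"
definition "nb = normal_basis ds bs"

lemma length_nb: "length nb = g"
  by (simp add: nb_def normal_basis_def g_def)

lemma nb_nth: "j < g \<Longrightarrow> nb ! j = (1 / real (ds ! j)) *\<^sub>R bs ! j"
  by (simp add: nb_def normal_basis_def g_def)

lemma bs_nb: "j < g \<Longrightarrow> bs ! j = real (ds ! j) *\<^sub>R nb ! j"
  using ds_pos[of j] by (simp add: nb_nth g_def)

lemma bs_V: "i < 2 * g \<Longrightarrow> bs ! i \<in> pspace A"
  using lattice_basis_span[OF basis] length_bs real_vector.span_base[of "bs ! i" "set bs"] by (simp add: g_def)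

lemma bs_L: "i < 2 * g \<Longrightarrow> bs ! i \<in> plat A"
  using basis length_bs zbasis_subset[of "plat A" "set bs"] nth_mem[of i bs]
  unfolding is_lattice_basis_iff g_def by auto

lemma nb_V: "j < g \<Longrightarrow> nb ! j \<in> pspace A"
  by (simp add: nb_nth V_closed bs_V)

lemma F_nb_y: "j < g \<Longrightarrow> k < g \<Longrightarrow> pform A (nb ! j) (bs ! (g + k)) = (if j = k then 1 else 0)"
  using ds_pos[of j, folded g_def] F_xy[folded g_def, of j k] by (auto simp: nb_nth F_scale bs_V)

lemma F_nb_nb: "j < g \<Longrightarrow> k < g \<Longrightarrow> pform A (nb ! j) (nb ! k) = 0"
  by (simp add: nb_nth F_scale bs_V F_xx[folded g_def] V_closed)

lemma vanishes_on_basis: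
  assumes "w \<in> pspace A" "\<And>k. k < g \<Longrightarrow> pform A w (bs ! k) = 0" "\<And>k. k < g \<Longrightarrow> pform A w (bs ! (g + k)) = 0"
  shows "w = 0"
proof (rule F_nondegenerate[OF assms(1)])
  fix y assume y: "y \<in> pspace A"
  have "pform A w c = 0" if c: "c \<in> set bs" for c
  proof -
    obtain i where i: "i < 2 * g" "c = bs ! i" using c length_bs by (auto simp: in_set_conv_nth g_def)
    show ?thesis
    proof (cases "i < g")
      case False
      then have "i = g + (i - g)" "i - g < g" using i by auto
      then show ?thesis using assms(3)[of "i - g"] i by simp
    qed (use i assms(2) in auto)
  qed
  then show "pform A w y = 0"
    using F_span_zero[of "set bs" w y] assms(1) y lattice_basis_span[OF basis] real_vector.span_superset[of "set bs"]
    by auto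
qed

text \<open>Up to sign, \<open>nb ! k\<close> is dual to \<open>bs ! (g + k)\<close>, and
  \<open>bs ! (g + k)\<close> divided by d_k is dual to \<open>bs ! k\<close>; so the difference of
  the two sides pairs to 0 with the whole basis. With d_k as the only denominators, the formula
  makes projections rational on the lattice.\<close>

lemma symplectic_expand:
  assumes w: "w \<in> pspace A"
  shows "w = (\<Sum>k<g. pform A w (bs ! (g + k)) *\<^sub>R nb ! k
            + (pform A (bs ! k) w / real (ds ! k)) *\<^sub>R bs ! (g + k))"
    (is "w = ?w")
proof -
  let ?t = "\<lambda>k. pform A w (bs ! (g + k)) *\<^sub>R nb ! k + (pform A (bs ! k) w / real (ds ! k)) *\<^sub>R bs ! (g + k)"
  have tV: "?t k \<in> pspace A" if "k < g" for k using that by (simp add: V_closed nb_V bs_V)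
  have wV: "?w \<in> pspace A" by (rule V_sum) (use tV in auto)
  have F_y_x: "pform A (bs ! (g + k)) (bs ! l) = (if k = l then - real (ds ! k) else 0)" if "k < g" "l < g" for k l
    using F_skew[of "bs ! (g + k)" "bs ! l"] F_xy[folded g_def, of l k] that bs_V by auto
  have F_nb_x: "pform A (nb ! j) (bs ! k) = 0" if "j < g" "k < g" for j k
    using that F_xx[folded g_def, of j k] by (simp add: nb_nth F_scale bs_V)
  have "w - ?w = 0"
  proof (rule vanishes_on_basis)
    show "w - ?w \<in> pspace A" using w wV by (rule V_closed)
    fix l assume l: "l < g"
    have "pform A ?w (bs ! l) = (\<Sum>k<g. pform A (?t k) (bs ! l))"
      using l by (intro F_sum) (auto simp: tV bs_V)
    also have "\<dots> = (\<Sum>k<g. if k = l then - pform A (bs ! l) w else 0)"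
      using l by (intro sum.cong) (auto simp: F_add F_scale V_closed nb_V bs_V F_nb_x F_y_x dest: ds_pos[folded g_def])
    also have "\<dots> = pform A w (bs ! l)" using l w F_skew[of w "bs ! l"] bs_V by simp
    finally show "pform A (w - ?w) (bs ! l) = 0" using w wV l bs_V by (simp add: F_diff)
    have "pform A ?w (bs ! (g + l)) = (\<Sum>k<g. pform A (?t k) (bs ! (g + l)))"
      using l by (intro F_sum) (auto simp: tV bs_V)
    also have "\<dots> = (\<Sum>k<g. if k = l then pform A w (bs ! (g + l)) else 0)"
      using l by (intro sum.cong) (auto simp: F_add F_scale V_closed nb_V bs_V F_nb_y F_yy[folded g_def])
    also have "\<dots> = pform A w (bs ! (g + l))" using l by simp
    finally show "pform A (w - ?w) (bs ! (g + l)) = 0" using w wV l bs_V by (simp add: F_diff)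
  qed
  then show ?thesis by simp
qed

lemma isotropic_part:
  fixes a b :: "nat \<Rightarrow> real"
  shows "(\<Sum>j<g. a j *\<^sub>R nb ! j) \<in> pspace A"
    "pform A (\<Sum>j<g. a j *\<^sub>R nb ! j) (\<Sum>j<g. b j *\<^sub>R nb ! j) = 0"
    "k < g \<Longrightarrow> pform A (\<Sum>j<g. a j *\<^sub>R nb ! j) (bs ! (g + k)) = a k"
proof -
  show V: "(\<Sum>j<g. c j *\<^sub>R nb ! j) \<in> pspace A" for c by (rule V_sum) (auto simp: V_closed nb_V)
  have "pform A (\<Sum>j<g. a j *\<^sub>R nb ! j) (\<Sum>j<g. b j *\<^sub>R nb ! j)
      = (\<Sum>j<g. pform A (a j *\<^sub>R nb ! j) (\<Sum>j<g. b j *\<^sub>R nb ! j))"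
    by (rule F_sum) (auto simp: V V_closed nb_V)
  also have "\<dots> = (\<Sum>j<g. \<Sum>k<g. pform A (a j *\<^sub>R nb ! j) (b k *\<^sub>R nb ! k))"
    by (intro sum.cong refl F_sum) (auto simp: V_closed nb_V)
  also have "\<dots> = 0" by (simp add: F_scale V_closed nb_V F_nb_nb)
  finally show "pform A (\<Sum>j<g. a j *\<^sub>R nb ! j) (\<Sum>j<g. b j *\<^sub>R nb ! j) = 0" .
  assume k: "k < g"
  have "pform A (\<Sum>j<g. a j *\<^sub>R nb ! j) (bs ! (g + k)) = (\<Sum>j<g. pform A (a j *\<^sub>R nb ! j) (bs ! (g + k)))"
    by (rule F_sum) (use k in \<open>auto simp: V_closed nb_V bs_V\<close>)
  also have "\<dots> = (\<Sum>j<g. if j = k then a k else 0)"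
    by (intro sum.cong) (use k in \<open>auto simp: F_scale nb_V bs_V F_nb_y\<close>)
  finally show "pform A (\<Sum>j<g. a j *\<^sub>R nb ! j) (bs ! (g + k)) = a k" using k by simp
qed

lemma split_Re_Im:
  "(\<Sum>j<m. c j *\<^sub>C f j) = (\<Sum>j<m. Re (c j) *\<^sub>R f j) + \<i> *\<^sub>C (\<Sum>j<m. Im (c j) *\<^sub>R f j)"
  for f :: "nat \<Rightarrow> 'w::complex_vector"
proof -
  have "c j *\<^sub>C f j = Re (c j) *\<^sub>R f j + \<i> *\<^sub>C Im (c j) *\<^sub>R f j" for j
    using scaleC_Complex[of "Re (c j)" "Im (c j)" "f j"] by (simp add: scaleC_scaleR)
  then show ?thesis by (simp add: sum.distrib complex_vector.scale_sum_right)
qed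

text \<open>The real span of the \<open>nb ! j\<close> is isotropic, so it meets its multiple by \<open>\<i>\<close> trivially.\<close>

lemma normal_basis_independent:
  assumes 0: "(\<Sum>j<g. c j *\<^sub>C nb ! j) = 0" and j: "j < g"
  shows "c j = 0"
proof -
  let ?a = "\<Sum>j<g. Re (c j) *\<^sub>R nb ! j" and ?b = "\<Sum>j<g. Im (c j) *\<^sub>R nb ! j"
  have "?a + \<i> *\<^sub>C ?b = 0" using 0 split_Re_Im by metis
  then have ib: "\<i> *\<^sub>C ?b = - ?a" by (simp add: eq_neg_iff_add_eq_0 add.commute)
  have "pform A ?b (\<i> *\<^sub>C ?b) = 0"
    unfolding ib by (simp add: F_minus isotropic_part)
  then have b: "?b = 0" using pos isotropic_part(1) by fastforce
  then have a: "?a = 0" using ib by simp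
  have "Re (c j) = 0"
    using isotropic_part(3)[OF j, of "\<lambda>j. Re (c j)"] j by (simp add: a F_zero bs_V)
  moreover have "Im (c j) = 0"
    using isotropic_part(3)[OF j, of "\<lambda>j. Im (c j)"] j by (simp add: b F_zero bs_V)
  ultimately show ?thesis by (simp add: complex_eq_iff)
qed

text \<open>For spanning, z is projected orthogonally to the complex span of \<open>nb\<close>. The
  remainder w pairs to 0 with \<open>bs ! k\<close> for k < g, so its symplectic expansion has only
  \<open>nb\<close> terms; hence w lies in the span, is orthogonal to itself and vanishes.\<close>

lemma normal_basis_is_cbasis: "is_cbasis (pspace A) nb"
proof (rule is_cbasisI[OF complex_subspace])
  show "nb ! j \<in> pspace A" if "j < length nb" for j using that nb_V by (simp add: length_nb)
  show "c j = 0" if "(\<Sum>j<length nb. c j *\<^sub>C nb ! j) = 0" "j < length nb" for c j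
    using normal_basis_independent that by (simp add: length_nb)
  fix z assume z: "z \<in> pspace A"
  let ?W = "range (\<lambda>c. \<Sum>j<g. c j *\<^sub>C nb ! j)"
  have sW: "complex_vector.subspace ?W"
  proof (rule complex_vector.subspaceI)
    show "0 \<in> ?W" by (rule range_eqI[where x = "\<lambda>_. 0"]) simp
    fix x y assume "x \<in> ?W" "y \<in> ?W"
    then obtain c d where "x = (\<Sum>j<g. c j *\<^sub>C nb ! j)" "y = (\<Sum>j<g. d j *\<^sub>C nb ! j)" by auto
    then show "x + y \<in> ?W"
      by (intro range_eqI[where x = "\<lambda>j. c j + d j"]) (simp add: scaleC_add_left sum.distrib)
  next
    fix x a assume "x \<in> ?W"
    then obtain c where "x = (\<Sum>j<g. c j *\<^sub>C nb ! j)" by auto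
    then show "a *\<^sub>C x \<in> ?W"
      by (intro range_eqI[where x = "\<lambda>j. a * c j"]) (simp add: complex_vector.scale_sum_right scaleC_scaleC)
  qed
  have WV: "?W \<subseteq> pspace A" by (auto intro!: V_sum V_scaleC nb_V)
  obtain v where v: "v \<in> ?W" "\<And>y. y \<in> ?W \<Longrightarrow> pform A v y = pform A z y"
    using orthogonal_vector_exists[OF sW WV z] by blast
  define w where "w = z - v"
  have vV: "v \<in> pspace A" using v WV by blast
  then have wV: "w \<in> pspace A" using z by (simp add: w_def V_closed)
  have wW: "pform A w y = 0" if "y \<in> ?W" for y
    using that v(2) z vV subsetD[OF WV that] by (simp add: w_def F_diff)
  have nbW: "a *\<^sub>R nb ! k \<in> ?W" if "k < g" for k a
  proof (rule range_eqI[where x = "\<lambda>j. if j = k then complex_of_real a else 0"])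
    have "(\<Sum>j<g. (if j = k then complex_of_real a else 0) *\<^sub>C nb ! j) = (\<Sum>j<g. if j = k then a *\<^sub>R nb ! k else 0)"
      by (rule sum.cong) (auto simp: scaleR_scaleC)
    then show "a *\<^sub>R nb ! k = (\<Sum>j<g. (if j = k then complex_of_real a else 0) *\<^sub>C nb ! j)" using that by simp
  qed
  have "pform A (bs ! k) w = 0" if "k < g" for k
  proof -
    have "pform A w (bs ! k) = 0" using wW[OF nbW[OF that, of "real (ds ! k)"]] bs_nb[OF that] by simp
    moreover have "bs ! k \<in> pspace A" using bs_V[of k] that by simp
    ultimately show ?thesis using F_skew[OF wV] by simp
  qed
  then have "w = (\<Sum>k<g. pform A w (bs ! (g + k)) *\<^sub>R nb ! k)"
    using symplectic_expand[OF wV] by simp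
  also have "\<dots> \<in> ?W"
    by (rule complex_vector.subspace_sum[OF sW]) (use nbW in auto)
  finally have "w \<in> ?W" .
  then have "\<i> *\<^sub>C w \<in> ?W" using sW complex_vector.subspace_scale by blast
  then have "w = 0" using wW pos[OF wV] by fastforce
  then have "z \<in> ?W" using v by (simp add: w_def)
  then show "\<exists>c. z = (\<Sum>j<length nb. c j *\<^sub>C nb ! j)" by (auto simp: length_nb)
qed

lemma cdim_g: "cdim (pspace A) = g"
  using is_cbasisD(4)[OF normal_basis_is_cbasis] by (simp add: length_nb)

text \<open>The left block E is automatic, as \<open>nb ! j\<close> is \<open>bs ! j\<close> divided
  by d_j; only the last g columns carry a condition.\<close>

lemma period_matrix_iff:
  assumes W: "W \<in> carrier_mat g g"
  shows "is_period_matrix A nb bs (normal_period_mat ds W)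
     \<longleftrightarrow> (\<forall>k<g. bs ! (g + k) = (\<Sum>j<g. W $$ (j, k) *\<^sub>C nb ! j))"
proof -
  have T: "type_mat ds \<in> carrier_mat g g" by (simp add: g_def)
  have ix: "normal_period_mat ds W $$ (j, i) = (if i < g then type_mat ds $$ (j, i) else W $$ (j, i - g))"
    if "j < g" "i < g + g" for i j using join_cols_index[OF T W] that by simp
  have t: "type_mat ds $$ (j, i) = (if j = i then complex_of_nat (ds ! i) else 0)" if "j < g" "i < g" for i j
    using that by (simp add: type_mat_def g_def)
  have x: "bs ! i = (\<Sum>j<g. normal_period_mat ds W $$ (j, i) *\<^sub>C nb ! j)" if i: "i < g" for i
  proof -
    have "(\<Sum>j<g. normal_period_mat ds W $$ (j, i) *\<^sub>C nb ! j) = (\<Sum>j<g. if j = i then real (ds ! i) *\<^sub>R nb ! i else 0)"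
      using i by (intro sum.cong) (auto simp: ix t scaleR_scaleC)
    then show ?thesis using i bs_nb by simp
  qed
  have y: "(\<Sum>j<g. normal_period_mat ds W $$ (j, g + k) *\<^sub>C nb ! j) = (\<Sum>j<g. W $$ (j, k) *\<^sub>C nb ! j)" if "k < g" for k
    using that by (intro sum.cong) (auto simp: ix)
  have len: "length bs = g + g" using length_bs by (simp add: g_def)
  have "is_period_matrix A nb bs (normal_period_mat ds W)
     \<longleftrightarrow> (\<forall>i<g + g. bs ! i = (\<Sum>j<g. normal_period_mat ds W $$ (j, i) *\<^sub>C nb ! j))"
    unfolding is_period_matrix_def len length_nb
    using normal_basis_is_cbasis basis join_cols_carrier[OF T W] by simp
  also have "\<dots> \<longleftrightarrow> (\<forall>k<g. bs ! (g + k) = (\<Sum>j<g. W $$ (j, k) *\<^sub>C nb ! j))"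
  proof
    assume R: "\<forall>k<g. bs ! (g + k) = (\<Sum>j<g. W $$ (j, k) *\<^sub>C nb ! j)"
    show "\<forall>i<g + g. bs ! i = (\<Sum>j<g. normal_period_mat ds W $$ (j, i) *\<^sub>C nb ! j)"
    proof (intro allI impI)
      fix i assume i: "i < g + g"
      show "bs ! i = (\<Sum>j<g. normal_period_mat ds W $$ (j, i) *\<^sub>C nb ! j)"
      proof (cases "i < g")
        case False
        then have "i = g + (i - g)" "i - g < g" using i by auto
        then show ?thesis using R y by metis
      qed (use x in simp)
    qed
  qed (use y in simp)
  finally show ?thesis .
qed

text \<open>Write \<open>y\<^sub>k = a\<^sub>k + \<i> c\<^sub>k\<close> with \<open>a\<^sub>k, c\<^sub>k\<close> in the isotropic real span of \<open>nb\<close>; then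
  \<open>Im W\<^sub>j\<^sub>k = F(c\<^sub>k, y\<^sub>j) = F(c\<^sub>k, \<i> c\<^sub>j)\<close>, and \<open>0 = F(y\<^sub>k, y\<^sub>j)\<close> gives the symmetry of \<open>Re W\<close>.\<close>

lemma period_matrix_siegel:
  assumes W: "W \<in> carrier_mat g g"
    and per: "\<And>k. k < g \<Longrightarrow> bs ! (g + k) = (\<Sum>j<g. W $$ (j, k) *\<^sub>C nb ! j)"
  shows "W \<in> siegel_space g"
proof -
  define a where "a k = (\<Sum>j<g. Re (W $$ (j, k)) *\<^sub>R nb ! j)" for k
  define c where "c k = (\<Sum>j<g. Im (W $$ (j, k)) *\<^sub>R nb ! j)" for k
  have y: "bs ! (g + k) = a k + \<i> *\<^sub>C c k" if "k < g" for k
    unfolding per[OF that] a_def c_def by (rule split_Re_Im)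
  have V: "a k \<in> pspace A" "c k \<in> pspace A" "\<i> *\<^sub>C c k \<in> pspace A" for k
    unfolding a_def c_def by (intro isotropic_part V_scaleC)+
  have iso: "pform A (a k) (a l) = 0" "pform A (a k) (c l) = 0" "pform A (c k) (a l) = 0" "pform A (c k) (c l) = 0" for k l
    unfolding a_def c_def by (intro isotropic_part)+
  have Re: "pform A (a k) (bs ! (g + l)) = Re (W $$ (l, k))" and Im: "pform A (c k) (bs ! (g + l)) = Im (W $$ (l, k))" if "l < g" for k l
    unfolding a_def c_def using isotropic_part(3)[OF that] by auto
  have ReF: "pform A (a k) (\<i> *\<^sub>C c l) = Re (W $$ (l, k))" if "l < g" for k l
    using Re[OF that, of k] y[OF that] by (simp add: F_add V iso)
  have ImF: "pform A (c k) (\<i> *\<^sub>C c l) = Im (W $$ (l, k))" if "l < g" for k l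
    using Im[OF that, of k] y[OF that] by (simp add: F_add V iso)
  have "W $$ (l, k) = W $$ (k, l)" if "l < g" "k < g" for l k
  proof -
    have "Im (W $$ (l, k)) = Im (W $$ (k, l))" using ImF[of l k] ImF[of k l] that sym[OF V(2) V(2), of k l] by simp
    moreover have "pform A (a k + \<i> *\<^sub>C c k) (a l + \<i> *\<^sub>C c l) = 0"
      using F_yy[folded g_def, of k l] y that by simp
    then have "Re (W $$ (l, k)) + pform A (\<i> *\<^sub>C c k) (a l) = 0"
      by (simp add: F_add V V_closed iso ReF that F_i_i)
    then have "Re (W $$ (l, k)) = Re (W $$ (k, l))"
      using F_skew[OF V(3) V(1), of k l] ReF[of k l] that by simp
    ultimately show ?thesis by (simp add: complex_eq_iff)
  qed
  then have "transpose_mat W = W" using W by (intro eq_matI) auto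
  moreover have "x \<bullet> (map_mat Im W *\<^sub>v x) > 0" if x: "x \<in> carrier_vec g" "x \<noteq> 0\<^sub>v g" for x :: "real vec"
  proof -
    define yy where "yy = (\<Sum>k<g. x $ k *\<^sub>R bs ! (g + k))"
    define aa where "aa = (\<Sum>k<g. x $ k *\<^sub>R a k)"
    define cc where "cc = (\<Sum>k<g. x $ k *\<^sub>R c k)"
    have VV: "aa \<in> pspace A" "cc \<in> pspace A" unfolding aa_def cc_def by (intro V_sum V_closed V)+
    have yy: "yy = aa + \<i> *\<^sub>C cc"
      unfolding yy_def aa_def cc_def
      by (simp add: y scaleR_add_right sum.distrib complex_vector.scale_sum_right scaleC_scaleR)
    have acc: "pform A (c k) aa = 0" for k
    proof -
      have "pform A (c k) aa = (\<Sum>l<g. pform A (c k) (x $ l *\<^sub>R a l))"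
        unfolding aa_def by (rule F_sum) (auto simp: V V_closed)
      then show ?thesis by (simp add: F_scale V iso)
    qed
    have "x \<bullet> (map_mat Im W *\<^sub>v x) = (\<Sum>l<g. \<Sum>k<g. x $ l * (Im (W $$ (l, k)) * x $ k))"
      using x W by (auto simp: scalar_prod_def lessThan_atLeast0 sum_distrib_left intro!: sum.cong)
    also have "\<dots> = (\<Sum>l<g. \<Sum>k<g. pform A (x $ k *\<^sub>R c k) (x $ l *\<^sub>R (\<i> *\<^sub>C c l)))"
      by (intro sum.cong refl) (auto simp: F_scale V V_closed ImF)
    also have "\<dots> = (\<Sum>l<g. pform A cc (x $ l *\<^sub>R (\<i> *\<^sub>C c l)))"
      unfolding cc_def by (intro sum.cong refl F_sum(1)[symmetric]) (auto simp: V V_closed)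
    also have "\<dots> = pform A cc (\<Sum>l<g. x $ l *\<^sub>R (\<i> *\<^sub>C c l))"
      by (rule F_sum(2)[symmetric]) (auto simp: V V_closed VV)
    also have "(\<Sum>l<g. x $ l *\<^sub>R (\<i> *\<^sub>C c l)) = \<i> *\<^sub>C cc"
      by (simp add: cc_def complex_vector.scale_sum_right scaleC_scaleR)
    finally have eq: "x \<bullet> (map_mat Im W *\<^sub>v x) = pform A cc (\<i> *\<^sub>C cc)" .
    \<comment> \<open>If \<open>cc\<close> vanished, the combination \<open>yy\<close> of the second
      half of the basis would lie in the isotropic real span of \<open>nb\<close>, whereas its
      pairing with \<open>nb ! k\<close> is x_k.\<close>
    have "cc \<noteq> 0"
    proof
      assume "cc = 0"
      then have ya: "yy = aa" using yy by simp
      obtain k where k: "k < g" "x $ k \<noteq> 0" using x by (metis carrier_vecD eq_vecI index_zero_vec)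
      have "pform A (nb ! k) yy = (\<Sum>l<g. pform A (nb ! k) (x $ l *\<^sub>R bs ! (g + l)))"
        unfolding yy_def by (rule F_sum) (use k in \<open>auto simp: nb_V V_closed bs_V\<close>)
      also have "\<dots> = (\<Sum>l<g. if l = k then x $ k else 0)"
        by (intro sum.cong) (use k in \<open>auto simp: F_scale nb_V bs_V F_nb_y\<close>)
      finally have 1: "pform A (nb ! k) yy = x $ k" using k by simp
      have "pform A (nb ! k) aa = (\<Sum>l<g. pform A (nb ! k) (x $ l *\<^sub>R a l))"
        unfolding aa_def by (rule F_sum) (use k in \<open>auto simp: nb_V V V_closed\<close>)
      also have "\<dots> = 0"
      proof (rule sum.neutral, intro ballI)
        fix l
        have "nb ! k = (\<Sum>j<g. (if j = k then 1 else 0) *\<^sub>R nb ! j)"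
          using k by (simp add: if_distrib[of "\<lambda>r. r *\<^sub>R _"] cong: if_cong)
        then have "pform A (nb ! k) (a l) = 0" unfolding a_def by (metis isotropic_part(2))
        then show "pform A (nb ! k) (x $ l *\<^sub>R a l) = 0" using k by (simp add: F_scale nb_V V)
      qed
      finally show False using 1 ya k by simp
    qed
    then show ?thesis using pos VV eq by simp
  qed
  ultimately show ?thesis using W by (simp add: siegel_space_def)
qed

lemma exists_period_matrix:
  "\<exists>W\<in>siegel_space g. \<forall>k<g. bs ! (g + k) = (\<Sum>j<g. W $$ (j, k) *\<^sub>C nb ! j)"
proof -
  have "\<exists>c. \<forall>k<g. bs ! (g + k) = (\<Sum>j<g. c k j *\<^sub>C nb ! j)"
  proof -
    have "\<forall>k. \<exists>c. k < g \<longrightarrow> bs ! (g + k) = (\<Sum>j<g. c j *\<^sub>C nb ! j)"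
      using is_cbasisD(3)[OF normal_basis_is_cbasis] bs_V by (simp add: length_nb)
    then show ?thesis by metis
  qed
  then obtain c where c: "\<And>k. k < g \<Longrightarrow> bs ! (g + k) = (\<Sum>j<g. c k j *\<^sub>C nb ! j)" by blast
  let ?W = "mat g g (\<lambda>(j, k). c k j)"
  have "\<forall>k<g. bs ! (g + k) = (\<Sum>j<g. ?W $$ (j, k) *\<^sub>C nb ! j)"
    using c by simp
  moreover from this have "?W \<in> siegel_space g" by (intro period_matrix_siegel) auto
  ultimately show ?thesis by blast
qed

end

lemma symplectic_pavI:
  assumes "pav A" "symplectic_basis A ds bs"
  shows "symplectic_pav A ds bs"
proof -
  interpret pav A by fact
  show ?thesis
  proof unfold_locales
    have len: "length bs = 2 * length ds" and J: "\<And>i j. i < 2 * length ds \<Longrightarrow> j < 2 * length ds \<Longrightarrow>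
        pform A (bs ! i) (bs ! j) = J_mat ds $$ (i, j)"
      using assms(2) by (auto simp: symplectic_basis_def)
    fix i j assume ij: "i < length ds" "j < length ds"
    show "pform A (bs ! i) (bs ! j) = 0"
      "pform A (bs ! (length ds + i)) (bs ! (length ds + j)) = 0"
      "pform A (bs ! i) (bs ! (length ds + j)) = (if i = j then real (ds ! i) else 0)"
      using ij J by (simp_all add: J_mat_index)
  qed (use assms(2) in \<open>auto simp: symplectic_basis_def\<close>)
qed

text \<open>The recursion starts with divisor 1. Nondegeneracy on the lattice holds because a vector
  orthogonal to a lattice basis is orthogonal to the whole space.\<close>

lemma (in pav) exists_symplectic_basis: "\<exists>ds bs. symplectic_basis A ds bs"
proof -
  obtain B where B: "zbasis (plat A) B" "span B = pspace A" by (rule obtain_zbasis)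
  have int: "\<exists>k::int. pform A x y = of_int (k * int 1)" if "x \<in> plat A" "y \<in> plat A" for x y
    using form_integral[OF that] by (auto elim: Ints_cases)
  have nd: "\<exists>y\<in>plat A. pform A x y \<noteq> 0" if x: "x \<in> plat A" "x \<noteq> 0" for x
  proof (rule ccontr)
    assume "\<not> (\<exists>y\<in>plat A. pform A x y \<noteq> 0)"
    then have "pform A x b = 0" if "b \<in> B" for b using zbasis_subset[OF B(1)] that by blast
    then have "pform A x y = 0" if "y \<in> pspace A" for y
      using F_span_zero[of B x y] lattice_subset zbasis_subset[OF B(1)] x that B(2) by blast
    then show False using F_nondegenerate[of x] x lattice_subset by blast
  qed
  have "\<exists>ds xs ys. length xs = length ds \<and> length ys = length ds \<and> distinct (xs @ ys) \<and>
     zbasis (plat A) (set (xs @ ys)) \<and> (\<forall>i<length ds. ds ! i > 0 \<and> 1 dvd ds ! i) \<and>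
     (\<forall>i. Suc i < length ds \<longrightarrow> ds ! i dvd ds ! Suc i) \<and>
     (\<forall>i<length ds. \<forall>j<length ds. pform A (xs ! i) (xs ! j) = 0 \<and> pform A (ys ! i) (ys ! j) = 0 \<and>
        pform A (xs ! i) (ys ! j) = (if i = j then real (ds ! i) else 0))"
    by (rule symplectic_basis_exists[OF refl B(1) lattice_subset]) (rule int, assumption+, rule nd, assumption+)
  then obtain ds xs ys where *: "length xs = length ds" "length ys = length ds" "distinct (xs @ ys)"
     "zbasis (plat A) (set (xs @ ys))" "\<forall>i<length ds. ds ! i > 0"
     "\<forall>i. Suc i < length ds \<longrightarrow> ds ! i dvd ds ! Suc i"
     and F: "\<And>i j. i < length ds \<Longrightarrow> j < length ds \<Longrightarrow> pform A (xs ! i) (xs ! j) = 0 \<and> pform A (ys ! i) (ys ! j) = 0 \<and>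
        pform A (xs ! i) (ys ! j) = (if i = j then real (ds ! i) else 0)"
    by blast
  let ?bs = "xs @ ys"
  have nth: "?bs ! i = xs ! i" "?bs ! (length ds + i) = ys ! i" if "i < length ds" for i
    using that * by (simp_all add: nth_append)
  interpret symplectic_pav A ds ?bs
    by unfold_locales (use * F nth in \<open>auto simp: is_lattice_basis_iff\<close>)
  have "pform A (?bs ! i) (?bs ! j) = J_mat ds $$ (i, j)" if ij: "i < 2 * length ds" "j < 2 * length ds" for i j
  proof -
    have c: "k < length ds \<or> (\<exists>k'<length ds. k = length ds + k')" if "k < 2 * length ds" for k
      using that by (metis add_diff_inverse_nat mult_2 nat_add_left_cancel_less)
    have yx: "pform A (?bs ! (length ds + k)) (?bs ! l) = - pform A (?bs ! l) (?bs ! (length ds + k))"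
      if "k < length ds" "l < length ds" for k l
      by (rule F_skew) (use that bs_V g_def in auto)
    show ?thesis using c[OF ij(1)] c[OF ij(2)]
      by (elim disjE exE conjE) (simp_all add: F_xx F_yy F_xy yx J_mat_index J_mat_index')
  qed
  then have "symplectic_basis A ds ?bs"
    unfolding symplectic_basis_def
    using * cdim_g basis length_bs by (simp add: g_def)
  then show ?thesis by blast
qed

section \<open>The period matrix of a subvariety\<close>

text \<open>Reads a column as a vector of V, so that matrix identities turn into identities of
  vectors and can be checked through a basis.\<close>

definition column_vector :: "'v::complex_vector list \<Rightarrow> complex mat \<Rightarrow> nat \<Rightarrow> 'v" where
  "column_vector vs M k = (\<Sum>r<length vs. M $$ (r, k) *\<^sub>C vs ! r)"

lemma column_vector_mult:
  assumes "M \<in> carrier_mat (length vs) m" "N \<in> carrier_mat m p" "k < p"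
  shows "column_vector vs (M * N) k = (\<Sum>j<m. N $$ (j, k) *\<^sub>C column_vector vs M j)"
proof -
  have "column_vector vs (M * N) k = (\<Sum>r<length vs. \<Sum>j<m. (M $$ (r, j) * N $$ (j, k)) *\<^sub>C vs ! r)"
    unfolding column_vector_def
    by (intro sum.cong refl)
      (use assms in \<open>simp add: scalar_prod_def complex_vector.scale_sum_left lessThan_atLeast0\<close>)
  also have "\<dots> = (\<Sum>j<m. N $$ (j, k) *\<^sub>C column_vector vs M j)"
    by (subst sum.swap) (simp add: column_vector_def complex_vector.scale_sum_right scaleC_scaleC mult.commute)
  finally show ?thesis .
qed

lemma column_vector_eq_iff:
  assumes "is_cbasis V vs" "M \<in> carrier_mat (length vs) m" "N \<in> carrier_mat (length vs) m"
  shows "M = N \<longleftrightarrow> (\<forall>k<m. column_vector vs M k = column_vector vs N k)"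
proof
  assume R: "\<forall>k<m. column_vector vs M k = column_vector vs N k"
  show "M = N"
  proof (rule eq_matI)
    fix i j assume "i < dim_row N" "j < dim_col N"
    then have ij: "i < length vs" "j < m" using assms by auto
    then show "M $$ (i, j) = N $$ (i, j)"
      using is_cbasis_unique[OF assms(1), of "\<lambda>r. M $$ (r, j)" "\<lambda>r. N $$ (r, j)"] R
      by (simp add: column_vector_def)
  qed (use assms in auto)
qed simp

text \<open>The columns of (E Z) P1 D^-1 are the vectors u_k / n_k and those of (E Z) P2 the vectors
  u_(h+k), written in the normal basis of A. The equation for W therefore expresses the latter in
  terms of the former.\<close>

lemma induced_period_eq_iff:
  assumes A: "symplectic_pav A ds bs" and B: "symplectic_pav B ns us"
    and Z: "Z \<in> carrier_mat (length ds) (length ds)"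
    and per: "is_period_matrix A (normal_basis ds bs) bs (normal_period_mat ds Z)"
    and P: "P1 \<in> carrier_mat (length bs) (length ns)" "P2 \<in> carrier_mat (length bs) (length ns)"
      "coordinate_matrix bs us (join_cols P1 P2)"
  shows "induced_period_eq ds Z ns P1 P2 W \<longleftrightarrow> W \<in> carrier_mat (length ns) (length ns) \<and>
    is_period_matrix B (normal_basis ns us) us (normal_period_mat ns W)"
proof (cases "W \<in> carrier_mat (length ns) (length ns)")
  case W: True
  interpret A: symplectic_pav A ds bs by fact
  interpret B: symplectic_pav B ns us by fact
  let ?g = "length ds" and ?h = "length ns" and ?PM = "normal_period_mat ds Z"
  let ?cv = "column_vector A.nb"
  have nb: "normal_basis ds bs = A.nb" by (simp add: A.nb_def)
  have lnb: "length A.nb = ?g" by (simp add: A.length_nb A.g_def)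
  have PM: "?PM \<in> carrier_mat (length A.nb) (length bs)"
    using join_cols_carrier[OF type_mat_carrier Z] by (simp add: lnb A.length_bs mult_2)
  have cvPM: "?cv ?PM i = bs ! i" if "i < length bs" for i
    using per that unfolding is_period_matrix_def nb column_vector_def by simp
  have us: "us ! k = (\<Sum>i<length bs. real_of_int (join_cols P1 P2 $$ (i, k)) *\<^sub>R bs ! i)" if "k < ?h + ?h" for k
    using P(3) that B.length_bs unfolding coordinate_matrix_def by simp
  have P1: "?cv (?PM * map_mat of_int P1) k = us ! k" if k: "k < ?h" for k
    using k P(1) join_cols_index[OF P(1,2), of _ k]
    by (subst column_vector_mult[OF PM, of _ ?h]) (auto simp: us cvPM scaleR_scaleC intro!: sum.cong)
  have P2: "?cv (?PM * map_mat of_int P2) k = us ! (?h + k)" if k: "k < ?h" for k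
    using k P(1,2) join_cols_index[OF P(1,2), of _ "?h + k"]
    by (subst column_vector_mult[OF PM, of _ ?h]) (auto simp: us cvPM scaleR_scaleC intro!: sum.cong)
  have M1: "?PM * map_mat of_int P1 \<in> carrier_mat (length A.nb) ?h" and M2: "?PM * map_mat of_int P2 \<in> carrier_mat (length A.nb) ?h"
    using PM P by auto
  have D: "type_mat_inv ns \<in> carrier_mat ?h ?h" by (simp add: type_mat_inv_def)
  have PD: "?cv (?PM * map_mat of_int P1 * type_mat_inv ns) k = B.nb ! k" if k: "k < ?h" for k
  proof -
    have "?cv (?PM * map_mat of_int P1 * type_mat_inv ns) k
       = (\<Sum>j<?h. type_mat_inv ns $$ (j, k) *\<^sub>C ?cv (?PM * map_mat of_int P1) j)"
      by (rule column_vector_mult[OF M1 D k])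
    also have "\<dots> = (\<Sum>j<?h. if j = k then (1 / real (ns ! k)) *\<^sub>R us ! k else 0)"
      using k by (intro sum.cong) (auto simp: type_mat_inv_def P1 scaleR_scaleC)
    finally show ?thesis using k by (simp add: B.nb_nth B.g_def)
  qed
  have M3: "?PM * map_mat of_int P1 * type_mat_inv ns \<in> carrier_mat (length A.nb) ?h" using M1 D by auto
  then have M4: "?PM * map_mat of_int P1 * type_mat_inv ns * W \<in> carrier_mat (length A.nb) ?h" using W by auto
  have "induced_period_eq ds Z ns P1 P2 W
     \<longleftrightarrow> ?PM * map_mat of_int P1 * type_mat_inv ns * W = ?PM * map_mat of_int P2"
    using W by (simp add: induced_period_eq_def)
  also have "\<dots> \<longleftrightarrow> (\<forall>k<?h. us ! (?h + k) = (\<Sum>j<?h. W $$ (j, k) *\<^sub>C B.nb ! j))"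
    unfolding column_vector_eq_iff[OF A.normal_basis_is_cbasis M4 M2]
    by (auto simp: P2 column_vector_mult[OF M3 W] PD)
  also have "\<dots> \<longleftrightarrow> is_period_matrix B (normal_basis ns us) us (normal_period_mat ns W)"
    using B.period_matrix_iff[of W] W by (simp add: B.nb_def B.g_def)
  finally show ?thesis using W by simp
qed (simp add: induced_period_eq_def)

text \<open>Existence comes from the normalized period matrix that B has as a polarized variety of
  its own; uniqueness holds because the vectors u_k / n_k are linearly independent over the complex
  numbers.\<close>

lemma induced_period_matrix:
  assumes A: "symplectic_pav A ds bs" and B: "symplectic_pav B ns us"
    and Z: "Z \<in> carrier_mat (length ds) (length ds)"
    and per: "is_period_matrix A (normal_basis ds bs) bs (normal_period_mat ds Z)"
    and P: "P1 \<in> carrier_mat (length bs) (length ns)" "P2 \<in> carrier_mat (length bs) (length ns)"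
      "coordinate_matrix bs us (join_cols P1 P2)"
  shows "\<exists>W\<in>siegel_space (length ns). induced_period_eq ds Z ns P1 P2 W \<and>
     (\<forall>W'. induced_period_eq ds Z ns P1 P2 W' \<longrightarrow> W' = W) \<and>
     is_period_matrix B (normal_basis ns us) us (normal_period_mat ns W)"
proof -
  interpret B: symplectic_pav B ns us by fact
  note iff = induced_period_eq_iff[OF A B Z per P]
  obtain W where W: "W \<in> siegel_space B.g" "\<forall>k<B.g. us ! (B.g + k) = (\<Sum>j<B.g. W $$ (j, k) *\<^sub>C B.nb ! j)"
    using B.exists_period_matrix by blast
  then have Wc: "W \<in> carrier_mat B.g B.g" by (simp add: siegel_space_def)
  have 1: "is_period_matrix B (normal_basis ns us) us (normal_period_mat ns W)"
    using B.period_matrix_iff[OF Wc] W(2) by (simp add: B.nb_def)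
  then have 2: "induced_period_eq ds Z ns P1 P2 W"
    using iff[of W] Wc by (simp add: B.g_def)
  have 3: "W' = W" if "induced_period_eq ds Z ns P1 P2 W'" for W'
  proof -
    have W': "W' \<in> carrier_mat B.g B.g" "is_period_matrix B B.nb us (normal_period_mat ns W')"
      using iff that by (auto simp: B.g_def B.nb_def)
    then have "\<forall>k<B.g. us ! (B.g + k) = (\<Sum>j<B.g. W' $$ (j, k) *\<^sub>C B.nb ! j)"
      using B.period_matrix_iff by blast
    with W(2) have eq: "column_vector B.nb W' k = column_vector B.nb W k" if "k < B.g" for k
      using that by (simp add: column_vector_def B.length_nb)
    have c: "W' \<in> carrier_mat (length B.nb) B.g" "W \<in> carrier_mat (length B.nb) B.g"
      using Wc W' by (simp_all add: B.length_nb)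
    show ?thesis using column_vector_eq_iff[OF B.normal_basis_is_cbasis c] eq by blast
  qed
  show ?thesis
    by (rule bexI[OF _ W(1)[unfolded B.g_def]]) (use 1 2 3 in blast)
qed

lemma exists_coordinate_matrix:
  assumes "is_lattice_basis L bs" "set us \<subseteq> L" "length us = h + h"
  shows "\<exists>P1 P2. P1 \<in> carrier_mat (length bs) h \<and> P2 \<in> carrier_mat (length bs) h \<and>
    coordinate_matrix bs us (join_cols P1 P2)"
proof -
  have "\<exists>c :: nat \<Rightarrow> int. k < length us \<longrightarrow> us ! k = (\<Sum>i<length bs. real_of_int (c i) *\<^sub>R bs ! i)" for k
  proof (cases "k < length us")
    case True
    then have "us ! k \<in> L" using assms(2) nth_mem by blast
    then show ?thesis using assms(1) unfolding is_lattice_basis_def by auto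
  qed simp
  then obtain c :: "nat \<Rightarrow> nat \<Rightarrow> int" where
    c: "\<And>k. k < length us \<Longrightarrow> us ! k = (\<Sum>i<length bs. real_of_int (c k i) *\<^sub>R bs ! i)" by metis
  let ?P1 = "mat (length bs) h (\<lambda>(i, k). c k i)" and ?P2 = "mat (length bs) h (\<lambda>(i, k). c (h + k) i)"
  have ix: "join_cols ?P1 ?P2 $$ (i, k) = c k i" if "i < length bs" "k < h + h" for i k
    using that by (subst join_cols_index[of _ "length bs" h _ h]) auto
  have "coordinate_matrix bs us (join_cols ?P1 ?P2)"
    unfolding coordinate_matrix_def using c assms(3) ix by (auto intro!: sum.cong)
  then show ?thesis by (intro exI[of _ ?P1] exI[of _ ?P2]) simp
qed

section \<open>Two-forms attached to alternating forms\<close>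

lemma wedge_dx_dx: "i < j \<Longrightarrow> wedge (dx i) (dx j) = (\<lambda>I. if I = {i, j} then 1 else 0)"
proof -
  assume "i < j"
  then have "ext_dx i * ext_dx j = monomial_at {i, j} 1"
    by (subst (2) ext_dx_monomial) (simp add: ext_dx_times_monomial shuffle_sign_singletons)
  then have "wedge (dx i) (dx j) = coeff_of (monomial_at {i, j} 1)"
    by (metis coeff_of_dx coeff_of_simps(6))
  then show ?thesis by (simp add: coeff_of_monomial)
qed

lemma two_form_coeff:
  assumes "i < j" "j < N"
  shows "two_form N a {i, j} = a i j"
proof -
  have w: "wedge (dx k) (dx l) {i, j} = (if k = i \<and> l = j then 1 else 0)" if "k < l" for k l
    using that assms(1) by (auto simp: wedge_dx_dx doubleton_eq_iff)
  have "two_form N a {i, j} = (\<Sum>k<N. \<Sum>l\<in>{k<..<N}. if k = i then if l = j then a i j else 0 else 0)"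
    unfolding two_form_def by (intro sum.cong refl) (use w in auto)
  also have "\<dots> = (\<Sum>k<N. if k = i then (\<Sum>l\<in>{k<..<N}. if l = j then a i j else 0) else 0)"
    by (intro sum.cong refl) auto
  also have "\<dots> = a i j" using assms by simp
  finally show ?thesis .
qed

lemma anticommuting_pairs_commute:
  fixes a b c d :: "'a::ring_1"
  assumes "a * c = - (c * a)" "a * d = - (d * a)" "b * c = - (c * b)" "b * d = - (d * b)"
  shows "(a * b) * (c * d) = (c * d) * (a * b)"
proof -
  have "(a * b) * (c * d) = a * (b * c) * d" by (simp add: mult.assoc)
  also have "\<dots> = - ((a * c) * (b * d))" unfolding assms(3) by (simp add: mult.assoc)
  also have "\<dots> = - (c * (a * d) * b)" unfolding assms(1,4) by (simp add: mult.assoc)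
  also have "\<dots> = (c * d) * (a * b)" unfolding assms(2) by (simp add: mult.assoc)
  finally show ?thesis .
qed

lemma one_form_pair_commute:
  "(one_form N a * one_form N b) * (one_form N c * one_form N d)
     = (one_form N c * one_form N d) * (one_form N a * one_form N b)"
  by (intro anticommuting_pairs_commute one_form_anticommute)

lemma one_form_pair_square: "(one_form N a * one_form N b) * (one_form N a * one_form N b) = 0"
proof -
  have "(one_form N a * one_form N b) * (one_form N a * one_form N b)
      = one_form N a * (one_form N b * one_form N a) * one_form N b" by (simp only: mult.assoc)
  also have "\<dots> = - (one_form N a * one_form N a * (one_form N b * one_form N b))"
    by (subst one_form_anticommute[of N b a]) (simp add: mult.assoc)
  finally show ?thesis by (simp add: one_form_square)
qed

text \<open>Each summand is a product of two anticommuting factors, and moving two past two changes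
  the sign an even number of times.\<close>

lemma ext_two_form_commute: "ext_two_form N a * ext_two_form N b = ext_two_form N b * ext_two_form N a"
proof -
  have c: "(ext_const x * (ext_dx i * ext_dx j)) * (ext_const y * (ext_dx k * ext_dx l))
     = (ext_const y * (ext_dx k * ext_dx l)) * (ext_const x * (ext_dx i * ext_dx j))" for x y i j k l
  proof -
    have p: "(ext_dx i * ext_dx j) * (ext_dx k * ext_dx l) = (ext_dx k * ext_dx l) * (ext_dx i * ext_dx j)"
      by (intro anticommuting_pairs_commute ext_dx_anticommute)
    have "(ext_const x * P) * (ext_const y * Q) = ext_const (x * y) * (P * Q)" for x y P Q
      by (metis ext_const_left_commute ext_const_simps(6) mult.assoc)
    then show ?thesis using p by (simp only: mult.commute[of x y])
  qed
  have d: "(ext_const x * (ext_dx i * ext_dx j)) * ext_two_form N b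
     = ext_two_form N b * (ext_const x * (ext_dx i * ext_dx j))" for x i j
    unfolding ext_two_form_def sum_distrib_left sum_distrib_right by (intro sum.cong refl c)
  show ?thesis
    by (subst (1 4) ext_two_form_def) (simp only: sum_distrib_left sum_distrib_right d)
qed

lemma ext_const_cancel: "ext_const c * a = 0 \<Longrightarrow> a \<noteq> 0 \<Longrightarrow> c = 0"
proof -
  assume 0: "ext_const c * a = 0" and "a \<noteq> 0"
  then obtain K where "coeff_of a K \<noteq> 0" using extalg_eqI[of a 0] by auto
  moreover have "coeff_of (ext_const c * a) K = 0" unfolding 0 by simp
  then have "c * coeff_of a K = 0" unfolding coeff_of_const_mult .
  ultimately show "c = 0" by simp
qed

text \<open>The products \<omega>^r \<theta>^(g-r) of the criterion become the coefficients of a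
  single polynomial in x.\<close>

lemma mixed_powers_expand:
  assumes "\<theta> * w = w * \<theta>"
  shows "(ext_const x * \<theta> - w) ^ g
     = (\<Sum>r\<le>g. ext_const ((-1) ^ r * x ^ (g - r)) * (of_nat (g choose r) * (w ^ r * \<theta> ^ (g - r))))"
proof -
  have "(ext_const x * \<theta>) * (- w) = (- w) * (ext_const x * \<theta>)"
    using assms by (simp add: mult.assoc ext_const_left_commute)
  then have "(ext_const x * \<theta> + - w) ^ g
     = (\<Sum>r\<le>g. of_nat (g choose r) * ((- w) ^ r * (ext_const x * \<theta>) ^ (g - r)))"
    by (rule commuting_binomial)
  also have "\<dots> = (\<Sum>r\<le>g. ext_const ((-1) ^ r * x ^ (g - r)) * (of_nat (g choose r) * (w ^ r * \<theta> ^ (g - r))))"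
  proof (intro sum.cong refl)
    fix r
    have a: "(- w) ^ r = ext_const ((-1) ^ r) * w ^ r"
      by (cases "even r") (simp_all add: ext_const_simps)
    have b: "(ext_const x * \<theta>) ^ k = ext_const (x ^ k) * \<theta> ^ k" for k
    proof (induction k)
      case (Suc k)
      have "ext_const x * \<theta> * (ext_const (x ^ k) * \<theta> ^ k) = ext_const x * (ext_const (x ^ k) * (\<theta> * \<theta> ^ k))"
        by (simp only: mult.assoc ext_const_left_commute[of \<theta>])
      then show ?case by (simp add: Suc ext_const_simps(6) mult.assoc)
    qed (simp add: ext_const_simps)
    show "of_nat (g choose r) * ((- w) ^ r * (ext_const x * \<theta>) ^ (g - r))
        = ext_const ((-1) ^ r * x ^ (g - r)) * (of_nat (g choose r) * (w ^ r * \<theta> ^ (g - r)))"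
      unfolding a b ext_const_simps(6) ext_const_of_nat[symmetric] mult.assoc
      by (metis ext_const_left_commute mult.assoc)
  qed
  finally show ?thesis by simp
qed

text \<open>Evaluates the polynomial whose coefficients are the right-hand sides of the
  criterion.\<close>

lemma signed_binomial:
  fixes x :: complex
  assumes "n \<le> g"
  shows "(\<Sum>r\<le>g. (-1) ^ r * x ^ (g - r) * of_nat (n choose r)) = x ^ (g - n) * (x - 1) ^ n"
proof -
  have "(\<Sum>r\<le>g. (-1) ^ r * x ^ (g - r) * of_nat (n choose r)) = (\<Sum>r\<le>n. (-1) ^ r * x ^ (g - r) * of_nat (n choose r))"
    by (rule sum.mono_neutral_right) (use assms in \<open>auto simp: binomial_eq_0\<close>)
  also have "\<dots> = (\<Sum>r\<le>n. x ^ (g - n) * (of_nat (n choose r) * (-1) ^ r * x ^ (n - r)))"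
  proof (intro sum.cong refl)
    fix r assume "r \<in> {..n}"
    then have "g - r = (g - n) + (n - r)" using assms by simp
    then have "x ^ (g - r) = x ^ (g - n) * x ^ (n - r)" by (simp only: power_add)
    then show "(-1) ^ r * x ^ (g - r) * of_nat (n choose r) = x ^ (g - n) * (of_nat (n choose r) * (-1) ^ r * x ^ (n - r))"
      by simp
  qed
  also have "\<dots> = x ^ (g - n) * (-1 + x) ^ n"
    by (simp only: binomial_ring[of "-1" x n] sum_distrib_left)
  finally show ?thesis by simp
qed

text \<open>At every index set K both sides are polynomial functions of x that agree everywhere. The
  proof substitutes g - r for r to arrange them in ascending powers.\<close>

lemma coefficients_eqI:
  fixes a b :: "nat \<Rightarrow> extalg"
  assumes "\<And>x. (\<Sum>r\<le>g. ext_const ((-1) ^ r * x ^ (g - r)) * a r) = (\<Sum>r\<le>g. ext_const ((-1) ^ r * x ^ (g - r)) * b r)"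
    and "r \<le> g"
  shows "a r = b r"
proof (rule extalg_eqI)
  fix K
  have "(\<Sum>r\<le>g. ((-1) ^ (g - r) * coeff_of (a (g - r)) K) * x ^ r)
      = (\<Sum>r\<le>g. ((-1) ^ (g - r) * coeff_of (b (g - r)) K) * x ^ r)" for x
  proof -
    have re: "(\<Sum>r\<le>g. ((-1) ^ (g - r) * coeff_of (c (g - r)) K) * x ^ r)
        = coeff_of (\<Sum>r\<le>g. ext_const ((-1) ^ r * x ^ (g - r)) * c r) K" for c
      unfolding coeff_of_sum coeff_of_const_mult
      by (rule sum.reindex_bij_witness[where i = "\<lambda>r. g - r" and j = "\<lambda>r. g - r"]) auto
    show ?thesis unfolding re using assms(1)[of x] by simp
  qed
  then have "\<forall>x. (\<Sum>r\<le>g. ((-1) ^ (g - r) * coeff_of (a (g - r)) K) * x ^ r)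
      = (\<Sum>r\<le>g. ((-1) ^ (g - r) * coeff_of (b (g - r)) K) * x ^ r)" by blast
  then have "\<forall>i\<le>g. (-1) ^ (g - i) * coeff_of (a (g - i)) K = (-1) ^ (g - i) * coeff_of (b (g - i)) K"
    unfolding polyfun_eq_coeffs .
  then show "coeff_of (a r) K = coeff_of (b r) K" using assms(2) by (metis diff_diff_cancel diff_le_self mult_left_cancel power_not_zero zero_neq_neg_one)
qed

section \<open>Admissible forms\<close>

lemma of_rat_complex: "complex_of_real (of_rat r) = of_rat r"
  by (cases r) (simp add: of_rat_rat)

locale period_pav = symplectic_pav A ds bs for A :: "'v::complex_vector pav" and ds bs +
  fixes Z :: "complex mat"
  assumes Z: "Z \<in> carrier_mat (length ds) (length ds)"
    and period: "is_period_matrix A (normal_basis ds bs) bs (normal_period_mat ds Z)"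
begin

definition "PM = normal_period_mat ds Z"
definition "dzf j = one_form (2 * g) (\<lambda>i. PM $$ (j, i))"
definition "Dz = prod_list (map dzf [0..<g])"
text \<open>\<open>gamma\<close> without its sign, so that \<open>gamma bs \<mu>\<close> corresponds
  to \<open>- bform \<mu>\<close>.\<close>

definition bform :: "('v \<Rightarrow> 'v \<Rightarrow> real) \<Rightarrow> extalg" where
  "bform \<mu> = ext_two_form (2 * g) (\<lambda>i j. complex_of_real (\<mu> (bs ! i) (bs ! j)))"
definition "th = - bform (pform A)"

lemma length_bs_g: "length bs = 2 * g" by (simp add: length_bs g_def)

lemma gamma_bform: "gamma bs \<mu> = coeff_of (- bform \<mu>)"
  by (rule ext) (simp add: gamma_def bform_def coeff_of_two_form length_bs_g)

lemma PM_carrier: "PM \<in> carrier_mat g (2 * g)"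
  using join_cols_carrier[OF type_mat_carrier Z] by (simp add: PM_def g_def mult_2)

lemma PM_left: "j < g \<Longrightarrow> i < g \<Longrightarrow> PM $$ (j, i) = (if j = i then of_nat (ds ! i) else 0)"
  using join_cols_index[OF type_mat_carrier Z, of j i] by (simp add: PM_def type_mat_def g_def)

lemma bs_PM: "i < 2 * g \<Longrightarrow> bs ! i = (\<Sum>j<g. PM $$ (j, i) *\<^sub>C nb ! j)"
  using period unfolding is_period_matrix_def by (simp add: length_bs_g length_nb PM_def nb_def[symmetric])

lemma dzf_Dz: "j < g \<Longrightarrow> dzf j * Dz = 0"
  using one_form_times_prod_list[of "\<lambda>i. PM $$ (j, i)" "map (\<lambda>j i. PM $$ (j, i)) [0..<g]" "2 * g"]
  by (simp add: Dz_def dzf_def[abs_def] comp_def)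

lemma coeff_of_dzf: "coeff_of (dzf j) = dz PM j"
  using PM_carrier
  by (auto simp: dzf_def dz_def one_form_def coeff_of_sum fun_eq_iff coeff_of_const_mult simp del: coeff_of_simps(6))

lemma coeff_of_Dz: "coeff_of Dz = wedge_list (map (dz PM) [0..<g])"
  by (simp add: Dz_def coeff_of_prod_list coeff_of_dzf[abs_def] comp_def)

lemma bform_F: "bform (pform A) = (\<Sum>i<g. ext_const (of_nat (ds ! i)) * (ext_dx i * ext_dx (g + i)))"
proof -
  let ?t = "\<lambda>i j. ext_const (complex_of_real (pform A (bs ! i) (bs ! j))) * (ext_dx i * ext_dx j)"
  have J: "pform A (bs ! i) (bs ! j) = (if i < g \<and> j = g + i then real (ds ! i) else 0)"
    if ij: "i < j" "j < 2 * g" for i j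
  proof -
    consider "i < g" "j < g" | "i < g" "\<not> j < g" | "\<not> i < g" by blast
    then show ?thesis
    proof cases
      case 1 then show ?thesis using F_xx[folded g_def, of i j] by simp
    next
      case 2
      then have "j = g + (j - g)" "j - g < g" using ij by auto
      then show ?thesis using F_xy[folded g_def, of i "j - g"] 2 by (metis add_diff_cancel_left')
    next
      case 3
      then have "i = g + (i - g)" "i - g < g" "j = g + (j - g)" "j - g < g" using ij by auto
      then show ?thesis using F_yy[folded g_def, of "i - g" "j - g"] 3 by metis
    qed
  qed
  have "bform (pform A) = (\<Sum>i<2 * g. \<Sum>j\<in>{i<..<2 * g}. ?t i j)" by (simp add: bform_def ext_two_form_def)
  also have "\<dots> = (\<Sum>i<2 * g. if i < g then ext_const (of_nat (ds ! i)) * (ext_dx i * ext_dx (g + i)) else 0)"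
  proof (intro sum.cong refl)
    fix i assume i: "i \<in> {..<2 * g}"
    have "(\<Sum>j\<in>{i<..<2 * g}. ?t i j)
      = (\<Sum>j\<in>{i<..<2 * g}. if j = g + i then (if i < g then ext_const (of_nat (ds ! i)) * (ext_dx i * ext_dx (g + i)) else 0) else 0)"
      by (rule sum.cong) (auto simp: J ext_const_simps)
    also have "\<dots> = (if i < g then ext_const (of_nat (ds ! i)) * (ext_dx i * ext_dx (g + i)) else 0)"
      by simp
    finally show "(\<Sum>j\<in>{i<..<2 * g}. ?t i j) = (if i < g then ext_const (of_nat (ds ! i)) * (ext_dx i * ext_dx (g + i)) else 0)" .
  qed
  also have "\<dots> = (\<Sum>i<g. ext_const (of_nat (ds ! i)) * (ext_dx i * ext_dx (g + i)))"
    by (rule sum.mono_neutral_cong_right) auto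
  finally show ?thesis .
qed

lemma theta_th: "theta ds = coeff_of th"
  by (rule ext) (simp add: theta_def th_def bform_F coeff_of_sum coeff_of_const_mult g_def[symmetric] del: coeff_of_simps(6), simp)

text \<open>Up to a nonzero scalar this power is the volume form, a single monomial. Hence scalars
  can be compared in equations between multiples of \<theta>^g.\<close>

lemma th_power_nonzero: "th ^ g \<noteq> 0"
proof -
  let ?E = "\<lambda>i. ext_dx i * ext_dx (g + i)"
  have th: "th = (\<Sum>i<g. ext_const (- of_nat (ds ! i)) * ?E i)"
    unfolding th_def bform_F ext_const_simps(4) by (simp add: sum_negf)
  have com: "?E i * ?E j = ?E j * ?E i" for i j
    by (intro anticommuting_pairs_commute ext_dx_anticommute)
  have sq: "?E i * ?E i = 0" for i
  proof -
    have "?E i * ?E i = ext_dx i * (ext_dx (g + i) * ext_dx i) * ext_dx (g + i)" by (simp only: mult.assoc)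
    also have "\<dots> = - (ext_dx i * ext_dx i * (ext_dx (g + i) * ext_dx (g + i)))"
      by (subst ext_dx_anticommute[of "g + i" i]) (simp add: mult.assoc)
    finally show ?thesis by (simp add: ext_dx_square)
  qed
  have e: "th ^ g = ext_const (fact g * (\<Prod>k<g. - of_nat (ds ! k))) * prod_list (map ?E [0..<g])"
    unfolding th using commuting_sum_power[of ?E "\<lambda>i. - of_nat (ds ! i)" g] com sq by blast
  have p: "prod_list (map ?E is) = prod_list (map ext_dx (concat (map (\<lambda>i. [i, g + i]) is)))" for "is"
    by (induction "is") (simp_all add: mult.assoc)
  have "m \<le> g \<Longrightarrow> distinct (concat (map (\<lambda>i. [i, g + i]) [0..<m]))" for m
    by (induction m) auto
  then obtain c where c: "c \<noteq> 0" "prod_list (map ?E [0..<g]) = monomial_at (set (concat (map (\<lambda>i. [i, g + i]) [0..<g]))) c"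
    unfolding p using prod_list_dx by blast
  have "prod_list (map ?E [0..<g]) \<noteq> 0" unfolding c(2) by (rule monomial_at_nonzero) (use c in auto)
  moreover have "fact g * (\<Prod>k<g. - of_nat (ds ! k)) \<noteq> (0::complex)"
    using ds_pos[folded g_def] by (auto simp: prod_zero_iff)
  ultimately show ?thesis using e ext_const_cancel by metis
qed

lemma admissible_iff:
  "admissible ds Z n (coeff_of w) \<longleftrightarrow> coeff_of w \<in> rational_two_forms (2 * g) \<and> w * Dz = 0 \<and>
    (\<forall>r\<in>{1..g}. of_nat (g choose r) * (w ^ r * th ^ (g - r)) = of_nat (n choose r) * th ^ g)"
proof -
  have z: "coeff_of x = (\<lambda>_. 0) \<longleftrightarrow> x = 0" for x using coeff_of_inject[of x 0] by simp
  have 1: "(wedge (coeff_of w) (wedge_list (map (dz PM) [0..<g])) = (\<lambda>_. 0)) \<longleftrightarrow> w * Dz = 0"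
    unfolding coeff_of_Dz[symmetric] coeff_of_simps(6)[symmetric] z ..
  have c: "(\<lambda>K. of_nat m * coeff_of a K) = coeff_of (of_nat m * a)" for m a
    unfolding ext_const_of_nat[symmetric] coeff_of_const_mult ..
  have 2: "((\<lambda>K. of_nat m * wedge (wedge_power (coeff_of w) r) (wedge_power (coeff_of th) s) K)
     = (\<lambda>K. of_nat m' * wedge_power (coeff_of th) s' K))
     \<longleftrightarrow> of_nat m * (w ^ r * th ^ s) = of_nat m' * th ^ s'" for m m' r s s'
    unfolding coeff_of_power[symmetric] coeff_of_simps(6)[symmetric] c coeff_of_inject ..
  show ?thesis
    unfolding admissible_def Let_def theta_th g_def[symmetric] PM_def[symmetric] 1 2 ..
qed

lemma bform_commute: "bform \<mu> * bform \<nu> = bform \<nu> * bform \<mu>"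
  unfolding bform_def by (rule ext_two_form_commute)

end

locale eigen_pav = period_pav A ds bs Z + U: unitary_basis "pspace A" "pform A" g e
  for A :: "'v::complex_vector pav" and ds bs Z e +
  fixes f :: "'v \<Rightarrow> 'v" and t :: "nat \<Rightarrow> real"
  assumes f_V: "x \<in> pspace A \<Longrightarrow> f x \<in> pspace A"
    and f_self: "x \<in> pspace A \<Longrightarrow> y \<in> pspace A \<Longrightarrow> pform A (f x) y = pform A x (f y)"
    and f_scale: "x \<in> pspace A \<Longrightarrow> f (c *\<^sub>C x) = c *\<^sub>C f x"
    and f_e: "k < g \<Longrightarrow> f (e k) = t k *\<^sub>R e k"
begin

text \<open>\<open>pf k\<close> and \<open>qf k\<close> are the real and the imaginary part of the
  unitary coordinate \<open>zeta k\<close>, written as linear forms in the dx_i.\<close>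

definition "pf k = one_form (2 * g) (\<lambda>i. complex_of_real (pform A (bs ! i) (\<i> *\<^sub>C e k)))"
definition "qf k = one_form (2 * g) (\<lambda>i. complex_of_real (pform A (e k) (bs ! i)))"
definition "Ek k = pf k * qf k"

lemma Ek_commute: "Ek i * Ek j = Ek j * Ek i" and Ek_square: "Ek i * Ek i = 0"
  unfolding Ek_def pf_def qf_def by (rule one_form_pair_commute one_form_pair_square)+

text \<open>Self-adjointness moves f onto e_k and i e_k, where it is multiplication by t_k; then
  \<open>F_right\<close> applies to f x.\<close>

lemma form_diagonal:
  assumes x: "x \<in> pspace A" and y: "y \<in> pspace A"
  shows "pform A (f x) y = (\<Sum>k<g. t k *
    (pform A x (\<i> *\<^sub>C e k) * pform A (e k) y - pform A (e k) x * pform A y (\<i> *\<^sub>C e k)))"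
proof -
  have "pform A (f x) (\<i> *\<^sub>C e k) = t k * pform A x (\<i> *\<^sub>C e k)" "pform A (e k) (f x) = t k * pform A (e k) x"
    if "k < g" for k
  proof -
    have "f (\<i> *\<^sub>C e k) = t k *\<^sub>R (\<i> *\<^sub>C e k)" using f_scale[OF U.e_V[OF that]] f_e[OF that] by (simp add: scaleC_scaleR)
    then show "pform A (f x) (\<i> *\<^sub>C e k) = t k * pform A x (\<i> *\<^sub>C e k)"
      using f_self[OF x V_scaleC[OF U.e_V[OF that]]] x U.e_V[OF that] by (simp add: F_scale V_scaleC)
    show "pform A (e k) (f x) = t k * pform A (e k) x"
      using f_self[OF U.e_V[OF that] x] f_e[OF that] x U.e_V[OF that] by (simp add: F_scale)
  qed
  then show ?thesis
    using U.F_right[OF f_V[OF x] y] by (simp add: algebra_simps)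
qed

lemma bform_diagonal:
  assumes "\<And>x y. x \<in> pspace A \<Longrightarrow> y \<in> pspace A \<Longrightarrow> \<mu> x y = pform A (f x) y"
  shows "bform \<mu> = (\<Sum>k<g. ext_const (t k) * Ek k)"
proof -
  have "bform \<mu> = ext_two_form (2 * g) (\<lambda>i j. \<Sum>k<g. complex_of_real (t k) *
     (complex_of_real (pform A (bs ! i) (\<i> *\<^sub>C e k)) * complex_of_real (pform A (e k) (bs ! j))
     - complex_of_real (pform A (bs ! j) (\<i> *\<^sub>C e k)) * complex_of_real (pform A (e k) (bs ! i))))"
    unfolding bform_def ext_two_form_def
    by (intro sum.cong refl) (auto simp: assms form_diagonal bs_V mult.commute)
  then show ?thesis
    unfolding ext_two_form_sum ext_two_form_linear(2) Ek_def pf_def qf_def one_form_mult .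
qed

text \<open>\<open>Ek\<close> is also the product of a complex linear form, which is a combination of the \<open>dz\<close>, and \<open>qf\<close>.\<close>

lemma Ek_Dz: "k < g \<Longrightarrow> Ek k * Dz = 0"
proof -
  assume k: "k < g"
  let ?z = "one_form (2 * g) (\<lambda>i. U.zeta k (bs ! i))"
  have "?z = one_form (2 * g) (\<lambda>i. complex_of_real (pform A (bs ! i) (\<i> *\<^sub>C e k)) + \<i> * complex_of_real (pform A (e k) (bs ! i)))"
    by (rule arg_cong[of _ _ "one_form _"]) (auto simp: U.zeta_def complex_eq_iff)
  then have z: "?z = pf k + ext_const \<i> * qf k" unfolding one_form_linear pf_def qf_def .
  then have "?z * qf k = Ek k + ext_const \<i> * (qf k * qf k)" by (simp add: Ek_def distrib_right mult.assoc)
  then have zq: "Ek k = ?z * qf k" by (simp add: qf_def one_form_square ext_const_simps)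
  \<comment> \<open>The function \<open>zeta k\<close> is complex linear, so applying it to
    \<open>bs ! i\<close>, whose coordinates in \<open>nb\<close> are the i-th column of
    \<open>PM\<close>, writes \<open>?z\<close> as a combination of the dz_j.\<close>
  have "?z = (\<Sum>i<2 * g. ext_const (\<Sum>j<g. U.zeta k (nb ! j) * PM $$ (j, i)) * ext_dx i)"
    unfolding one_form_def
  proof (intro sum.cong refl arg_cong[of _ _ "\<lambda>c. ext_const c * _"])
    fix i assume "i \<in> {..<2 * g}"
    then have "U.zeta k (bs ! i) = U.zeta k (\<Sum>j<g. PM $$ (j, i) *\<^sub>C nb ! j)" using bs_PM by simp
    also have "\<dots> = (\<Sum>j<g. U.zeta k (nb ! j) * PM $$ (j, i))"
      using k by (subst U.zeta_sum) (auto simp: V_scaleC nb_V U.zeta_scale mult.commute)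
    finally show "U.zeta k (bs ! i) = (\<Sum>j<g. U.zeta k (nb ! j) * PM $$ (j, i))" .
  qed
  also have "\<dots> = one_form (2 * g) (\<lambda>i. \<Sum>j<g. U.zeta k (nb ! j) * PM $$ (j, i))"
    by (simp add: one_form_def)
  also have "\<dots> = (\<Sum>j<g. ext_const (U.zeta k (nb ! j)) * dzf j)"
    by (simp only: one_form_sum one_form_linear dzf_def)
  finally have zz: "?z = (\<Sum>j<g. ext_const (U.zeta k (nb ! j)) * dzf j)" .
  have "?z * Dz = 0" unfolding zz by (simp add: sum_distrib_right mult.assoc dzf_Dz)
  moreover have "?z * qf k = - (qf k * ?z)" unfolding qf_def by (rule one_form_anticommute)
  then have "Ek k * Dz = - (qf k * (?z * Dz))" unfolding zq by (simp add: mult.assoc)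
  ultimately show "Ek k * Dz = 0" by simp
qed

lemma bform_F_diagonal: "bform (pform A) = (\<Sum>k<g. Ek k)"
proof -
  \<comment> \<open>The polarization belongs to the identity map, whose eigenvalues are all
    1.\<close>
  interpret I: eigen_pav A ds bs Z e "\<lambda>x. x" "\<lambda>_. 1"
    by unfold_locales auto
  have "I.Ek k = Ek k" for k by (simp add: I.Ek_def Ek_def I.pf_def pf_def I.qf_def qf_def)
  then show ?thesis using I.bform_diagonal[of "pform A"] by (simp add: ext_const_simps)
qed

text \<open>\<theta> and \<omega> both carry the minus sign of \<open>gamma\<close>, so x\<theta> -
  \<omega> has the coefficients t_k - x.\<close>

lemma mixed_power_diagonal:
  assumes mu: "\<And>x y. x \<in> pspace A \<Longrightarrow> y \<in> pspace A \<Longrightarrow> \<mu> x y = pform A (f x) y"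
  shows "(ext_const x * th - (- bform \<mu>)) ^ g
    = ext_const (fact g * (\<Prod>k<g. complex_of_real (t k) - x)) * prod_list (map Ek [0..<g])"
proof -
  have d: "bform \<mu> = (\<Sum>k<g. ext_const (t k) * Ek k)" by (rule bform_diagonal) (rule mu)
  have "ext_const x * th - (- bform \<mu>) = (\<Sum>k<g. ext_const (complex_of_real (t k) - x) * Ek k)"
    unfolding th_def bform_F_diagonal d
    by (simp add: ext_const_simps left_diff_distrib sum_subtractf sum_distrib_left)
  then show ?thesis using commuting_sum_power[of Ek] Ek_commute Ek_square by metis
qed

lemma th_power_diagonal: "th ^ g = ext_const (fact g * (-1) ^ g) * prod_list (map Ek [0..<g])"
proof -
  have "th = (\<Sum>k<g. ext_const (-1) * Ek k)"
    unfolding th_def bform_F_diagonal by (simp add: ext_const_simps sum_negf)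
  then have "th ^ g = ext_const (fact g * (\<Prod>k<g. -1)) * prod_list (map Ek [0..<g])"
    using commuting_sum_power[of Ek "\<lambda>_. -1" g] Ek_commute Ek_square by metis
  then show ?thesis by simp
qed

text \<open>At x = t_k the diagonal formula makes (x\<theta> - \<omega>)^g vanish, while the
  criterion turns it into x^(g-n) (x-1)^n \<theta>^g; since \<theta>^g is nonzero, x is 0 or
  1.\<close>

lemma eigenvalues_of_admissible:
  assumes mu: "\<And>x y. x \<in> pspace A \<Longrightarrow> y \<in> pspace A \<Longrightarrow> \<mu> x y = pform A (f x) y"
    and adm: "admissible ds Z n (gamma bs \<mu>)" and n: "n \<le> g" and k: "k < g"
  shows "t k = 0 \<or> t k = 1"
proof -
  define w where "w = - bform \<mu>"
  define x where "x = complex_of_real (t k)"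
  have com: "th * w = w * th" unfolding th_def w_def using bform_commute by simp
  have "admissible ds Z n (coeff_of w)" using adm gamma_bform w_def by simp
  \<comment> \<open>The criterion starts at r = 1; for r = 0 both binomial coefficients are 1 and
    the equation is trivial.\<close>
  then have eq: "of_nat (g choose r) * (w ^ r * th ^ (g - r)) = of_nat (n choose r) * th ^ g" if "r \<le> g" for r
    using that unfolding admissible_iff by (cases "r = 0") auto
  have "(ext_const x * th - w) ^ g = (\<Sum>r\<le>g. ext_const ((-1) ^ r * x ^ (g - r)) * (of_nat (n choose r) * th ^ g))"
    unfolding mixed_powers_expand[OF com] by (intro sum.cong refl) (simp add: eq)
  also have "\<dots> = ext_const (\<Sum>r\<le>g. (-1) ^ r * x ^ (g - r) * of_nat (n choose r)) * th ^ g"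
    by (simp only: ext_const_sum ext_const_of_nat ext_const_simps(6) sum_distrib_right mult.assoc)
  finally have "(ext_const x * th - w) ^ g = ext_const (x ^ (g - n) * (x - 1) ^ n) * th ^ g"
    unfolding signed_binomial[OF n] .
  moreover have p: "(\<Prod>k<g. complex_of_real (t k) - x) = 0" unfolding x_def using k by (auto simp: prod_zero_iff)
  have "(ext_const x * th - w) ^ g
      = ext_const (fact g * (\<Prod>k<g. complex_of_real (t k) - x)) * prod_list (map Ek [0..<g])"
    unfolding w_def by (rule mixed_power_diagonal) (rule mu)
  then have "(ext_const x * th - w) ^ g = 0" by (simp only: p mult_zero_right ext_const_simps mult_zero_left)
  ultimately have "x ^ (g - n) * (x - 1) ^ n = 0" using ext_const_cancel th_power_nonzero by metis
  then show ?thesis unfolding x_def by (auto simp: complex_eq_iff)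
qed

text \<open>The diagonal formula holds for every x, and the equations follow by comparing
  coefficients in x; n is the number of eigenvalues equal to 1, that is, the rank.\<close>

lemma idempotent_admissible:
  assumes mu: "\<And>x y. x \<in> pspace A \<Longrightarrow> y \<in> pspace A \<Longrightarrow> \<mu> x y = pform A (f x) y"
    and rat: "\<And>x y. x \<in> plat A \<Longrightarrow> y \<in> plat A \<Longrightarrow> \<mu> x y \<in> \<rat>"
    and t01: "\<And>k. k < g \<Longrightarrow> t k = 0 \<or> t k = 1" and n: "n = card {k\<in>{..<g}. t k = 1}"
  shows "admissible ds Z n (gamma bs \<mu>)"
proof -
  define w where "w = - bform \<mu>"
  have com: "th * w = w * th" unfolding th_def w_def using bform_commute by simp
  have "\<forall>i j. \<exists>q. i < 2 * g \<longrightarrow> j < 2 * g \<longrightarrow> - \<mu> (bs ! i) (bs ! j) = of_rat q"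
    using rat bs_L by (metis Rats_cases of_rat_minus)
  then obtain q where q: "\<And>i j. i < 2 * g \<Longrightarrow> j < 2 * g \<Longrightarrow> - \<mu> (bs ! i) (bs ! j) = of_rat (q i j)" by metis
  have "w = ext_two_form (2 * g) (\<lambda>i j. - complex_of_real (\<mu> (bs ! i) (bs ! j)))"
    unfolding w_def bform_def by (rule ext_two_form_linear(3)[symmetric])
  also have "\<dots> = ext_two_form (2 * g) (\<lambda>i j. of_rat (q i j))"
    unfolding ext_two_form_def
  proof (intro sum.cong refl arg_cong[of _ _ "\<lambda>c. ext_const c * _"])
    fix i j assume "i \<in> {..<2 * g}" "j \<in> {i<..<2 * g}"
    then have "- \<mu> (bs ! i) (bs ! j) = of_rat (q i j)" using q by simp
    then have "complex_of_real (- \<mu> (bs ! i) (bs ! j)) = of_rat (q i j)" by (simp only: of_rat_complex)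
    then show "- complex_of_real (\<mu> (bs ! i) (bs ! j)) = of_rat (q i j)" by simp
  qed
  finally have r: "coeff_of w \<in> rational_two_forms (2 * g)"
    unfolding rational_two_forms_def coeff_of_two_form[symmetric] by blast
  have "w * Dz = - (\<Sum>k<g. ext_const (t k) * (Ek k * Dz))"
  proof -
    have "bform \<mu> = (\<Sum>k<g. ext_const (t k) * Ek k)" by (rule bform_diagonal) (rule mu)
    then show ?thesis unfolding w_def by (simp add: sum_distrib_right mult.assoc)
  qed
  also have "\<dots> = 0" using Ek_Dz by simp
  finally have wD: "w * Dz = 0" .
  have ng: "n \<le> g" unfolding n using card_mono[of "{..<g}" "{k\<in>{..<g}. t k = 1}"] by auto
  \<comment> \<open>An eigenvalue 1 contributes 1 - x and an eigenvalue 0 contributes -x; the signs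
    combine to (-1)^g.\<close>
  have prod: "(\<Prod>k<g. complex_of_real (t k) - x) = (-1) ^ g * (x ^ (g - n) * (x - 1) ^ n)" for x
  proof -
    have s: "{..<g} = {k\<in>{..<g}. t k = 1} \<union> {k\<in>{..<g}. t k \<noteq> 1}" by auto
    have c2: "card {k\<in>{..<g}. t k \<noteq> 1} = g - n"
    proof -
      have "{k\<in>{..<g}. t k \<noteq> 1} = {..<g} - {k\<in>{..<g}. t k = 1}" by auto
      moreover have "card ({..<g} - {k\<in>{..<g}. t k = 1}) = card {..<g} - card {k\<in>{..<g}. t k = 1}"
        by (rule card_Diff_subset) auto
      ultimately show ?thesis by (simp add: n)
    qed
    have "(\<Prod>k<g. complex_of_real (t k) - x)
       = (\<Prod>k\<in>{k\<in>{..<g}. t k = 1}. complex_of_real (t k) - x) * (\<Prod>k\<in>{k\<in>{..<g}. t k \<noteq> 1}. complex_of_real (t k) - x)"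
      by (subst s, rule prod.union_disjoint) auto
    also have "(\<Prod>k\<in>{k\<in>{..<g}. t k = 1}. complex_of_real (t k) - x) = (\<Prod>k\<in>{k\<in>{..<g}. t k = 1}. 1 - x)"
      by (rule prod.cong) auto
    also have "(\<Prod>k\<in>{k\<in>{..<g}. t k \<noteq> 1}. complex_of_real (t k) - x) = (\<Prod>k\<in>{k\<in>{..<g}. t k \<noteq> 1}. - x)"
      by (rule prod.cong) (use t01 in auto)
    also have "(\<Prod>k\<in>{k\<in>{..<g}. t k = 1}. 1 - x) * (\<Prod>k\<in>{k\<in>{..<g}. t k \<noteq> 1}. - x) = (1 - x) ^ n * (- x) ^ (g - n)"
      by (simp only: prod_constant c2 n[symmetric])
    also have "\<dots> = ((-1) ^ n * (x - 1) ^ n) * ((-1) ^ (g - n) * x ^ (g - n))"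
      by (simp add: power_mult_distrib[symmetric])
    also have "\<dots> = ((-1) ^ n * (-1) ^ (g - n)) * (x ^ (g - n) * (x - 1) ^ n)" by simp
    also have "(-1) ^ n * (-1) ^ (g - n) = ((-1) ^ g :: complex)" using ng by (simp flip: power_add)
    finally show ?thesis .
  qed
  have key: "(\<Sum>r\<le>g. ext_const ((-1) ^ r * x ^ (g - r)) * (of_nat (g choose r) * (w ^ r * th ^ (g - r))))
      = (\<Sum>r\<le>g. ext_const ((-1) ^ r * x ^ (g - r)) * (of_nat (n choose r) * th ^ g))" for x
  proof -
    have "(\<Sum>r\<le>g. ext_const ((-1) ^ r * x ^ (g - r)) * (of_nat (g choose r) * (w ^ r * th ^ (g - r))))
      = (ext_const x * th - w) ^ g" by (rule mixed_powers_expand[OF com, symmetric])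
    also have "\<dots> = ext_const (fact g * ((-1) ^ g * (x ^ (g - n) * (x - 1) ^ n))) * prod_list (map Ek [0..<g])"
      unfolding w_def prod[symmetric] by (rule mixed_power_diagonal) (rule mu)
    \<comment> \<open>The sign (-1)^g is absorbed, as \<open>th_power_diagonal\<close> carries the
      same one.\<close>
    also have "\<dots> = ext_const (x ^ (g - n) * (x - 1) ^ n) * th ^ g"
      unfolding th_power_diagonal by (simp only: mult.assoc[symmetric] ext_const_simps(6)[symmetric]) (simp only: ac_simps)
    also have "\<dots> = (\<Sum>r\<le>g. ext_const ((-1) ^ r * x ^ (g - r)) * (of_nat (n choose r) * th ^ g))"
      unfolding signed_binomial[OF ng, symmetric]
      by (simp only: ext_const_sum ext_const_of_nat ext_const_simps(6) sum_distrib_right mult.assoc)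
    finally show ?thesis .
  qed
  have "of_nat (g choose r) * (w ^ r * th ^ (g - r)) = of_nat (n choose r) * th ^ g" if "r \<le> g" for r
    using coefficients_eqI[of g "\<lambda>r. of_nat (g choose r) * (w ^ r * th ^ (g - r))" "\<lambda>r. of_nat (n choose r) * th ^ g" r] key that
    by blast
  then have "admissible ds Z n (coeff_of w)" unfolding admissible_iff using r wD by simp
  then show ?thesis by (simp add: gamma_bform w_def)
qed

end

section \<open>Rational two-forms of type (1,1)\<close>

context period_pav
begin

text \<open>The coefficients at {i, j} with i < j give the values on pairs of basis vectors, and
  bilinearity gives the rest. Off the space of A all members of \<open>NS_rat\<close> are 0 by
  convention, so they agree as functions.\<close>

lemma gamma_inj: "inj_on (gamma bs) (NS_rat A)"
proof (rule inj_onI)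
  fix \<mu> \<nu> assume mu: "\<mu> \<in> NS_rat A" and nu: "\<nu> \<in> NS_rat A" and eq: "gamma bs \<mu> = gamma bs \<nu>"
  define D where "D = (\<lambda>x y. \<mu> x y - \<nu> x y)"
  have "alternating_form_on (pspace A) D"
    using mu nu unfolding NS_rat_def alternating_form_on_def D_def by (auto simp: algebra_simps)
  then interpret D: alternating_form "pspace A" D by unfold_locales (rule subV)
  have Dij: "D (bs ! i) (bs ! j) = 0" if ij: "i < j" "j < 2 * g" for i j
  proof -
    have "gamma bs \<mu> {i, j} = gamma bs \<nu> {i, j}" using eq by simp
    then have "complex_of_real (\<mu> (bs ! i) (bs ! j)) = complex_of_real (\<nu> (bs ! i) (bs ! j))"
      unfolding gamma_def length_bs_g by (simp add: two_form_coeff[OF ij])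
    then show ?thesis by (simp add: D_def)
  qed
  have Dbb: "D b c = 0" if b: "b \<in> set bs" and c: "c \<in> set bs" for b c
  proof -
    obtain i j where i: "i < 2 * g" "b = bs ! i" and j: "j < 2 * g" "c = bs ! j"
      using b c by (auto simp: in_set_conv_nth length_bs_g)
    consider "i < j" | "i = j" | "j < i" by linarith
    then show ?thesis
    proof cases
      case 3 then show ?thesis using Dij[of j i] D.F_skew[of b c] i j bs_V by simp
    qed (use Dij i j D.F_self bs_V in auto)
  qed
  have sp: "set bs \<subseteq> pspace A" "span (set bs) = pspace A"
    using lattice_basis_span[OF basis] real_vector.span_superset[of "set bs"] by auto
  have "D b x = 0" if "b \<in> set bs" "x \<in> pspace A" for b x
    using D.F_span_zero[OF sp(1), of b x] Dbb that sp by auto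
  then have "D x b = 0" if "b \<in> set bs" "x \<in> pspace A" for b x
    using D.F_skew[of x b] that sp by auto
  then have "D x y = 0" if "x \<in> pspace A" "y \<in> pspace A" for x y
    using D.F_span_zero[OF sp(1), of x y] that sp by auto
  moreover have "\<mu> x y = 0 \<and> \<nu> x y = 0" if "x \<notin> pspace A \<or> y \<notin> pspace A" for x y
    using mu nu that unfolding NS_rat_def by blast
  ultimately show "\<mu> = \<nu>" unfolding D_def by (intro ext) (metis eq_iff_diff_eq_0)
qed

lemma form_of_gamma: "\<mu> \<in> NS_rat A \<Longrightarrow> form_of A bs (gamma bs \<mu>) = \<mu>"
  unfolding form_of_def by (rule inv_into_f_f[OF gamma_inj])

text \<open>The left block of \<open>PM\<close> is diagonal, so among the dx_i with i < g only dx_j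
  occurs in dz_j, and the coefficient is up to sign the product of the d_j. The induction prepends
  the factors from the last one downwards.\<close>

lemma Dz_leading: "coeff_of Dz {0..<g} \<noteq> 0"
proof -
  have "coeff_of (prod_list (map dzf [g - m..<g])) {g - m..<g} \<noteq> 0" if "m \<le> g" for m
    using that
  proof (induction m)
    case 0 then show ?case by (simp add: ext_one_def)
  next
    case (Suc m)
    let ?j = "g - Suc m"
    have j: "?j < g" "Suc ?j = g - m" using Suc.prems by auto
    have u: "[?j..<g] = ?j # [g - m..<g]" using j upt_rec[of ?j g] by simp
    have K: "{?j..<g} = insert ?j {g - m..<g}" using j by auto
    let ?R = "coeff_of (prod_list (map dzf [g - m..<g]))"
    have dc: "dim_col PM = 2 * g" using PM_carrier by simp
    have dzj: "dz PM ?j I = (if \<exists>i<2 * g. I = {i} then PM $$ (?j, the_elem I) else 0)" for I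
    proof (cases "\<exists>i<2 * g. I = {i}")
      case True
      then obtain i where i: "i < 2 * g" "I = {i}" by blast
      have "dz PM ?j I = (\<Sum>k<2 * g. if k = i then PM $$ (?j, i) else 0)"
        unfolding dz_def dx_def dc i(2) by (rule sum.cong) auto
      then show ?thesis using i by auto
    next
      case False
      then have "dz PM ?j I = 0" unfolding dz_def dx_def dc by (intro sum.neutral) auto
      then show ?thesis by (simp only: False if_False)
    qed
    have "coeff_of (prod_list (map dzf [?j..<g])) {?j..<g}
        = (\<Sum>I\<in>Pow {?j..<g}. shuffle_sign I ({?j..<g} - I) * dz PM ?j I * ?R ({?j..<g} - I))"
      unfolding u by (simp add: wedge_def coeff_of_dzf)
    also have "\<dots> = (\<Sum>I\<in>{{?j}}. shuffle_sign I ({?j..<g} - I) * dz PM ?j I * ?R ({?j..<g} - I))"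
    proof (rule sum.mono_neutral_right)
      show "\<forall>I\<in>Pow {?j..<g} - {{?j}}. shuffle_sign I ({?j..<g} - I) * dz PM ?j I * ?R ({?j..<g} - I) = 0"
      proof
        fix I assume I: "I \<in> Pow {?j..<g} - {{?j}}"
        have "dz PM ?j I = 0"
        proof (cases "\<exists>i<2 * g. I = {i}")
          case True
          then obtain i where i: "I = {i}" by blast
          then have "i < g" "i \<noteq> ?j" using I by auto
          then show ?thesis using dzj[of I] True i PM_left[OF j(1), of i] by simp
        next
          case False then show ?thesis by (simp only: dzj if_False)
        qed
        then show "shuffle_sign I ({?j..<g} - I) * dz PM ?j I * ?R ({?j..<g} - I) = 0" by simp
      qed
    qed (use j in auto)
    also have "\<dots> = shuffle_sign {?j} ({?j..<g} - {?j}) * dz PM ?j {?j} * ?R ({?j..<g} - {?j})" by simp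
    also have "{?j..<g} - {?j} = {g - m..<g}" using j by auto
    finally have e: "coeff_of (prod_list (map dzf [?j..<g])) {?j..<g}
      = shuffle_sign {?j} {g - m..<g} * dz PM ?j {?j} * ?R {g - m..<g}" .
    have "dz PM ?j {?j} = of_nat (ds ! ?j)" using dzj[of "{?j}"] j PM_left[OF j(1), of ?j] by auto
    moreover have "ds ! ?j > 0" using ds_pos[folded g_def] j by blast
    moreover have "shuffle_sign {?j} {g - m..<g} \<noteq> 0" by (simp add: shuffle_sign_def)
    ultimately show ?case using e Suc by simp
  qed
  from this[of g] show ?thesis by (simp add: Dz_def)
qed

text \<open>A two-form in the \<open>dx\<^sub>m\<close> with \<open>m \<ge> g\<close> is determined by its product with \<open>Dz\<close>, since only one
  term contributes to the coefficient at \<open>{0..<g} \<union> {m, p}\<close>.\<close>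

lemma antiholomorphic_part_zero:
  assumes supp: "\<And>i j. i < j \<Longrightarrow> j < 2 * g \<Longrightarrow> i < g \<Longrightarrow> \<kappa> i j = 0"
    and 0: "ext_two_form (2 * g) \<kappa> * Dz = 0"
    and mp: "g \<le> m" "m < p" "p < 2 * g"
  shows "\<kappa> m p = 0"
proof -
  let ?K = "{0..<g} \<union> {m, p}"
  have tf: "two_form (2 * g) \<kappa> I = 0" if I: "I \<subseteq> ?K" "I \<noteq> {m, p}" for I
    unfolding two_form_def
  proof (intro sum.neutral ballI)
    fix i j assume ij: "i \<in> {..<2 * g}" "j \<in> {i<..<2 * g}"
    show "\<kappa> i j * wedge (dx i) (dx j) I = 0"
    proof (cases "i < g")
      case True then show ?thesis using supp[of i j] ij by simp
    next
      case False
      have "I \<noteq> {i, j}"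
      proof
        assume "I = {i, j}"
        then have "i \<in> {m, p}" "j \<in> {m, p}" "i < j" using I(1) False ij by auto
        then have "{i, j} = {m, p}" using mp by auto
        then show False using I \<open>I = {i, j}\<close> by simp
      qed
      then show ?thesis using wedge_dx_dx[of i j] ij by simp
    qed
  qed
  have "0 = coeff_of (ext_two_form (2 * g) \<kappa> * Dz) ?K" unfolding 0 by simp
  also have "\<dots> = (\<Sum>I\<in>Pow ?K. shuffle_sign I (?K - I) * two_form (2 * g) \<kappa> I * coeff_of Dz (?K - I))"
    by (simp add: wedge_def coeff_of_two_form)
  also have "\<dots> = (\<Sum>I\<in>{{m, p}}. shuffle_sign I (?K - I) * two_form (2 * g) \<kappa> I * coeff_of Dz (?K - I))"
    by (rule sum.mono_neutral_right) (use tf in auto)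
  also have "\<dots> = shuffle_sign {m, p} (?K - {m, p}) * two_form (2 * g) \<kappa> {m, p} * coeff_of Dz (?K - {m, p})" by simp
  also have "?K - {m, p} = {0..<g}" using mp by auto
  also have "two_form (2 * g) \<kappa> {m, p} = \<kappa> m p" by (rule two_form_coeff) (use mp in auto)
  finally show ?thesis using Dz_leading by (auto simp: shuffle_sign_def)
qed

text \<open>The vectors \<open>u\<close> below are the coordinates of the vectors of type (0,1); modulo the \<open>dz\<^sub>j\<close> each
  \<open>dx\<^sub>i\<close> is the combination with coefficients \<open>y i\<close> of the \<open>dx\<^sub>m\<close> with \<open>m \<ge> g\<close>.\<close>

lemma annihilates_antiholomorphic:
  fixes \<alpha> :: "nat \<Rightarrow> nat \<Rightarrow> complex"
  assumes skew: "\<And>i j. \<alpha> i j = - \<alpha> j i"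
    and 0: "ext_two_form (2 * g) \<alpha> * Dz = 0"
    and u: "\<And>j. j < g \<Longrightarrow> (\<Sum>i<2 * g. PM $$ (j, i) * u i) = 0"
    and v: "\<And>j. j < g \<Longrightarrow> (\<Sum>i<2 * g. PM $$ (j, i) * v i) = 0"
  shows "(\<Sum>i<2 * g. \<Sum>j<2 * g. \<alpha> i j * u i * v j) = 0"
proof -
  let ?N = "2 * g"
  \<comment> \<open>For i < g this solves dz_i = d_i dx_i + \<Sum> PM_im dx_m = 0, summed over m
    \<ge> g, for dx_i; for i \<ge> g it is dx_i itself.\<close>
  define y where "y i m = (if m < g then 0 else if i < g then - PM $$ (i, m) / of_nat (ds ! i)
      else if i = m then 1 else 0)" for i m
  have split: "(\<Sum>i<?N. h i) = (\<Sum>i<g. h i) + (\<Sum>i\<in>{g..<?N}. h i)" for h :: "nat \<Rightarrow> complex"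
  proof -
    have s: "{..<?N} = {..<g} \<union> {g..<?N}" by auto
    show ?thesis unfolding s by (rule sum.union_disjoint) auto
  qed
  have dpos: "of_nat (ds ! j) \<noteq> (0::complex)" if "j < g" for j using ds_pos[folded g_def] that by auto
  have PMu: "(\<Sum>i<?N. PM $$ (j, i) * u i) = of_nat (ds ! j) * u j + (\<Sum>i\<in>{g..<?N}. PM $$ (j, i) * u i)"
    if "j < g" for j and u :: "nat \<Rightarrow> complex"
  proof -
    have "(\<Sum>i<g. PM $$ (j, i) * u i) = (\<Sum>i<g. if i = j then of_nat (ds ! j) * u j else 0)"
      by (rule sum.cong) (use PM_left[OF that] in auto)
    then show ?thesis unfolding split using that by simp
  qed
  have ysum: "u i = (\<Sum>m<?N. y i m * u m)"
    if u: "\<And>j. j < g \<Longrightarrow> (\<Sum>i<?N. PM $$ (j, i) * u i) = 0" and i: "i < ?N" for u :: "nat \<Rightarrow> complex" and i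
  proof (cases "i < g")
    case True
    have "(\<Sum>m<?N. y i m * u m) = (\<Sum>m\<in>{g..<?N}. - (PM $$ (i, m) * u m) / of_nat (ds ! i))"
      unfolding split using True by (simp add: y_def)
    also have "\<dots> = - (\<Sum>m\<in>{g..<?N}. PM $$ (i, m) * u m) / of_nat (ds ! i)"
      by (simp add: sum_divide_distrib sum_negf)
    also have "(\<Sum>m\<in>{g..<?N}. PM $$ (i, m) * u m) = - (of_nat (ds ! i) * u i)"
      using u[OF True] PMu[OF True, of u] by (simp add: eq_neg_iff_add_eq_0 add.commute)
    finally show ?thesis using dpos[OF True] by simp
  next
    case False
    have "(\<Sum>m<?N. y i m * u m) = (\<Sum>m<?N. if m = i then u i else 0)"
      by (rule sum.cong) (use False in \<open>auto simp: y_def\<close>)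
    then show ?thesis using i by simp
  qed
  define Y where "Y i = one_form ?N (y i)" for i
  have dxY: "ext_dx i * Dz = Y i * Dz" if i: "i < ?N" for i
  proof (cases "i < g")
    case True
    have "one_form ?N (y i) = one_form ?N (\<lambda>m. (if m = i then 1 else 0) + (- 1 / of_nat (ds ! i)) * PM $$ (i, m))"
      unfolding one_form_def
      by (intro sum.cong refl arg_cong[of _ _ "\<lambda>c. ext_const c * _"])
        (use True PM_left[OF True] dpos[OF True] in \<open>auto simp: y_def\<close>)
    also have "\<dots> = ext_dx i + ext_const (- 1 / of_nat (ds ! i)) * dzf i"
      unfolding one_form_linear dzf_def ext_dx_one_form[OF i] ..
    finally show ?thesis using dzf_Dz[OF True] by (simp add: Y_def distrib_right mult.assoc)
  next
    case False
    have "one_form ?N (y i) = one_form ?N (\<lambda>m. if m = i then 1 else 0)"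
      by (rule arg_cong[of _ _ "one_form _"]) (use False in \<open>auto simp: y_def\<close>)
    then show ?thesis unfolding Y_def using ext_dx_one_form[OF i] by simp
  qed
  have dxdx: "ext_dx i * ext_dx j * Dz = Y i * Y j * Dz" if "i < ?N" "j < ?N" for i j
  proof -
    \<comment> \<open>Only the factor next to \<open>Dz\<close> can be replaced, so the two factors
      are exchanged between the replacements.\<close>
    have ac: "ext_dx i * Y j = - (Y j * ext_dx i)"
      unfolding Y_def ext_dx_one_form[OF that(1)] by (rule one_form_anticommute)
    have "ext_dx i * ext_dx j * Dz = (ext_dx i * Y j) * Dz" using dxY[OF that(2)] by (simp add: mult.assoc)
    also have "\<dots> = - (Y j * (Y i * Dz))" unfolding ac using dxY[OF that(1)] by (simp add: mult.assoc)
    also have "\<dots> = - (Y j * Y i) * Dz" by (simp add: mult.assoc)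
    also have "- (Y j * Y i) = Y i * Y j" unfolding Y_def by (rule one_form_anticommute[symmetric])
    finally show ?thesis .
  qed
  \<comment> \<open>B is \<alpha> rewritten in the dx_m with m \<ge> g; the aim is that it
    vanishes.\<close>
  define B where "B m p = (\<Sum>i<?N. \<Sum>j<?N. \<alpha> i j * y i m * y j p)" for m p
  have Bskew: "B m p = - B p m" for m p
  proof -
    have "B m p = (\<Sum>j<?N. \<Sum>i<?N. \<alpha> i j * y i m * y j p)" unfolding B_def by (rule sum.swap)
    also have "\<dots> = (\<Sum>j<?N. \<Sum>i<?N. - (\<alpha> j i * y j p * y i m))"
      by (intro sum.cong refl) (subst skew, simp)
    finally show ?thesis by (simp add: B_def sum_negf)
  qed
  \<comment> \<open>The factor 2 appears because the full double sum meets every pair i < j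
    twice.\<close>
  have "ext_two_form ?N (\<lambda>i j. 2 * \<alpha> i j) = (\<Sum>i<?N. \<Sum>j<?N. ext_const (\<alpha> i j) * (ext_dx i * ext_dx j))"
  proof -
    have "(\<Sum>i<?N. \<Sum>j<?N. ext_const (\<alpha> i j) * (ext_dx i * ext_dx j))
       = (\<Sum>i<?N. \<Sum>j\<in>{i<..<?N}. ext_const (\<alpha> i j) * (ext_dx i * ext_dx j) + ext_const (\<alpha> j i) * (ext_dx j * ext_dx i))"
      by (rule sum_off_diagonal) (simp add: ext_dx_square)
    also have "\<dots> = ext_two_form ?N (\<lambda>i j. 2 * \<alpha> i j)"
      unfolding ext_two_form_def
    proof (intro sum.cong refl)
      fix i j
      have "ext_const (\<alpha> j i) * (ext_dx j * ext_dx i) = ext_const (\<alpha> i j) * (ext_dx i * ext_dx j)"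
        unfolding skew[of j i] ext_dx_anticommute[of j i] ext_const_simps(4) by simp
      moreover have "ext_const (2 * \<alpha> i j) = ext_const (\<alpha> i j) + ext_const (\<alpha> i j)"
        by (simp only: mult_2 ext_const_simps(3))
      ultimately show "ext_const (\<alpha> i j) * (ext_dx i * ext_dx j) + ext_const (\<alpha> j i) * (ext_dx j * ext_dx i)
         = ext_const (2 * \<alpha> i j) * (ext_dx i * ext_dx j)" by (simp add: distrib_right)
    qed
    finally show ?thesis by simp
  qed
  then have "(\<Sum>i<?N. \<Sum>j<?N. ext_const (\<alpha> i j) * (ext_dx i * ext_dx j)) * Dz
      = ext_const 2 * (ext_two_form ?N \<alpha> * Dz)"
    by (simp only: ext_two_form_linear(2)[symmetric] mult.assoc[symmetric])
  then have s0: "(\<Sum>i<?N. \<Sum>j<?N. ext_const (\<alpha> i j) * (ext_dx i * ext_dx j * Dz)) = 0"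
    using 0 by (simp add: sum_distrib_right mult.assoc)
  have "(\<Sum>i<?N. \<Sum>j<?N. ext_const (\<alpha> i j) * (Y i * Y j)) * Dz
      = (\<Sum>i<?N. \<Sum>j<?N. ext_const (\<alpha> i j) * (Y i * Y j * Dz))"
    by (simp only: sum_distrib_right mult.assoc)
  also have "\<dots> = (\<Sum>i<?N. \<Sum>j<?N. ext_const (\<alpha> i j) * (ext_dx i * ext_dx j * Dz))"
    by (intro sum.cong refl) (simp only: dxdx lessThan_iff)
  finally have "(\<Sum>i<?N. \<Sum>j<?N. ext_const (\<alpha> i j) * (Y i * Y j)) * Dz = 0" unfolding s0 .
  moreover have "(\<Sum>i<?N. \<Sum>j<?N. ext_const (\<alpha> i j) * (Y i * Y j)) = ext_two_form ?N (\<lambda>m p. B m p - B p m)"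
  proof -
    have "ext_const (\<alpha> i j) * (Y i * Y j) = ext_two_form ?N (\<lambda>m p. \<alpha> i j * (y i m * y j p - y i p * y j m))" for i j
      unfolding Y_def one_form_mult ext_two_form_linear(2) ..
    then have "(\<Sum>i<?N. \<Sum>j<?N. ext_const (\<alpha> i j) * (Y i * Y j))
       = ext_two_form ?N (\<lambda>m p. \<Sum>i<?N. \<Sum>j<?N. \<alpha> i j * (y i m * y j p - y i p * y j m))"
      unfolding ext_two_form_sum by simp
    also have "(\<lambda>m p. \<Sum>i<?N. \<Sum>j<?N. \<alpha> i j * (y i m * y j p - y i p * y j m)) = (\<lambda>m p. B m p - B p m)"
      unfolding B_def by (intro ext) (simp add: right_diff_distrib sum_subtractf mult.assoc)
    finally show ?thesis .
  qed
  ultimately have 00: "ext_two_form ?N (\<lambda>m p. B m p - B p m) * Dz = 0" by simp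
  have Bsupp: "B m p = 0" if "m < g \<or> p < g" for m p
    unfolding B_def using that by (auto simp: y_def)
  have Bmp: "B m p = 0" if "m < p" "p < ?N" for m p
  proof (cases "g \<le> m")
    case True
    have "B m p - B p m = 0"
      by (rule antiholomorphic_part_zero[of "\<lambda>m p. B m p - B p m", OF _ 00 True that]) (simp add: Bsupp)
    then show ?thesis using Bskew[of m p] by (simp add: add_eq_0_iff2)
  qed (use Bsupp in auto)
  have B0: "B m p = 0" if "m < ?N" "p < ?N" for m p
  proof -
    consider "m < p" | "m = p" | "p < m" by linarith
    then show ?thesis
    proof cases
      case 2 then show ?thesis using Bskew[of m m] by simp
    qed (use Bmp Bskew[of m p] that in auto)
  qed
  \<comment> \<open>Vectors annihilated by all dz_j are determined by their coordinates with index m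
    \<ge> g, and on these \<alpha> acts as B.\<close>
  have "(\<Sum>i<?N. \<Sum>j<?N. \<alpha> i j * u i * v j)
     = (\<Sum>i<?N. \<Sum>j<?N. \<alpha> i j * (\<Sum>m<?N. y i m * u m) * (\<Sum>p<?N. y j p * v p))"
    by (intro sum.cong refl) (use ysum[of u] ysum[of v] u v in auto)
  also have "\<dots> = (\<Sum>i<?N. \<Sum>j<?N. \<Sum>m<?N. \<Sum>p<?N. u m * v p * (\<alpha> i j * y i m * y j p))"
    by (simp add: sum_distrib_left sum_distrib_right mult_ac)
  also have "\<dots> = (\<Sum>i<?N. \<Sum>m<?N. \<Sum>j<?N. \<Sum>p<?N. u m * v p * (\<alpha> i j * y i m * y j p))"
    by (rule sum.cong[OF refl], rule sum.swap)
  also have "\<dots> = (\<Sum>m<?N. \<Sum>i<?N. \<Sum>j<?N. \<Sum>p<?N. u m * v p * (\<alpha> i j * y i m * y j p))"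
    by (rule sum.swap)
  also have "\<dots> = (\<Sum>m<?N. \<Sum>i<?N. \<Sum>p<?N. \<Sum>j<?N. u m * v p * (\<alpha> i j * y i m * y j p))"
    by (rule sum.cong[OF refl], rule sum.cong[OF refl], rule sum.swap)
  also have "\<dots> = (\<Sum>m<?N. \<Sum>p<?N. \<Sum>i<?N. \<Sum>j<?N. u m * v p * (\<alpha> i j * y i m * y j p))"
    by (rule sum.cong[OF refl], rule sum.swap)
  also have "\<dots> = (\<Sum>m<?N. \<Sum>p<?N. u m * v p * B m p)"
    by (simp only: B_def sum_distrib_left)
  also have "\<dots> = 0" using B0 by simp
  finally show ?thesis .
qed

definition xi :: "nat \<Rightarrow> 'v \<Rightarrow> real" where
  "xi i x = representation (set bs) x (bs ! i)"

lemma xi_linear: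
  assumes "x \<in> pspace A" "y \<in> pspace A"
  shows "xi i (x + y) = xi i x + xi i y" "xi i (r *\<^sub>R x) = r * xi i x"
  using assms basis lattice_basis_span[OF basis]
  unfolding xi_def is_lattice_basis_iff zbasis_def
  by (simp_all add: real_vector.representation_add real_vector.representation_scale)

lemma xi_integral: "x \<in> plat A \<Longrightarrow> i < 2 * g \<Longrightarrow> xi i x \<in> \<int>"
  using basis length_bs_g nth_mem[of i bs] unfolding xi_def is_lattice_basis_iff zbasis_def by auto

lemma xi_basis: "i < 2 * g \<Longrightarrow> j < 2 * g \<Longrightarrow> xi i (bs ! j) = (if i = j then 1 else 0)"
  using basis length_bs_g nth_mem[of j bs] nth_eq_iff_index_eq[of bs i j]
  unfolding xi_def is_lattice_basis_iff zbasis_def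
  by (auto simp: real_vector.representation_basis)

lemma xi_expand: "x \<in> pspace A \<Longrightarrow> x = (\<Sum>i<2 * g. xi i x *\<^sub>R bs ! i)"
proof -
  assume x: "x \<in> pspace A"
  have d: "distinct bs" and ind: "independent (set bs)" using basis by (auto simp: is_lattice_basis_def)
  have "x = (\<Sum>b\<in>set bs. representation (set bs) x b *\<^sub>R b)"
    using sum_representation[OF finite_set ind, of x] x lattice_basis_span[OF basis] by simp
  also have "\<dots> = (\<Sum>i<2 * g. xi i x *\<^sub>R bs ! i)"
    unfolding xi_def using sum.reindex_bij_betw[OF bij_betw_nth[OF d refl refl], of "\<lambda>b. representation (set bs) x b *\<^sub>R b"]
    by (simp add: length_bs_g)
  finally show ?thesis .
qed

text \<open>The vector \<open>x \<otimes> 1 + \<i>x \<otimes> \<i>\<close> is of type (0,1).\<close>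

lemma xi_antiholomorphic:
  assumes x: "x \<in> pspace A" and j: "j < g"
  shows "(\<Sum>i<2 * g. PM $$ (j, i) * Complex (xi i x) (xi i (\<i> *\<^sub>C x))) = 0"
proof -
  define s where "s x j = (\<Sum>i<2 * g. PM $$ (j, i) * complex_of_real (xi i x))" for x j
  have s: "x = (\<Sum>j<length nb. s x j *\<^sub>C nb ! j)" if x: "x \<in> pspace A" for x
  proof -
    have "x = (\<Sum>i<2 * g. complex_of_real (xi i x) *\<^sub>C (\<Sum>j<g. PM $$ (j, i) *\<^sub>C nb ! j))"
      using xi_expand[OF x] by (simp add: bs_PM scaleR_scaleC)
    also have "\<dots> = (\<Sum>i<2 * g. \<Sum>j<g. (PM $$ (j, i) * complex_of_real (xi i x)) *\<^sub>C nb ! j)"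
      by (simp add: complex_vector.scale_sum_right scaleC_scaleC mult.commute)
    also have "\<dots> = (\<Sum>j<g. s x j *\<^sub>C nb ! j)"
      by (subst sum.swap) (simp add: s_def complex_vector.scale_sum_left)
    finally show ?thesis by (simp add: length_nb)
  qed
  have "(\<Sum>j<length nb. s (\<i> *\<^sub>C x) j *\<^sub>C nb ! j) = (\<Sum>j<length nb. (\<i> * s x j) *\<^sub>C nb ! j)"
  proof -
    have "(\<Sum>j<length nb. (\<i> * s x j) *\<^sub>C nb ! j) = \<i> *\<^sub>C (\<Sum>j<length nb. s x j *\<^sub>C nb ! j)"
      by (simp add: complex_vector.scale_sum_right scaleC_scaleC)
    then show ?thesis using s[OF x] s[OF V_scaleC[OF x, of \<i>]] by simp
  qed
  then have "s (\<i> *\<^sub>C x) j = \<i> * s x j"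
    using is_cbasis_unique[OF normal_basis_is_cbasis, of "s (\<i> *\<^sub>C x)" "\<lambda>j. \<i> * s x j" j] j by (simp add: length_nb)
  moreover have "(\<Sum>i<2 * g. PM $$ (j, i) * Complex (xi i x) (xi i (\<i> *\<^sub>C x))) = s x j + \<i> * s (\<i> *\<^sub>C x) j"
    unfolding s_def sum_distrib_left sum.distrib[symmetric]
    by (intro sum.cong refl) (simp add: Complex_eq algebra_simps)
  ultimately show ?thesis by simp
qed

text \<open>The coefficients of w define a form that is rational on L by construction. Its
  invariance under i comes from w Dz = 0, which makes the complex bilinear extension vanish on pairs
  of vectors of type (0,1).\<close>

lemma gamma_surjective:
  assumes w: "coeff_of w \<in> rational_two_forms (2 * g)" and 0: "w * Dz = 0"
  shows "\<exists>\<mu>\<in>NS_rat A. gamma bs \<mu> = coeff_of w"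
proof -
  let ?N = "2 * g"
  obtain a :: "nat \<Rightarrow> nat \<Rightarrow> rat" where a: "coeff_of w = two_form ?N (\<lambda>i j. of_rat (a i j))"
    using w by (auto simp: rational_two_forms_def)
  \<comment> \<open>A \<open>two_form\<close> only sees the coefficients with i < j; they are
    extended to a skew matrix.\<close>
  define \<alpha> :: "nat \<Rightarrow> nat \<Rightarrow> real" where
    "\<alpha> i j = (if i < j then of_rat (a i j) else if j < i then - of_rat (a j i) else 0)" for i j
  have skew: "\<alpha> i j = - \<alpha> j i" for i j by (auto simp: \<alpha>_def)
  have w': "w = ext_two_form ?N (\<lambda>i j. complex_of_real (\<alpha> i j))"
  proof -
    have "coeff_of w = coeff_of (ext_two_form ?N (\<lambda>i j. complex_of_real (\<alpha> i j)))"
      unfolding a coeff_of_two_form two_form_def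
      by (intro ext sum.cong refl) (auto simp: \<alpha>_def of_rat_complex)
    then show ?thesis by (simp add: coeff_of_inject)
  qed
  define \<beta> where "\<beta> x y = (\<Sum>i<?N. \<Sum>j<?N. \<alpha> i j * xi i x * xi j y)" for x y
  \<comment> \<open>The sign compensates the one in \<open>gamma\<close>, and the value 0 off the
    space is the convention of \<open>NS_rat\<close>.\<close>
  define \<mu> where "\<mu> x y = (if x \<in> pspace A \<and> y \<in> pspace A then - \<beta> x y else 0)" for x y
  have \<beta>_add: "\<beta> (x + y) z = \<beta> x z + \<beta> y z" "\<beta> z (x + y) = \<beta> z x + \<beta> z y"
    if "x \<in> pspace A" "y \<in> pspace A" for x y z
    unfolding \<beta>_def xi_linear(1)[OF that] sum.distrib[symmetric] by (simp_all add: algebra_simps)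
  have \<beta>_scale: "\<beta> (r *\<^sub>R x) z = r * \<beta> x z" "\<beta> z (r *\<^sub>R x) = r * \<beta> z x" if "x \<in> pspace A" for r x z
    unfolding \<beta>_def xi_linear(2)[OF that that] sum_distrib_left by (simp_all add: algebra_simps)
  have \<beta>_skew: "\<beta> x y = - \<beta> y x" for x y
  proof -
    have "\<beta> x y = (\<Sum>j<?N. \<Sum>i<?N. \<alpha> i j * xi i x * xi j y)" unfolding \<beta>_def by (rule sum.swap)
    also have "\<dots> = (\<Sum>j<?N. \<Sum>i<?N. - (\<alpha> j i * xi j y * xi i x))"
      by (intro sum.cong refl) (subst skew, simp)
    finally show ?thesis by (simp add: \<beta>_def sum_negf)
  qed
  have \<beta>_self: "\<beta> x x = 0" for x using \<beta>_skew[of x x] by simp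
  have alt\<mu>: "alternating_form_on (pspace A) \<mu>"
    unfolding alternating_form_on_def \<mu>_def by (auto simp: V_closed \<beta>_add \<beta>_scale \<beta>_self)
  have \<alpha>_rat: "\<alpha> i j \<in> \<rat>" for i j by (auto simp: \<alpha>_def)
  have rat: "\<mu> x y \<in> \<rat>" if "x \<in> plat A" "y \<in> plat A" for x y
  proof -
    have "xi i x \<in> \<rat>" "xi i y \<in> \<rat>" if "i < ?N" for i
      using xi_integral that \<open>x \<in> plat A\<close> \<open>y \<in> plat A\<close> Ints_subset_Rats by blast+
    then have "\<beta> x y \<in> \<rat>" unfolding \<beta>_def using \<alpha>_rat by (intro Rats_sum Rats_mult) auto
    then show ?thesis unfolding \<mu>_def by auto
  qed
  have inv: "\<mu> (\<i> *\<^sub>C x) (\<i> *\<^sub>C y) = \<mu> x y" if x: "x \<in> pspace A" and y: "y \<in> pspace A" for x y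
  proof -
    let ?u = "\<lambda>i. Complex (xi i x) (xi i (\<i> *\<^sub>C x))" and ?v = "\<lambda>i. Complex (xi i y) (xi i (\<i> *\<^sub>C y))"
    have "(\<Sum>i<?N. \<Sum>j<?N. complex_of_real (\<alpha> i j) * ?u i * ?v j) = 0"
    proof (rule annihilates_antiholomorphic)
      show "complex_of_real (\<alpha> i j) = - complex_of_real (\<alpha> j i)" for i j using skew[of i j] by simp
      show "ext_two_form ?N (\<lambda>i j. complex_of_real (\<alpha> i j)) * Dz = 0" using 0 w' by simp
    qed (use xi_antiholomorphic x y in auto)
    \<comment> \<open>The real part of u_i v_j is the product of the coordinates of x and y minus
      that of the coordinates of i x and i y.\<close>
    then have "Re (\<Sum>i<?N. \<Sum>j<?N. complex_of_real (\<alpha> i j) * ?u i * ?v j) = 0" by simp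
    then have "\<beta> x y - \<beta> (\<i> *\<^sub>C x) (\<i> *\<^sub>C y) = 0"
      unfolding \<beta>_def sum_subtractf[symmetric] by (simp add: algebra_simps)
    then show ?thesis using x y V_scaleC by (simp add: \<mu>_def)
  qed
  have NS: "\<mu> \<in> NS_rat A" unfolding NS_rat_def using alt\<mu> rat inv by (auto simp: \<mu>_def)
  have \<mu>bs: "\<mu> (bs ! i) (bs ! j) = - \<alpha> i j" if "i < ?N" "j < ?N" for i j
  proof -
    have "\<beta> (bs ! i) (bs ! j) = (\<Sum>k<?N. \<Sum>l<?N. if k = i then if l = j then \<alpha> i j else 0 else 0)"
      unfolding \<beta>_def by (intro sum.cong refl) (use that in \<open>simp add: xi_basis\<close>)
    also have "\<dots> = (\<Sum>k<?N. if k = i then (\<Sum>l<?N. if l = j then \<alpha> i j else 0) else 0)"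
      by (intro sum.cong refl) auto
    also have "\<dots> = \<alpha> i j" using that by simp
    finally show ?thesis using that bs_V by (simp add: \<mu>_def)
  qed
  have "- bform \<mu> = ext_two_form ?N (\<lambda>i j. - complex_of_real (\<mu> (bs ! i) (bs ! j)))"
    unfolding bform_def by (rule ext_two_form_linear(3)[symmetric])
  also have "\<dots> = w"
    unfolding w' ext_two_form_def by (intro sum.cong refl) (auto simp: \<mu>bs)
  finally have wb: "- bform \<mu> = w" .
  show ?thesis by (rule bexI[OF _ NS]) (simp only: gamma_bform wb)
qed

end

section \<open>Sum morphisms of orthogonal subvarieties\<close>

definition coset :: "'v::ab_group_add set \<Rightarrow> 'v \<Rightarrow> 'v set" where
  "coset L v = (\<lambda>l. l + v) ` L"

lemma coset_eq_iff:
  fixes L :: "'v::real_vector set"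
  assumes "add_subgroup L"
  shows "coset L v = coset L w \<longleftrightarrow> v - w \<in> L"
proof
  assume "coset L v = coset L w"
  moreover have "v \<in> coset L v" unfolding coset_def by (rule image_eqI[of _ _ 0]) (use add_subgroup_closed[OF assms] in auto)
  ultimately obtain l where "l \<in> L" "v = l + w" by (auto simp: coset_def)
  then show "v - w \<in> L" by simp
next
  assume vw: "v - w \<in> L"
  have sub: "coset L a \<subseteq> coset L b" if "a - b \<in> L" for a b
  proof
    fix x assume "x \<in> coset L a"
    then obtain l where "l \<in> L" "x = l + a" by (auto simp: coset_def)
    then have "l + (a - b) \<in> L" "x = (l + (a - b)) + b" using add_subgroup_closed(4)[OF assms] that by auto
    then show "x \<in> coset L b" unfolding coset_def by blast
  qed
  have "w - v \<in> L" using add_subgroup_closed(3)[OF assms vw] by simp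
  then show "coset L v = coset L w" using sub vw by blast
qed

lemma coset_zero: "coset L 0 = L"
  by (simp add: coset_def)

lemma torus_group_carrier: "carrier (torus_group B) = coset (plat B) ` pspace B"
  by (auto simp: torus_group_def FactGroup_def RCOSETS_def r_coset_def coset_def)

lemma torus_group_one: "\<one>\<^bsub>torus_group B\<^esub> = plat B"
  by (simp add: torus_group_def FactGroup_def)

lemma torus_group_mult:
  fixes B :: "'v::real_vector pav"
  assumes "add_subgroup (plat B)"
  shows "coset (plat B) v \<otimes>\<^bsub>torus_group B\<^esub> coset (plat B) w = coset (plat B) (v + w)"
proof
  note c = add_subgroup_closed[OF assms]
  have m: "coset (plat B) v \<otimes>\<^bsub>torus_group B\<^esub> coset (plat B) w = {x + y | x y. x \<in> coset (plat B) v \<and> y \<in> coset (plat B) w}"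
    by (auto simp: torus_group_def FactGroup_def set_mult_def)
  show "coset (plat B) v \<otimes>\<^bsub>torus_group B\<^esub> coset (plat B) w \<subseteq> coset (plat B) (v + w)"
  proof
    fix z assume "z \<in> coset (plat B) v \<otimes>\<^bsub>torus_group B\<^esub> coset (plat B) w"
    then obtain l k where lk: "l \<in> plat B" "k \<in> plat B" "z = (l + v) + (k + w)" unfolding m by (auto simp: coset_def)
    then have "z = (l + k) + (v + w)" by (simp add: algebra_simps)
    then show "z \<in> coset (plat B) (v + w)" unfolding coset_def using c(4) lk by blast
  qed
  show "coset (plat B) (v + w) \<subseteq> coset (plat B) v \<otimes>\<^bsub>torus_group B\<^esub> coset (plat B) w"
  proof
    fix z assume "z \<in> coset (plat B) (v + w)"
    then obtain l where l: "l \<in> plat B" "z = l + (v + w)" by (auto simp: coset_def)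
    then have "z = (l + v) + (0 + w)" by (simp add: algebra_simps)
    moreover have "l + v \<in> coset (plat B) v" "0 + w \<in> coset (plat B) w" unfolding coset_def using l c(1) by blast+
    ultimately show "z \<in> coset (plat B) v \<otimes>\<^bsub>torus_group B\<^esub> coset (plat B) w" unfolding m by blast
  qed
qed

text \<open>Replacing representatives changes the sum by a lattice vector, which the summand
  \<open>l\<close> in \<open>sum_morphism\<close> absorbs.\<close>

lemma sum_morphism_coset:
  fixes A :: "'v::real_vector pav"
  assumes A: "add_subgroup (plat A)"
    and Bs: "\<And>i. i < length Bs \<Longrightarrow> plat (Bs ! i) \<subseteq> plat A" "\<And>i. i < length Bs \<Longrightarrow> 0 \<in> plat (Bs ! i)"
    and X: "\<And>i. i < length Bs \<Longrightarrow> X i = coset (plat (Bs ! i)) (v i)"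
  shows "sum_morphism A Bs X = coset (plat A) (\<Sum>i<length Bs. v i)"
proof
  note c = add_subgroup_closed[OF A]
  let ?k = "length Bs"
  show "sum_morphism A Bs X \<subseteq> coset (plat A) (\<Sum>i<?k. v i)"
  proof
    fix z assume "z \<in> sum_morphism A Bs X"
    then obtain x l where x: "\<And>i. i < ?k \<Longrightarrow> x i \<in> X i" and l: "l \<in> plat A" "z = (\<Sum>i<?k. x i) + l"
      by (auto simp: sum_morphism_def)
    have "x i - v i \<in> plat A" if "i < ?k" for i
      using x[OF that] X[OF that] Bs(1)[OF that] by (auto simp: coset_def)
    then have "(\<Sum>i<?k. x i - v i) + l \<in> plat A" using add_subgroup_sum[OF A, of "{..<?k}"] c(4) l(1) by auto
    moreover have "z = ((\<Sum>i<?k. x i - v i) + l) + (\<Sum>i<?k. v i)" using l(2) by (simp add: sum_subtractf)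
    ultimately show "z \<in> coset (plat A) (\<Sum>i<?k. v i)" unfolding coset_def by blast
  qed
  show "coset (plat A) (\<Sum>i<?k. v i) \<subseteq> sum_morphism A Bs X"
  proof
    fix z assume "z \<in> coset (plat A) (\<Sum>i<?k. v i)"
    then obtain l where l: "l \<in> plat A" "z = l + (\<Sum>i<?k. v i)" by (auto simp: coset_def)
    have "v i \<in> X i" if "i < ?k" for i
      unfolding X[OF that] coset_def using Bs(2)[OF that] by (intro image_eqI[of _ _ 0]) auto
    then show "z \<in> sum_morphism A Bs X"
      unfolding sum_morphism_def using l by (auto simp: add.commute)
  qed
qed

text \<open>Surjectivity: the sum of the pieces is a real subspace that contains L. Finite kernel:
  if the sum of the v_i lies in L, multiplying by N and comparing components puts N v_i into the
  lattice L_i of its piece, and (1/N) L_i modulo L_i is finite.\<close>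

lemma (in pav) sum_is_isogenyI:
  assumes sub: "\<And>B. B \<in> set Bs \<Longrightarrow> abelian_subvariety A B"
    and ind: "\<And>x. (\<And>i. i < length Bs \<Longrightarrow> x i \<in> pspace (Bs ! i)) \<Longrightarrow> (\<Sum>i<length Bs. x i) = 0 \<Longrightarrow>
       \<forall>i<length Bs. x i = 0"
    and N: "N > 0" "\<And>l. l \<in> plat A \<Longrightarrow> \<exists>x. (\<forall>i<length Bs. x i \<in> plat (Bs ! i)) \<and> real N *\<^sub>R l = (\<Sum>i<length Bs. x i)"
  shows "sum_is_isogeny A Bs"
proof -
  let ?k = "length Bs" and ?P = "product_torus Bs" and ?h = "sum_morphism A Bs"
  have pB: "pav (Bs ! i)" if "i < ?k" for i by (rule abelian_subvariety_pav[OF pav_axioms sub]) (use that in auto)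
  have B: "pspace (Bs ! i) \<subseteq> pspace A" "plat (Bs ! i) = plat A \<inter> pspace (Bs ! i)" if "i < ?k" for i
    using sub[of "Bs ! i"] that by (auto simp: abelian_subvariety_def)
  have sgB: "add_subgroup (plat (Bs ! i))" if "i < ?k" for i by (rule pav.lattice_subgroup[OF pB[OF that]])
  have sVB: "complex_vector.subspace (pspace (Bs ! i))" if "i < ?k" for i
    using hermitian_form.complex_subspace[of "pspace (Bs ! i)" "pform (Bs ! i)"] pB[OF that]
    by (metis polarized_abelian_variety_def complex_torus_def pav_def)
  have rsc: "r *\<^sub>R x \<in> pspace (Bs ! i)" "x \<in> pspace (Bs ! i) \<Longrightarrow> y \<in> pspace (Bs ! i) \<Longrightarrow> x + y \<in> pspace (Bs ! i) \<and> x - y \<in> pspace (Bs ! i)"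
    if "i < ?k" "x \<in> pspace (Bs ! i)" for r x y i
    using complex_subspace_imp_real[OF sVB[OF that(1)]] that
    by (auto simp: real_vector.subspace_scale real_vector.subspace_add real_vector.subspace_diff)
  have car: "carrier ?P = (\<Pi>\<^sub>E i\<in>{..<?k}. coset (plat (Bs ! i)) ` pspace (Bs ! i))"
    by (simp add: product_torus_def torus_group_carrier)
  have rep: "\<exists>v. \<forall>i<?k. v i \<in> pspace (Bs ! i) \<and> X i = coset (plat (Bs ! i)) (v i)" if "X \<in> carrier ?P" for X
  proof -
    have "\<forall>i. \<exists>v. i < ?k \<longrightarrow> v \<in> pspace (Bs ! i) \<and> X i = coset (plat (Bs ! i)) v"
      using that unfolding car by (auto simp: PiE_iff image_iff Ball_def)
    then show ?thesis by metis
  qed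
  have h: "?h X = coset (plat A) (\<Sum>i<?k. v i)" if "\<And>i. i < ?k \<Longrightarrow> X i = coset (plat (Bs ! i)) (v i)" for X v
  proof (rule sum_morphism_coset[OF lattice_subgroup])
    show "plat (Bs ! i) \<subseteq> plat A" if "i < ?k" for i using B(2)[OF that] by blast
    show "0 \<in> plat (Bs ! i)" if "i < ?k" for i by (rule add_subgroup_closed(1)[OF sgB[OF that]])
  qed (rule that)
  have "?h \<in> hom ?P (torus_group A)"
  proof (rule homI)
    fix X assume "X \<in> carrier ?P"
    then obtain v where v: "\<And>i. i < ?k \<Longrightarrow> v i \<in> pspace (Bs ! i) \<and> X i = coset (plat (Bs ! i)) (v i)" using rep by blast
    have "(\<Sum>i<?k. v i) \<in> pspace A" using v B by (intro V_sum) auto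
    then show "?h X \<in> carrier (torus_group A)" using h[of X v] v by (simp add: torus_group_carrier)
    fix Y assume "Y \<in> carrier ?P"
    then obtain w where w: "\<And>i. i < ?k \<Longrightarrow> w i \<in> pspace (Bs ! i) \<and> Y i = coset (plat (Bs ! i)) (w i)" using rep by blast
    have "?h (X \<otimes>\<^bsub>?P\<^esub> Y) = coset (plat A) (\<Sum>i<?k. v i + w i)"
      by (rule h) (simp add: product_torus_def v w torus_group_mult sgB)
    also have "\<dots> = ?h X \<otimes>\<^bsub>torus_group A\<^esub> ?h Y"
      using h[of X v] h[of Y w] v w by (simp add: torus_group_mult lattice_subgroup sum.distrib)
    finally show "?h (X \<otimes>\<^bsub>?P\<^esub> Y) = ?h X \<otimes>\<^bsub>torus_group A\<^esub> ?h Y" .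
  qed
  moreover have "?h ` carrier ?P = carrier (torus_group A)"
  proof
    show "?h ` carrier ?P \<subseteq> carrier (torus_group A)" using calculation by (auto simp: hom_def)
    let ?S = "{v. \<exists>x. (\<forall>i<?k. x i \<in> pspace (Bs ! i)) \<and> v = (\<Sum>i<?k. x i)}"
    have "subspace ?S"
    proof (rule real_vector.subspaceI)
      show "0 \<in> ?S"
        using complex_vector.subspace_0[OF sVB] by (intro CollectI exI[of _ "\<lambda>_. 0"]) auto
      fix a b assume "a \<in> ?S" "b \<in> ?S"
      then obtain x y where "\<forall>i<?k. x i \<in> pspace (Bs ! i)" "a = (\<Sum>i<?k. x i)" "\<forall>i<?k. y i \<in> pspace (Bs ! i)" "b = (\<Sum>i<?k. y i)"
        by blast
      then show "a + b \<in> ?S" using rsc by (intro CollectI exI[of _ "\<lambda>i. x i + y i"]) (auto simp: sum.distrib)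
    next
      fix c a assume "a \<in> ?S"
      then obtain x where "\<forall>i<?k. x i \<in> pspace (Bs ! i)" "a = (\<Sum>i<?k. x i)" by blast
      then show "c *\<^sub>R a \<in> ?S" using rsc by (intro CollectI exI[of _ "\<lambda>i. c *\<^sub>R x i"]) (auto simp: scaleR_sum_right)
    qed
    moreover have "l \<in> ?S" if l: "l \<in> plat A" for l
    proof -
      obtain x where x: "\<forall>i<?k. x i \<in> plat (Bs ! i)" "real N *\<^sub>R l = (\<Sum>i<?k. x i)" using N(2)[OF l] by blast
      have "l = (1 / real N) *\<^sub>R (real N *\<^sub>R l)" using N(1) by simp
      also have "\<dots> = (\<Sum>i<?k. (1 / real N) *\<^sub>R x i)" unfolding x(2) by (rule scaleR_sum_right)
      finally show ?thesis using x(1) B(2) rsc by (intro CollectI exI[of _ "\<lambda>i. (1 / real N) *\<^sub>R x i"]) auto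
    qed
    ultimately have "span (plat A) \<subseteq> ?S" by (intro real_vector.span_minimal) auto
    moreover obtain C where "zbasis (plat A) C" "span C = pspace A" by (rule obtain_zbasis)
    ultimately have all: "pspace A \<subseteq> ?S" using zbasis_span_eq[of "plat A" C] by simp
    show "carrier (torus_group A) \<subseteq> ?h ` carrier ?P"
    proof
      fix c assume "c \<in> carrier (torus_group A)"
      then obtain v where v: "v \<in> pspace A" "c = coset (plat A) v" by (auto simp: torus_group_carrier)
      then obtain x where x: "\<forall>i<?k. x i \<in> pspace (Bs ! i)" "v = (\<Sum>i<?k. x i)" using all by blast
      let ?X = "\<lambda>i\<in>{..<?k}. coset (plat (Bs ! i)) (x i)"
      have "?h ?X = c" using h[of ?X x] v x by simp
      moreover have "?X \<in> carrier ?P" unfolding car using x by auto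
      ultimately show "c \<in> ?h ` carrier ?P" by blast
    qed
  qed
  moreover have "finite (kernel ?P (torus_group A) ?h)"
  proof -
    have "\<forall>i. \<exists>R. i < ?k \<longrightarrow> finite R \<and> (\<forall>x. real N *\<^sub>R x \<in> plat (Bs ! i) \<longrightarrow> (\<exists>r\<in>R. x - r \<in> plat (Bs ! i)))"
    proof
      fix i
      show "\<exists>R. i < ?k \<longrightarrow> finite R \<and> (\<forall>x. real N *\<^sub>R x \<in> plat (Bs ! i) \<longrightarrow> (\<exists>r\<in>R. x - r \<in> plat (Bs ! i)))"
      proof (cases "i < ?k")
        case True
        obtain C where "zbasis (plat (Bs ! i)) C" by (rule pav.obtain_zbasis[OF pB[OF True]])
        then show ?thesis using zbasis_finite_quotient[OF _ N(1)] by blast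
      qed simp
    qed
    then obtain R where R: "\<And>i. i < ?k \<Longrightarrow> finite (R i)"
      "\<And>i x. i < ?k \<Longrightarrow> real N *\<^sub>R x \<in> plat (Bs ! i) \<Longrightarrow> \<exists>r\<in>R i. x - r \<in> plat (Bs ! i)" by metis
    have "kernel ?P (torus_group A) ?h \<subseteq> (\<Pi>\<^sub>E i\<in>{..<?k}. coset (plat (Bs ! i)) ` R i)"
    proof
      fix X assume X: "X \<in> kernel ?P (torus_group A) ?h"
      then have Xc: "X \<in> carrier ?P" and h1: "?h X = plat A" by (auto simp: kernel_def torus_group_one)
      obtain v where v: "\<And>i. i < ?k \<Longrightarrow> v i \<in> pspace (Bs ! i) \<and> X i = coset (plat (Bs ! i)) (v i)" using rep[OF Xc] by blast
      have "coset (plat A) (\<Sum>i<?k. v i) = coset (plat A) 0" using h[of X v] v h1 by (simp add: coset_zero)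
      then have "(\<Sum>i<?k. v i) \<in> plat A" using coset_eq_iff[OF lattice_subgroup] by simp
      then obtain x where x: "\<forall>i<?k. x i \<in> plat (Bs ! i)" "real N *\<^sub>R (\<Sum>i<?k. v i) = (\<Sum>i<?k. x i)" using N(2) by blast
      have "\<forall>i<?k. real N *\<^sub>R v i - x i = 0"
      proof (rule ind)
        show "(\<Sum>i<?k. real N *\<^sub>R v i - x i) = 0" using x(2) by (simp add: sum_subtractf scaleR_sum_right)
      qed (use v x(1) B(2) rsc in auto)
      then have "real N *\<^sub>R v i \<in> plat (Bs ! i)" if "i < ?k" for i using x(1) that by simp
      then have NL: "real N *\<^sub>R v i \<in> plat (Bs ! i)" if "i < ?k" for i using that by blast
      have "X i \<in> coset (plat (Bs ! i)) ` R i" if i: "i < ?k" for i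
      proof -
        obtain r where r: "r \<in> R i" "v i - r \<in> plat (Bs ! i)" using R(2)[OF i NL[OF i]] by blast
        then have "X i = coset (plat (Bs ! i)) r" using v[OF i] coset_eq_iff[OF sgB[OF i]] by simp
        then show ?thesis using r(1) by blast
      qed
      then show "X \<in> (\<Pi>\<^sub>E i\<in>{..<?k}. coset (plat (Bs ! i)) ` R i)"
        using Xc unfolding car by (auto simp: PiE_iff)
    qed
    moreover have "finite (\<Pi>\<^sub>E i\<in>{..<?k}. coset (plat (Bs ! i)) ` R i)" using R(1) by (intro finite_PiE) auto
    ultimately show ?thesis by (rule finite_subset)
  qed
  ultimately show ?thesis by (simp add: sum_is_isogeny_def isogeny_def)
qed

section \<open>Orthogonal families of subvarieties\<close>

definition orthogonal_spaces :: "'v pav \<Rightarrow> 'v pav \<Rightarrow> 'v pav \<Rightarrow> bool" where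
  "orthogonal_spaces A B C \<longleftrightarrow> (\<forall>x\<in>pspace B. \<forall>y\<in>pspace C. pform A x y = 0)"

text \<open>The pieces are complex, so orthogonality survives multiplication by i: pairing x_j with
  i times the sum leaves only F x_j (i x_j), which is positive unless x_j = 0.\<close>

lemma (in pav) orthogonal_independent:
  assumes sub: "\<And>B. B \<in> set Bs \<Longrightarrow> abelian_subvariety A B"
    and orth: "sorted_wrt (orthogonal_spaces A) Bs"
    and x: "\<And>i. i < length Bs \<Longrightarrow> x i \<in> pspace (Bs ! i)" and 0: "(\<Sum>i<length Bs. x i) = 0"
    and j: "j < length Bs"
  shows "x j = 0"
proof (rule ccontr)
  assume nz: "x j \<noteq> 0"
  have B: "pspace (Bs ! i) \<subseteq> pspace A" "complex_vector.subspace (pspace (Bs ! i))" if "i < length Bs" for i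
    using sub[of "Bs ! i"] that by (auto simp: abelian_subvariety_def complex_torus_def)
  have xV: "x i \<in> pspace A" if "i < length Bs" for i using x B that by blast
  have ix: "\<i> *\<^sub>C x i \<in> pspace (Bs ! i)" if "i < length Bs" for i
    using complex_vector.subspace_scale[OF B(2)[OF that] x[OF that]] .
  have o: "pform A (x j) (\<i> *\<^sub>C x i) = 0" if i: "i < length Bs" "i \<noteq> j" for i
  proof (cases "j < i")
    case True
    then have "orthogonal_spaces A (Bs ! j) (Bs ! i)" using orth i(1) by (simp add: sorted_wrt_iff_nth_less)
    then show ?thesis using x[OF j] ix[OF i(1)] by (simp add: orthogonal_spaces_def)
  next
    case False
    then have "orthogonal_spaces A (Bs ! i) (Bs ! j)" using orth i(2) j by (simp add: sorted_wrt_iff_nth_less)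
    then have "pform A (\<i> *\<^sub>C x i) (x j) = 0" using x[OF j] ix[OF i(1)] by (simp add: orthogonal_spaces_def)
    then show ?thesis using F_skew[OF xV[OF j] V_scaleC[OF xV[OF i(1)]]] by simp
  qed
  have "0 = pform A (x j) (\<i> *\<^sub>C (\<Sum>i<length Bs. x i))" unfolding 0 using xV[OF j] by (simp add: F_zero)
  also have "\<dots> = pform A (x j) (\<Sum>i<length Bs. \<i> *\<^sub>C x i)" by (simp only: complex_vector.scale_sum_right)
  also have "\<dots> = (\<Sum>i<length Bs. pform A (x j) (\<i> *\<^sub>C x i))"
    by (rule F_sum) (use xV j V_scaleC in auto)
  also have "\<dots> = (\<Sum>i<length Bs. if i = j then pform A (x j) (\<i> *\<^sub>C x j) else 0)"
    by (rule sum.cong) (use o in auto)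
  also have "\<dots> = pform A (x j) (\<i> *\<^sub>C x j)" using j by simp
  finally show False using pos[OF xV[OF j] nz] by simp
qed

text \<open>Nonzero vectors chosen from the pieces are independent over the complex numbers. This
  bounds the number of pieces and so the number of splitting steps.\<close>

lemma (in pav) orthogonal_length_le:
  assumes sub: "\<And>B. B \<in> set Bs \<Longrightarrow> abelian_subvariety A B \<and> pspace B \<noteq> {0}"
    and orth: "sorted_wrt (orthogonal_spaces A) Bs"
  shows "length Bs \<le> cdim (pspace A)"
proof -
  let ?k = "length Bs"
  have B: "pspace (Bs ! i) \<subseteq> pspace A" "complex_vector.subspace (pspace (Bs ! i))" if "i < ?k" for i
    using sub[of "Bs ! i"] that by (auto simp: abelian_subvariety_def complex_torus_def)
  have "\<exists>v. i < ?k \<longrightarrow> v \<in> pspace (Bs ! i) \<and> v \<noteq> 0" for i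
    using sub[of "Bs ! i"] complex_vector.subspace_0[OF B(2), of i] by auto
  then obtain v where v: "\<And>i. i < ?k \<Longrightarrow> v i \<in> pspace (Bs ! i) \<and> v i \<noteq> 0" by metis
  have ind: "c j = 0" if "(\<Sum>i<?k. c i *\<^sub>C v i) = 0" "j < ?k" for c j
  proof -
    have "c j *\<^sub>C v j = 0"
      by (rule orthogonal_independent[of Bs "\<lambda>i. c i *\<^sub>C v i"])
        (use sub orth v that complex_vector.subspace_scale[OF B(2)] in auto)
    then show ?thesis using v[OF that(2)] complex_vector.scale_eq_0_iff by blast
  qed
  have inj: "inj_on v {..<?k}"
  proof (rule inj_onI, rule ccontr)
    fix i j assume ij: "i \<in> {..<?k}" "j \<in> {..<?k}" "v i = v j" "i \<noteq> j"
    have "(\<Sum>l<?k. (if l = i then 1 else if l = j then -1 else 0) *\<^sub>C v l)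
        = (\<Sum>l<?k. (if l = i then v i else 0) + (if l = j then - (v i) else 0))"
      by (rule sum.cong) (use ij in \<open>auto simp: scaleC_one\<close>)
    also have "\<dots> = 0" using ij by (simp add: sum.distrib)
    finally show False using ind[of "\<lambda>l. if l = i then 1 else if l = j then -1 else 0" i] ij by simp
  qed
  have "complex_vector.independent (v ` {..<?k})"
  proof (rule complex_vector.independent_if_scalars_zero)
    fix f y assume 0: "(\<Sum>y\<in>v ` {..<?k}. f y *\<^sub>C y) = 0" and "y \<in> v ` {..<?k}"
    then obtain j where "j < ?k" "y = v j" by auto
    then show "f y = 0" using ind[of "\<lambda>i. f (v i)" j] 0 by (simp add: sum.reindex[OF inj])
  qed simp
  moreover obtain e where e: "unitary_basis (pspace A) (pform A) (cdim (pspace A)) e" by (rule obtain_unitary_basis)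
  then have sp: "complex_vector.span (e ` {..<cdim (pspace A)}) = pspace A" by (rule unitary_basis.e_span)
  moreover have "v ` {..<?k} \<subseteq> pspace A" using v B by auto
  ultimately have "card (v ` {..<?k}) \<le> card (e ` {..<cdim (pspace A)})"
    using complex_vector.independent_span_bound[of "e ` {..<cdim (pspace A)}"] by simp
  also have "\<dots> \<le> cdim (pspace A)" using card_image_le[of "{..<cdim (pspace A)}" e] by simp
  finally show ?thesis using card_image[OF inj] by simp
qed

text \<open>Recursive, so that exchanging a piece in the middle of a list is handled by
  \<open>lattice_sum_append\<close>.\<close>

primrec lattice_sum :: "'v::real_vector pav list \<Rightarrow> 'v set" where
  "lattice_sum [] = {0}"
| "lattice_sum (B # Bs) = {x + y | x y. x \<in> plat B \<and> y \<in> lattice_sum Bs}"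

lemma lattice_sum_nth:
  "v \<in> lattice_sum Bs \<Longrightarrow> \<exists>x. (\<forall>i<length Bs. x i \<in> plat (Bs ! i)) \<and> v = (\<Sum>i<length Bs. x i)"
proof (induction Bs arbitrary: v)
  case (Cons B Bs)
  then obtain a b where ab: "a \<in> plat B" "b \<in> lattice_sum Bs" "v = a + b" by auto
  then obtain x where "\<forall>i<length Bs. x i \<in> plat (Bs ! i)" "b = (\<Sum>i<length Bs. x i)" using Cons.IH by blast
  with ab have x: "\<forall>i<length Bs. x i \<in> plat (Bs ! i)" "v = a + (\<Sum>i<length Bs. x i)" by auto
  show ?case
  proof (intro exI[of _ "case_nat a x"] conjI allI impI)
    fix i assume "i < length (B # Bs)"
    then show "case_nat a x i \<in> plat ((B # Bs) ! i)" using ab(1) x(1) by (cases i) auto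
  next
    show "v = (\<Sum>i<length (B # Bs). case_nat a x i)"
      using x(2) by (simp add: sum.lessThan_Suc_shift del: sum.lessThan_Suc)
  qed
qed simp

lemma lattice_sum_append: "lattice_sum (Bs @ Cs) = {x + y | x y. x \<in> lattice_sum Bs \<and> y \<in> lattice_sum Cs}"
proof (induction Bs)
  case (Cons B Bs)
  show ?case
  proof (intro Set.set_eqI iffI)
    fix v assume "v \<in> lattice_sum ((B # Bs) @ Cs)"
    then obtain a d where ad: "a \<in> plat B" "d \<in> lattice_sum (Bs @ Cs)" "v = a + d" by auto
    from ad(2) obtain b c where "b \<in> lattice_sum Bs" "c \<in> lattice_sum Cs" "d = b + c" unfolding Cons.IH by blast
    with ad have "a + b \<in> lattice_sum (B # Bs)" "c \<in> lattice_sum Cs" "v = (a + b) + c"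
      by (auto simp: add.assoc)
    then show "v \<in> {x + y |x y. x \<in> lattice_sum (B # Bs) \<and> y \<in> lattice_sum Cs}" by blast
  next
    fix v assume "v \<in> {x + y |x y. x \<in> lattice_sum (B # Bs) \<and> y \<in> lattice_sum Cs}"
    then obtain a b c where abc: "a \<in> plat B" "b \<in> lattice_sum Bs" "c \<in> lattice_sum Cs" "v = a + b + c" by auto
    then have "b + c \<in> lattice_sum (Bs @ Cs)" "v = a + (b + c)" unfolding Cons.IH by (blast, simp add: add.assoc)
    with abc(1) show "v \<in> lattice_sum ((B # Bs) @ Cs)" by auto
  qed
qed simp

lemma lattice_sum_scale:
  "(\<And>B. B \<in> set Bs \<Longrightarrow> add_subgroup (plat B)) \<Longrightarrow> v \<in> lattice_sum Bs \<Longrightarrow> real m *\<^sub>R v \<in> lattice_sum Bs"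
proof (induction Bs arbitrary: v)
  case (Cons B Bs)
  then obtain a b where ab: "a \<in> plat B" "b \<in> lattice_sum Bs" "v = a + b" by auto
  have "real m *\<^sub>R a \<in> plat B" using Cons.prems(1) ab(1) by (intro add_subgroup_scale_nat) auto
  moreover have "real m *\<^sub>R b \<in> lattice_sum Bs" using Cons.prems(1) ab(2) by (intro Cons.IH) auto
  ultimately show ?case unfolding ab(3) scaleR_add_right by auto
qed simp

lemma (in pav) orthogonal_sum_is_isogeny:
  assumes sub: "\<And>B. B \<in> set Bs \<Longrightarrow> abelian_subvariety A B"
    and orth: "sorted_wrt (orthogonal_spaces A) Bs"
    and N: "N > 0" "\<And>l. l \<in> plat A \<Longrightarrow> real N *\<^sub>R l \<in> lattice_sum Bs"
  shows "sum_is_isogeny A Bs"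
proof (rule sum_is_isogenyI[OF sub _ N(1) lattice_sum_nth[OF N(2)]])
  fix x assume "\<And>i. i < length Bs \<Longrightarrow> x i \<in> pspace (Bs ! i)" "(\<Sum>i<length Bs. x i) = 0"
  then show "\<forall>i<length Bs. x i = 0" using orthogonal_independent[OF sub orth, of x] by blast
qed

section \<open>Symmetric idempotents and complementary subvarieties\<close>

context pav
begin

text \<open>These are the vectors of L tensor Q inside V.\<close>

definition commensurable :: "'v \<Rightarrow> bool" where
  "commensurable v \<longleftrightarrow> (\<exists>m::nat. m > 0 \<and> real m *\<^sub>R v \<in> plat A)"

lemma commensurable_add: "commensurable v \<Longrightarrow> commensurable w \<Longrightarrow> commensurable (v + w)"
proof -
  assume "commensurable v" "commensurable w"
  then obtain m k :: nat where m: "m > 0" "real m *\<^sub>R v \<in> plat A" and k: "k > 0" "real k *\<^sub>R w \<in> plat A"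
    by (auto simp: commensurable_def)
  have "real (m * k) *\<^sub>R (v + w) = real k *\<^sub>R (real m *\<^sub>R v) + real m *\<^sub>R (real k *\<^sub>R w)"
    by (simp add: scaleR_add_right mult.commute)
  also have "\<dots> \<in> plat A"
    by (intro add_subgroup_closed(4)[OF lattice_subgroup] add_subgroup_scale_nat[OF lattice_subgroup] m k)
  finally show ?thesis unfolding commensurable_def using m k by (intro exI[of _ "m * k"]) simp
qed

lemma commensurable_sum: "(\<And>i. i \<in> I \<Longrightarrow> commensurable (f i)) \<Longrightarrow> commensurable (sum f I)"
  by (induction I rule: infinite_finite_induct)
    (auto simp: commensurable_add, auto simp: commensurable_def add_subgroup_closed[OF lattice_subgroup])

lemma commensurable_rat: "r \<in> \<rat> \<Longrightarrow> v \<in> plat A \<Longrightarrow> commensurable (r *\<^sub>R v)"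
proof -
  assume r: "r \<in> \<rat>" and v: "v \<in> plat A"
  then obtain a b where ab: "b > 0" "r = real_of_int a / real_of_int b" by (meson Rats_cases')
  then have "real (nat b) *\<^sub>R (r *\<^sub>R v) = real_of_int a *\<^sub>R v" by simp
  also have "\<dots> \<in> plat A" using add_subgroup_scale_int[OF lattice_subgroup v] .
  finally show "commensurable (r *\<^sub>R v)" unfolding commensurable_def using ab by (intro exI[of _ "nat b"]) simp
qed

text \<open>The product of the denominators for a finite lattice basis works for the whole
  lattice.\<close>

lemma uniform_denominator:
  assumes add: "\<And>x y. x \<in> pspace A \<Longrightarrow> y \<in> pspace A \<Longrightarrow> f (x + y) = f x + f y"
    and scale: "\<And>r x. x \<in> pspace A \<Longrightarrow> f (r *\<^sub>R x) = r *\<^sub>R f x"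
    and com: "\<And>x. x \<in> plat A \<Longrightarrow> commensurable (f x)"
  shows "\<exists>m::nat. m > 0 \<and> (\<forall>x\<in>plat A. real m *\<^sub>R f x \<in> plat A)"
proof -
  obtain B where B: "zbasis (plat A) B" "span B = pspace A" by (rule obtain_zbasis)
  have fin: "finite B" and ind: "independent B" using B(1) by (auto simp: zbasis_def)
  have BL: "B \<subseteq> plat A" by (rule zbasis_subset[OF B(1)])
  have "\<exists>m::nat. m > 0 \<and> (\<forall>b\<in>C. real m *\<^sub>R f b \<in> plat A)" if "finite C" "C \<subseteq> B" for C
    using that
  proof (induction C rule: finite_induct)
    case (insert c C)
    then obtain m :: nat where m: "m > 0" "\<And>b. b \<in> C \<Longrightarrow> real m *\<^sub>R f b \<in> plat A" by auto
    obtain k :: nat where k: "k > 0" "real k *\<^sub>R f c \<in> plat A"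
      using com[of c] insert.prems BL by (auto simp: commensurable_def)
    have "real (m * k) *\<^sub>R f b \<in> plat A" if "b \<in> insert c C" for b
    proof (cases "b = c")
      case True
      then show ?thesis using add_subgroup_scale_nat[OF lattice_subgroup k(2), of m] by simp
    next
      case False
      then show ?thesis using add_subgroup_scale_nat[OF lattice_subgroup m(2), of b k] that by (simp add: mult.commute)
    qed
    then show ?case using m(1) k(1) by (intro exI[of _ "m * k"]) auto
  qed (auto intro: exI[of _ 1])
  from this[OF fin order_refl] obtain m :: nat where m: "m > 0" "\<And>b. b \<in> B \<Longrightarrow> real m *\<^sub>R f b \<in> plat A" by auto
  have f0: "f 0 = 0" using scale[OF V_closed(1), of 0] by simp
  have fsum: "f (sum h I) = (\<Sum>i\<in>I. f (h i))" if "\<And>i. i \<in> I \<Longrightarrow> h i \<in> pspace A" for h and I :: "'v set"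
    using that
  proof (induction I rule: infinite_finite_induct)
    case (insert x I) then show ?case by (simp add: add V_sum)
  qed (auto simp: f0)
  have "real m *\<^sub>R f x \<in> plat A" if x: "x \<in> plat A" for x
  proof -
    obtain c :: "'v \<Rightarrow> int" where c: "x = (\<Sum>b\<in>B. real_of_int (c b) *\<^sub>R b)"
      using zbasis_range[OF fin ind, of "plat A"] B(1) x by auto
    have BV: "b \<in> pspace A" if "b \<in> B" for b using that BL lattice_subset by blast
    have "real m *\<^sub>R f x = (\<Sum>b\<in>B. real_of_int (c b) *\<^sub>R (real m *\<^sub>R f b))"
      unfolding c by (subst fsum) (auto simp: V_closed BV scale scaleR_sum_right mult.commute intro!: sum.cong)
    also have "\<dots> \<in> plat A"
      by (intro add_subgroup_sum[OF lattice_subgroup] add_subgroup_scale_int[OF lattice_subgroup] m)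
    finally show ?thesis .
  qed
  then show ?thesis using m(1) by blast
qed

lemma symmetric_idempotentI:
  assumes "f \<in> extensional (pspace A)"
    and V: "\<And>x. x \<in> pspace A \<Longrightarrow> f x \<in> pspace A"
    and add: "\<And>x y. x \<in> pspace A \<Longrightarrow> y \<in> pspace A \<Longrightarrow> f (x + y) = f x + f y"
    and scale: "\<And>c x. x \<in> pspace A \<Longrightarrow> f (c *\<^sub>C x) = c *\<^sub>C f x"
    and self: "\<And>x y. x \<in> pspace A \<Longrightarrow> y \<in> pspace A \<Longrightarrow> pform A (f x) y = pform A x (f y)"
    and idem: "\<And>x. x \<in> pspace A \<Longrightarrow> f (f x) = f x"
    and com: "\<And>x. x \<in> plat A \<Longrightarrow> commensurable (f x)"
  shows "symmetric_idempotent A f"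
proof -
  have scaleR: "f (r *\<^sub>R x) = r *\<^sub>R f x" if "x \<in> pspace A" for r x
    using scale[OF that, of "complex_of_real r"] by (simp add: scaleR_scaleC)
  have "\<exists>m::nat. m > 0 \<and> (\<forall>x\<in>plat A. real m *\<^sub>R f x \<in> plat A)"
    by (rule uniform_denominator) (use add scaleR com in auto)
  then have "f \<in> End_rat A"
    using assms by (auto simp: End_rat_def PiE_def)
  moreover have "rosati A f = f"
  proof
    fix v
    show "rosati A f v = f v"
    proof (cases "v \<in> pspace A")
      case True
      have "phi_pol_inv A (restrict (\<lambda>w. phi_form A (pform A) v (f w)) (pspace A)) = f v"
        by (rule phi_pol_inv_eq) (use True V self in \<open>auto simp: phi_form_def\<close>)
      then show ?thesis using True by (simp add: rosati_def)
    qed (use assms(1) in \<open>auto simp: rosati_def extensional_def\<close>)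
  qed
  moreover have "compose (pspace A) f f = f"
    using assms(1) idem by (auto simp: compose_def extensional_def)
  ultimately show ?thesis by (simp add: symmetric_idempotent_def)
qed

lemma symmetric_idempotentD:
  assumes "symmetric_idempotent A f"
  shows "f \<in> extensional (pspace A)" "x \<in> pspace A \<Longrightarrow> f x \<in> pspace A"
    "x \<in> pspace A \<Longrightarrow> y \<in> pspace A \<Longrightarrow> f (x + y) = f x + f y"
    "x \<in> pspace A \<Longrightarrow> f (c *\<^sub>C x) = c *\<^sub>C f x"
    "x \<in> pspace A \<Longrightarrow> y \<in> pspace A \<Longrightarrow> pform A (f x) y = pform A x (f y)"
    "x \<in> pspace A \<Longrightarrow> f (f x) = f x"
    "\<exists>m::nat. m > 0 \<and> (\<forall>x\<in>plat A. real m *\<^sub>R f x \<in> plat A)"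
proof -
  have E: "f \<in> End_rat A" and ros: "rosati A f = f" and comp: "compose (pspace A) f f = f"
    using assms by (auto simp: symmetric_idempotent_def)
  show "f \<in> extensional (pspace A)" and m: "\<exists>m::nat. m > 0 \<and> (\<forall>x\<in>plat A. real m *\<^sub>R f x \<in> plat A)"
    using E by (auto simp: End_rat_def PiE_def)
  have V: "x \<in> pspace A \<Longrightarrow> f x \<in> pspace A" for x using E by (auto simp: End_rat_def)
  then show "x \<in> pspace A \<Longrightarrow> f x \<in> pspace A" .
  have add: "x \<in> pspace A \<Longrightarrow> y \<in> pspace A \<Longrightarrow> f (x + y) = f x + f y" for x y using E by (auto simp: End_rat_def)
  then show "x \<in> pspace A \<Longrightarrow> y \<in> pspace A \<Longrightarrow> f (x + y) = f x + f y" .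
  have scale: "x \<in> pspace A \<Longrightarrow> f (c *\<^sub>C x) = c *\<^sub>C f x" for x c using E by (auto simp: End_rat_def)
  then show "x \<in> pspace A \<Longrightarrow> f (c *\<^sub>C x) = c *\<^sub>C f x" .
  show "x \<in> pspace A \<Longrightarrow> f (f x) = f x" using comp by (metis compose_eq)
  assume x: "x \<in> pspace A" and y: "y \<in> pspace A"
  have scaleR: "f (r *\<^sub>R x) = r *\<^sub>R f x" if "x \<in> pspace A" for r x
    using scale[OF that, of "complex_of_real r"] by (simp add: scaleR_scaleC)
  \<comment> \<open>\<open>rosati\<close> is built from \<open>inv_into\<close>; it can be evaluated
    once the functional is known to be represented by some u.\<close>
  obtain u where u: "u \<in> pspace A" "\<And>w. w \<in> pspace A \<Longrightarrow> pform A u w = pform A x (f w)"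
    using form_riesz[of "\<lambda>w. pform A x (f w)"] x V by (auto simp: add scaleR F_add F_scale)
  have "phi_pol_inv A (restrict (\<lambda>w. phi_form A (pform A) x (f w)) (pspace A)) = u"
    by (rule phi_pol_inv_eq) (use u x V in \<open>auto simp: phi_form_def\<close>)
  then have "rosati A f x = u" using x by (simp add: rosati_def)
  then show "pform A (f x) y = pform A x (f y)" using ros u(2)[OF y] by simp
qed

lemma one_minus_symmetric_idempotent:
  assumes "symmetric_idempotent A f"
  shows "symmetric_idempotent A (one_minus A f)"
proof -
  note f = symmetric_idempotentD[OF assms]
  obtain m :: nat where m: "m > 0" "\<And>x. x \<in> plat A \<Longrightarrow> real m *\<^sub>R f x \<in> plat A" using f(7) by auto
  have fd: "f (x - y) = f x - f y" if "x \<in> pspace A" "y \<in> pspace A" for x y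
    using f(3)[of "x - y" y] that by (simp add: V_closed eq_diff_eq)
  show ?thesis
  proof (rule symmetric_idempotentI)
    fix x assume "x \<in> plat A"
    then have "real m *\<^sub>R (x - f x) \<in> plat A"
      using m add_subgroup_closed(2)[OF lattice_subgroup add_subgroup_scale_nat[OF lattice_subgroup]]
      by (simp add: scaleR_diff_right)
    then show "commensurable (one_minus A f x)"
      using \<open>x \<in> plat A\<close> m(1) lattice_subset by (auto simp: commensurable_def one_minus_def)
  qed (use f fd in \<open>auto simp: one_minus_def V_closed V_scaleC F_diff complex_vector.scale_right_diff_distrib\<close>)
qed

text \<open>The intersection of L with the image U has a basis, being a subgroup of L. It spans U
  over the reals because m f(b) lies in it for each lattice vector b, and the f(b) span U.\<close>

lemma Im_variety_subvariety:
  assumes "symmetric_idempotent A f"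
  shows "abelian_subvariety A (Im_variety A f)"
proof -
  note f = symmetric_idempotentD[OF assms]
  obtain m :: nat where m: "m > 0" "\<And>x. x \<in> plat A \<Longrightarrow> real m *\<^sub>R f x \<in> plat A" using f(7) by auto
  let ?U = "f ` pspace A"
  have UV: "?U \<subseteq> pspace A" using f(2) by blast
  have subU: "complex_vector.subspace ?U"
  proof (rule complex_vector.subspaceI)
    show "0 \<in> ?U" using f(4)[OF V_closed(1), of 0] V_closed(1) by (intro image_eqI[of _ _ 0]) auto
    fix x y assume "x \<in> ?U" "y \<in> ?U"
    then obtain a b where "a \<in> pspace A" "x = f a" "b \<in> pspace A" "y = f b" by blast
    then show "x + y \<in> ?U" by (intro image_eqI[of _ _ "a + b"]) (auto simp: f(3) V_closed)
  next
    fix c x assume "x \<in> ?U"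
    then obtain a where "a \<in> pspace A" "x = f a" by blast
    then show "c *\<^sub>C x \<in> ?U" by (intro image_eqI[of _ _ "c *\<^sub>C a"]) (auto simp: f(4) V_scaleC)
  qed
  have sg: "add_subgroup (plat A \<inter> ?U)"
    using add_subgroup_closed[OF lattice_subgroup] complex_vector.subspace_0[OF subU] complex_vector.subspace_diff[OF subU]
    by (auto simp: add_subgroup_def)
  obtain B where B: "zbasis (plat A) B" "span B = pspace A" by (rule obtain_zbasis)
  obtain C where C: "zbasis (plat A \<inter> ?U) C" using zbasis_subgroup[OF B(1) sg] by blast
  have "span C = ?U"
  proof
    show "span C \<subseteq> ?U"
      by (rule real_vector.span_minimal) (use zbasis_subset[OF C] subU complex_subspace_imp_real in auto)
    show "?U \<subseteq> span C"
    proof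
      fix y assume "y \<in> ?U"
      then obtain x where x: "x \<in> span B" "y = f x" using B by blast
      have "subspace {x \<in> pspace A. f x \<in> span C}"
      proof (rule real_vector.subspaceI)
        have "f 0 = 0" using f(4)[OF V_closed(1), of 0] by simp
        then show "0 \<in> {x \<in> pspace A. f x \<in> span C}" using V_closed(1) by (auto simp: real_vector.span_zero)
      next
        fix c x assume "x \<in> {x \<in> pspace A. f x \<in> span C}"
        then show "c *\<^sub>R x \<in> {x \<in> pspace A. f x \<in> span C}"
          using f(4)[of x "complex_of_real c"] by (auto simp: V_closed real_vector.span_scale simp flip: scaleR_scaleC)
      qed (auto simp: V_closed f(3) real_vector.span_add)
      moreover have "b \<in> {x \<in> pspace A. f x \<in> span C}" if b: "b \<in> B" for b
      proof -
        have bL: "b \<in> plat A" "b \<in> pspace A" using b zbasis_subset[OF B(1)] lattice_subset by auto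
        have "real m *\<^sub>R f b \<in> ?U" using subU complex_subspace_imp_real bL by (intro real_vector.subspace_scale) auto
        then have "real m *\<^sub>R f b \<in> span C" using m(2)[OF bL(1)] zbasis_span[OF C] by blast
        then have "(1 / real m) *\<^sub>R (real m *\<^sub>R f b) \<in> span C" by (rule real_vector.span_scale)
        then show ?thesis using m(1) bL by simp
      qed
      ultimately have "span B \<subseteq> {x \<in> pspace A. f x \<in> span C}" by (intro real_vector.span_minimal) auto
      then show "y \<in> span C" using x by blast
    qed
  qed
  moreover obtain cs where "set cs = C" "distinct cs" using C finite_distinct_list unfolding zbasis_def by blast
  ultimately have "complex_torus ?U (plat A \<inter> ?U)"
    unfolding complex_torus_def is_lattice_basis_iff using C subU by blast
  then show ?thesis using UV by (simp add: abelian_subvariety_def Im_variety_def)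
qed

text \<open>On the image, v and f v define the same functional: F(f v, f x) = F(v, f (f x)) = F(v, f
  x).\<close>

lemma norm_idempotent_Im:
  assumes "symmetric_idempotent A f"
  shows "norm_idempotent A (Im_variety A f) = f"
proof
  note f = symmetric_idempotentD[OF assms]
  let ?Y = "Im_variety A f"
  interpret Y: pav ?Y by (rule abelian_subvariety_pav[OF pav_axioms Im_variety_subvariety[OF assms]])
  have Y: "pspace ?Y = f ` pspace A" "pform ?Y = pform A" by (simp_all add: Im_variety_def)
  fix v
  show "norm_idempotent A ?Y v = f v"
  proof (cases "v \<in> pspace A")
    case True
    have "phi_pol_inv ?Y (restrict (phi_form A (pform A) v) (pspace ?Y)) = f v"
    proof (rule Y.phi_pol_inv_eq)
      show "f v \<in> pspace ?Y" using True Y by blast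
      fix w assume "w \<in> pspace ?Y"
      then obtain x where x: "x \<in> pspace A" "w = f x" using Y by blast
      then show "pform ?Y (f v) w = phi_form A (pform A) v w"
        using f(2)[of x] f(5)[of v w] f(6)[of x] True Y(2) by (simp add: phi_form_def)
    qed
    then show ?thesis using True by (simp add: norm_idempotent_def)
  qed (use f(1) in \<open>auto simp: norm_idempotent_def extensional_def\<close>)
qed

lemma one_minus_one_minus: "f \<in> extensional (pspace A) \<Longrightarrow> (\<And>x. x \<in> pspace A \<Longrightarrow> f x \<in> pspace A) \<Longrightarrow>
    one_minus A (one_minus A f) = f"
  by (auto simp: one_minus_def extensional_def fun_eq_iff V_closed)

lemma complementary_Im:
  assumes "symmetric_idempotent A f"
  shows "complementary_subvarieties A (Im_variety A f) (Im_variety A (one_minus A f))"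
  unfolding complementary_subvarieties_def
  using Im_variety_subvariety[OF assms] Im_variety_subvariety[OF one_minus_symmetric_idempotent[OF assms]]
    norm_idempotent_Im[OF assms] norm_idempotent_Im[OF one_minus_symmetric_idempotent[OF assms]]
    one_minus_one_minus symmetric_idempotentD(1,2)[OF assms]
  by simp

text \<open>The orthogonal projection onto a subvariety \<open>Y\<close>, expanded in a symplectic basis of \<open>Y\<close>, has
  rational coefficients on the lattice.\<close>

lemma norm_idempotent_symmetric:
  assumes "abelian_subvariety A Y"
  shows "symmetric_idempotent A (norm_idempotent A Y)" "norm_idempotent A Y ` pspace A = pspace Y"
proof -
  interpret Y: pav Y by (rule abelian_subvariety_pav[OF pav_axioms assms])
  have Y: "pspace Y \<subseteq> pspace A" "plat Y \<subseteq> plat A" "pform Y = pform A"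
    using assms by (auto simp: abelian_subvariety_def)
  let ?f = "norm_idempotent A Y"
  have f: "?f v \<in> pspace Y \<and> (\<forall>y\<in>pspace Y. pform A (?f v) y = pform A v y)" if v: "v \<in> pspace A" for v
  proof -
    obtain u where u: "u \<in> pspace Y" "\<And>y. y \<in> pspace Y \<Longrightarrow> pform Y u y = pform A v y"
      using Y.form_riesz[of "pform A v"] v Y by (auto simp: F_add F_scale subset_iff)
    have "phi_pol_inv Y (restrict (phi_form A (pform A) v) (pspace Y)) = u"
      by (rule Y.phi_pol_inv_eq) (use u v Y in \<open>auto simp: phi_form_def\<close>)
    then have "?f v = u" using v by (simp add: norm_idempotent_def)
    then show ?thesis using u Y(3) by simp
  qed
  have fY: "?f v \<in> pspace Y" and fF: "y \<in> pspace Y \<Longrightarrow> pform A (?f v) y = pform A v y" if "v \<in> pspace A" for v y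
    using f[OF that] by auto
  have fV: "?f v \<in> pspace A" if "v \<in> pspace A" for v using fY[OF that] Y by blast
  have YV: "y \<in> pspace A" if "y \<in> pspace Y" for y using that Y by blast
  \<comment> \<open>The projection is characterized by its pairings with Y; linearity and the
    identity on Y are read off from this uniqueness.\<close>
  have uniq: "?f v = u" if "v \<in> pspace A" "u \<in> pspace Y" "\<And>y. y \<in> pspace Y \<Longrightarrow> pform A u y = pform A v y" for u v
    by (rule Y.F_eqI) (use that fY fF Y(3) in auto)
  have id: "?f y = y" if "y \<in> pspace Y" for y using that YV by (intro uniq) auto
  \<comment> \<open>Both sides equal F(f x, f y), since a vector and its projection have the same
    pairings with Y.\<close>
  have self: "pform A (?f x) y = pform A x (?f y)" if x: "x \<in> pspace A" and y: "y \<in> pspace A" for x y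
  proof -
    have "pform A (?f x) y = - pform A y (?f x)" using F_skew fV x y by blast
    also have "\<dots> = - pform A (?f y) (?f x)" using fF[OF y fY[OF x]] by simp
    also have "\<dots> = pform A (?f x) (?f y)" using F_skew[OF fV[OF x] fV[OF y]] by simp
    also have "\<dots> = pform A x (?f y)" using fF[OF x fY[OF y]] .
    finally show ?thesis .
  qed
  obtain ns us where "symplectic_basis Y ns us" using Y.exists_symplectic_basis by blast
  then interpret S: symplectic_pav Y ns us by (rule symplectic_pavI[OF Y.pav_axioms])
  have com: "commensurable (?f x)" if x: "x \<in> plat A" for x
  proof -
    have xV: "x \<in> pspace A" using x lattice_subset by blast
    have uL: "us ! i \<in> plat A" "us ! i \<in> pspace Y" if "i < 2 * S.g" for i using S.bs_L[OF that] S.bs_V[OF that] Y by auto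
    have rat: "pform A (?f x) (us ! i) \<in> \<rat>" "pform A (us ! i) (?f x) \<in> \<rat>" if "i < 2 * S.g" for i
    proof -
      show 1: "pform A (?f x) (us ! i) \<in> \<rat>"
        using fF[OF xV uL(2)[OF that]] form_integral[OF x uL(1)[OF that]] Ints_subset_Rats by auto
      then show "pform A (us ! i) (?f x) \<in> \<rat>"
        using F_skew[of "us ! i" "?f x"] fV[OF xV] YV[OF uL(2)[OF that]] by simp
    qed
    have "commensurable (pform A (?f x) (us ! (S.g + k)) *\<^sub>R S.nb ! k
            + (pform A (us ! k) (?f x) / real (ns ! k)) *\<^sub>R us ! (S.g + k))" if "k < S.g" for k
    proof -
      have "pform A (?f x) (us ! (S.g + k)) *\<^sub>R S.nb ! k = (pform A (?f x) (us ! (S.g + k)) / real (ns ! k)) *\<^sub>R us ! k"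
        using that by (simp add: S.nb_nth)
      then show ?thesis using rat uL that by (auto intro!: commensurable_add commensurable_rat Rats_divide)
    qed
    then show ?thesis
      using S.symplectic_expand[OF fY[OF xV]] commensurable_sum[of "{..<S.g}"] Y(3)
      by (metis (no_types, lifting) lessThan_iff)
  qed
  show "symmetric_idempotent A ?f"
  proof (rule symmetric_idempotentI)
    show "?f \<in> extensional (pspace A)" by (simp add: norm_idempotent_def)
    fix x y assume x: "x \<in> pspace A" and y: "y \<in> pspace A"
    show "?f (x + y) = ?f x + ?f y"
      by (rule uniq) (use x y fY fF Y.V_closed V_closed YV fV in \<open>auto simp: F_add\<close>)
  next
    fix c x assume x: "x \<in> pspace A"
    show "?f (c *\<^sub>C x) = c *\<^sub>C ?f x"
    proof (rule uniq)
      fix z assume z: "z \<in> pspace Y"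
      note c = scaleC_Re_Im[of c]
      have "pform A (\<i> *\<^sub>C ?f x) z = pform A (\<i> *\<^sub>C x) z"
        using fF[OF x Y.V_scaleC[OF z, of \<i>]] F_i_left[OF fV[OF x] YV[OF z]] F_i_left[OF x YV[OF z]] by simp
      then show "pform A (c *\<^sub>C ?f x) z = pform A (c *\<^sub>C x) z"
        unfolding c using x z fV YV fF by (simp add: F_add F_scale V_closed V_scaleC)
    qed (use x fY V_scaleC Y.V_scaleC in auto)
  qed (use fV self com id fY in auto)
  show "?f ` pspace A = pspace Y" using fY id YV by force
qed

end

section \<open>Idempotents attached to admissible forms\<close>

context period_pav
begin

lemma eigen_pav_exists:
  assumes V: "\<And>x. x \<in> pspace A \<Longrightarrow> f x \<in> pspace A"
    and add: "\<And>x y. x \<in> pspace A \<Longrightarrow> y \<in> pspace A \<Longrightarrow> f (x + y) = f x + f y"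
    and scale: "\<And>c x. x \<in> pspace A \<Longrightarrow> f (c *\<^sub>C x) = c *\<^sub>C f x"
    and self: "\<And>x y. x \<in> pspace A \<Longrightarrow> y \<in> pspace A \<Longrightarrow> pform A (f x) y = pform A x (f y)"
  obtains e t where "eigen_pav A ds bs Z e f t"
proof -
  obtain e t where e: "unitary_basis (pspace A) (pform A) g e" "\<And>k. k < g \<Longrightarrow> f (e k) = t k *\<^sub>R e k"
    using form_spectral[of f] V add scale self unfolding cdim_g by blast
  then interpret U: unitary_basis "pspace A" "pform A" g e by blast
  have "eigen_pav A ds bs Z e f t"
    by unfold_locales (use V scale self e in auto)
  then show ?thesis by (rule that)
qed

text \<open>Riesz gives f x from \<mu>(x, .). Invariance of \<mu> under i makes f complex linear,
  skewness of both forms makes it self-adjoint, and for x in L the symplectic expansion of f x has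
  rational coefficients.\<close>

lemma varphi_NS:
  assumes mu: "\<mu> \<in> NS_rat A"
  defines "f \<equiv> varphi A \<mu>"
  shows "f \<in> extensional (pspace A)" "x \<in> pspace A \<Longrightarrow> f x \<in> pspace A"
    "x \<in> pspace A \<Longrightarrow> y \<in> pspace A \<Longrightarrow> pform A (f x) y = \<mu> x y"
    "x \<in> pspace A \<Longrightarrow> y \<in> pspace A \<Longrightarrow> f (x + y) = f x + f y"
    "x \<in> pspace A \<Longrightarrow> f (c *\<^sub>C x) = c *\<^sub>C f x"
    "x \<in> pspace A \<Longrightarrow> y \<in> pspace A \<Longrightarrow> pform A (f x) y = pform A x (f y)"
    "x \<in> plat A \<Longrightarrow> commensurable (f x)"
proof -
  have alt\<mu>: "alternating_form_on (pspace A) \<mu>"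
    and rat: "\<And>x y. x \<in> plat A \<Longrightarrow> y \<in> plat A \<Longrightarrow> \<mu> x y \<in> \<rat>"
    and inv: "\<And>x y. x \<in> pspace A \<Longrightarrow> y \<in> pspace A \<Longrightarrow> \<mu> (\<i> *\<^sub>C x) (\<i> *\<^sub>C y) = \<mu> x y"
    using mu by (auto simp: NS_rat_def)
  interpret M: alternating_form "pspace A" \<mu> by unfold_locales (use subV alt\<mu> in auto)
  show "f \<in> extensional (pspace A)" by (simp add: f_def varphi_def)
  have f: "f x \<in> pspace A \<and> (\<forall>y\<in>pspace A. pform A (f x) y = \<mu> x y)" if x: "x \<in> pspace A" for x
  proof -
    obtain u where u: "u \<in> pspace A" "\<And>y. y \<in> pspace A \<Longrightarrow> pform A u y = \<mu> x y"
      using form_riesz[of "\<mu> x"] x by (auto simp: M.F_add M.F_scale)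
    have "phi_pol_inv A (restrict (\<mu> x) (pspace A)) = u"
      by (rule phi_pol_inv_eq) (use u in auto)
    then have "f x = u" using x by (simp add: f_def varphi_def phi_form_def)
    then show ?thesis using u by simp
  qed
  have fV: "x \<in> pspace A \<Longrightarrow> f x \<in> pspace A" and fF: "x \<in> pspace A \<Longrightarrow> y \<in> pspace A \<Longrightarrow> pform A (f x) y = \<mu> x y" for x y
    using f by auto
  show "x \<in> pspace A \<Longrightarrow> f x \<in> pspace A" "x \<in> pspace A \<Longrightarrow> y \<in> pspace A \<Longrightarrow> pform A (f x) y = \<mu> x y"
    using f by auto
  show "f (x + y) = f x + f y" if x: "x \<in> pspace A" and y: "y \<in> pspace A"
    by (rule F_eqI) (use x y fV fF in \<open>auto simp: V_closed F_add M.F_add\<close>)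
  show "f (c *\<^sub>C x) = c *\<^sub>C f x" if x: "x \<in> pspace A"
  proof (rule F_eqI)
    fix y assume y: "y \<in> pspace A"
    note c = scaleC_Re_Im[of c]
    have "pform A (\<i> *\<^sub>C f x) y = - \<mu> x (\<i> *\<^sub>C y)"
      using F_i_left[OF fV[OF x] y] fF[OF x V_scaleC[OF y]] by simp
    also have "\<dots> = \<mu> (\<i> *\<^sub>C x) y"
      using inv[OF x V_scaleC[OF y, of \<i>]] x y V_scaleC by (simp add: i_i_scaleC M.F_minus)
    finally show "pform A (f (c *\<^sub>C x)) y = pform A (c *\<^sub>C f x) y"
      unfolding fF[OF V_scaleC[OF x] y] c using x y fV fF by (simp add: F_add F_scale M.F_add M.F_scale V_closed V_scaleC)
  qed (use x fV V_scaleC in auto)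
  show "pform A (f x) y = pform A x (f y)" if x: "x \<in> pspace A" and y: "y \<in> pspace A"
    using fF[OF x y] fF[OF y x] M.F_skew[OF x y] F_skew[OF x fV[OF y]] by simp
  show "commensurable (f x)" if x: "x \<in> plat A"
  proof -
    have xV: "x \<in> pspace A" using x lattice_subset by blast
    have rt: "pform A (f x) (bs ! i) \<in> \<rat>" "pform A (bs ! i) (f x) \<in> \<rat>" if "i < 2 * g" for i
    proof -
      show 1: "pform A (f x) (bs ! i) \<in> \<rat>"
        using fF[OF xV bs_V[OF that]] rat[OF x bs_L[OF that]] by simp
      then show "pform A (bs ! i) (f x) \<in> \<rat>"
        using F_skew[of "bs ! i" "f x"] fV[OF xV] bs_V[OF that] by simp
    qed
    have "commensurable (pform A (f x) (bs ! (g + k)) *\<^sub>R nb ! k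
            + (pform A (bs ! k) (f x) / real (ds ! k)) *\<^sub>R bs ! (g + k))" if "k < g" for k
    proof -
      have "pform A (f x) (bs ! (g + k)) *\<^sub>R nb ! k = (pform A (f x) (bs ! (g + k)) / real (ds ! k)) *\<^sub>R bs ! k"
        using that by (simp add: nb_nth)
      then show ?thesis using rt bs_L that by (auto intro!: commensurable_add commensurable_rat Rats_divide)
    qed
    then show ?thesis
      using symplectic_expand[OF fV[OF xV]] commensurable_sum[of "{..<g}"]
      by (metis (no_types, lifting) lessThan_iff)
  qed
qed

text \<open>In an eigenbasis f has only the eigenvalues 0 and 1, hence it is idempotent. The
  equation for r = 1, g \<omega> \<theta>^(g-1) = n \<theta>^g, excludes f = 0, which would give n =
  0, and f = 1, which would give n = g.\<close>

lemma admissible_idempotent: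
  assumes n: "1 \<le> n" "n < g" and adm: "admissible ds Z n \<omega>"
  defines "f \<equiv> varphi A (form_of A bs \<omega>)"
  shows "symmetric_idempotent A f" "\<exists>x\<in>pspace A. f x \<noteq> 0" "\<exists>x\<in>pspace A. f x \<noteq> x"
proof -
  have "\<omega> \<in> rational_two_forms (2 * g)" using adm by (auto simp: admissible_def Let_def g_def)
  then obtain w where w: "\<omega> = coeff_of w" unfolding rational_two_forms_def coeff_of_two_form[symmetric] by blast
  have adm_w: "coeff_of w \<in> rational_two_forms (2 * g)" "w * Dz = 0"
    and eq: "\<And>r. r \<in> {1..g} \<Longrightarrow> of_nat (g choose r) * (w ^ r * th ^ (g - r)) = of_nat (n choose r) * th ^ g"
    using adm unfolding w admissible_iff by auto
  obtain \<mu> where mu: "\<mu> \<in> NS_rat A" and gam: "gamma bs \<mu> = coeff_of w" using gamma_surjective[OF adm_w] by blast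
  have "form_of A bs \<omega> = \<mu>" using form_of_gamma[OF mu] gam w by simp
  then have f: "f = varphi A \<mu>" by (simp add: f_def)
  note phi = varphi_NS[OF mu, folded f]
  obtain e t where "eigen_pav A ds bs Z e f t"
    by (rule eigen_pav_exists[of f, OF phi(2,4,5,6)])
  then interpret eigen_pav A ds bs Z e f t .
  have t01: "t k = 0 \<or> t k = 1" if "k < g" for k
    by (rule eigenvalues_of_admissible[of \<mu> n]) (use phi(3) adm gam w n that in auto)
  have idem: "f (f x) = f x" if x: "x \<in> pspace A" for x
  proof -
    define y where "y = f (f x) - f x"
    have yV: "y \<in> pspace A" by (simp add: y_def V_closed x f_V)
    have ff: "pform A (f (f x)) z = pform A x (f (f z))" if "z \<in> pspace A" for z
      using f_self f_V x that by metis
    have yF: "pform A y z = pform A x (f (f z)) - pform A x (f z)" if "z \<in> pspace A" for z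
      using that x by (simp add: y_def F_diff f_V ff f_self[OF x])
    have ee: "f (f (e k)) = f (e k)" if "k < g" for k
    proof -
      have sc: "f (r *\<^sub>R e k) = r *\<^sub>R f (e k)" for r
        using f_scale[OF U.e_V[OF that], of "complex_of_real r"] by (simp add: scaleR_scaleC)
      show ?thesis using t01[OF that] sc[of "t k"] f_e[OF that] by auto
    qed
    have "pform A y (e k) = 0" "pform A y (\<i> *\<^sub>C e k) = 0" if "k < g" for k
    proof -
      show "pform A y (e k) = 0" using yF[OF U.e_V[OF that]] ee[OF that] by simp
      have "f (f (\<i> *\<^sub>C e k)) = f (\<i> *\<^sub>C e k)"
        using f_scale[OF U.e_V[OF that]] f_scale[OF f_V[OF U.e_V[OF that]]] ee[OF that] by simp
      then show "pform A y (\<i> *\<^sub>C e k) = 0" using yF[OF V_scaleC[OF U.e_V[OF that]]] by simp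
    qed
    then have "y = 0"
      using U.e_expand[OF yV] F_skew[OF U.e_V yV] by simp
    then show ?thesis by (simp add: y_def)
  qed
  show "symmetric_idempotent A f"
    by (rule symmetric_idempotentI) (use phi idem in auto)
  have w_mu: "w = - bform \<mu>" using gam unfolding gamma_bform coeff_of_inject by simp
  have one: "of_nat g * (w * th ^ (g - 1)) = of_nat n * th ^ g" using eq[of 1] n by simp
  show "\<exists>x\<in>pspace A. f x \<noteq> 0"
  proof (rule ccontr)
    assume "\<not> (\<exists>x\<in>pspace A. f x \<noteq> 0)"
    then have "\<mu> x y = 0" if "x \<in> pspace A" "y \<in> pspace A" for x y
      using phi(3)[OF that] that F_zero by simp
    then have "w = 0" unfolding w_mu bform_def ext_two_form_def by (simp add: bs_V ext_const_simps)
    then have "ext_const (of_nat n) * th ^ g = 0" using one by (simp add: ext_const_of_nat)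
    then have "(of_nat n :: complex) = 0" using ext_const_cancel th_power_nonzero by blast
    then show False using n by simp
  qed
  show "\<exists>x\<in>pspace A. f x \<noteq> x"
  proof (rule ccontr)
    assume "\<not> (\<exists>x\<in>pspace A. f x \<noteq> x)"
    then have "\<mu> x y = pform A x y" if "x \<in> pspace A" "y \<in> pspace A" for x y
      using phi(3)[OF that] that by simp
    then have "bform \<mu> = bform (pform A)" unfolding bform_def ext_two_form_def
      by (intro sum.cong refl) (auto simp: bs_V)
    then have "w = th" by (simp add: w_mu th_def)
    moreover have "th * th ^ (g - 1) = th ^ g" using n by (simp add: power_eq_if)
    ultimately have "ext_const (of_nat g - of_nat n) * th ^ g = 0"
      using one by (simp add: ext_const_simps ext_const_of_nat left_diff_distrib)
    then have "(of_nat g - of_nat n :: complex) = 0" using ext_const_cancel th_power_nonzero by blast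
    then show False using n by simp
  qed
qed

lemma eigen_pav_one_minus:
  assumes f: "symmetric_idempotent A f" and e: "eigen_pav A ds bs Z e f t"
  shows "eigen_pav A ds bs Z e (one_minus A f) (\<lambda>k. 1 - t k)"
proof -
  interpret eigen_pav A ds bs Z e f t by (rule e)
  note h = symmetric_idempotentD[OF one_minus_symmetric_idempotent[OF f]]
  show ?thesis
    by unfold_locales (use h U.e_V f_e in \<open>auto simp: one_minus_def algebra_simps\<close>)
qed

text \<open>The ranks of f and 1 - f are positive and add up to g, so both are less than g and one
  of them is at most (g+1)/2. That idempotent supplies the admissible form; one eigenbasis serves
  both.\<close>

lemma nontrivial_idempotent_admissible:
  assumes f: "symmetric_idempotent A f" and ne0: "\<exists>x\<in>pspace A. f x \<noteq> 0" and ne1: "\<exists>x\<in>pspace A. f x \<noteq> x"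
  shows "\<exists>n\<in>dim_range g. \<exists>\<omega>. admissible ds Z n \<omega>"
proof -
  note fD = symmetric_idempotentD[OF f]
  obtain e t where e: "eigen_pav A ds bs Z e f t"
    by (rule eigen_pav_exists[of f, OF fD(2,3,4,5)])
  interpret eigen_pav A ds bs Z e f t by (rule e)
  have scR: "f (r *\<^sub>R x) = r *\<^sub>R f x" if "x \<in> pspace A" for r x
    using f_scale[OF that, of "complex_of_real r"] by (simp add: scaleR_scaleC)
  have nz: "e k \<noteq> 0" if "k < g" for k using U.e_ie[OF that that] F_zero[OF V_closed(1)] by auto
  have t01: "t k = 0 \<or> t k = 1" if k: "k < g" for k
  proof -
    have "f (f (e k)) = f (e k)" using fD(6) U.e_V[OF k] .
    then have "(t k * t k) *\<^sub>R e k = t k *\<^sub>R e k" using f_e[OF k] scR[OF U.e_V[OF k]] by simp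
    then have "t k * t k = t k" using nz[OF k] by simp
    then show ?thesis by simp
  qed
  have fF: "pform A (f x) y = (\<Sum>k<g. t k * (pform A x (\<i> *\<^sub>C e k) * pform A (e k) y - pform A (e k) x * pform A y (\<i> *\<^sub>C e k)))"
    if "x \<in> pspace A" "y \<in> pspace A" for x y by (rule form_diagonal[OF that])
  have some1: "\<exists>k<g. t k = 1"
  proof (rule ccontr)
    assume "\<not> (\<exists>k<g. t k = 1)"
    then have "t k = 0" if "k < g" for k using t01[OF that] that by auto
    then have "pform A (f x) y = 0" if "x \<in> pspace A" "y \<in> pspace A" for x y using fF[OF that] by simp
    then show False using ne0 F_nondegenerate f_V by metis
  qed
  have some0: "\<exists>k<g. t k = 0"
  proof (rule ccontr)
    assume "\<not> (\<exists>k<g. t k = 0)"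
    then have "t k = 1" if "k < g" for k using t01[OF that] that by auto
    then have "pform A (f x) y = pform A x y" if "x \<in> pspace A" "y \<in> pspace A" for x y
      using fF[OF that] U.F_right[OF that] by simp
    then show False using ne1 F_eqI f_V by metis
  qed
  let ?h = "card {k\<in>{..<g}. t k = 1}" and ?h' = "card {k\<in>{..<g}. 1 - t k = 1}"
  have "?h > 0" "?h' > 0" using some0 some1 by (auto simp: card_gt_0_iff)
  have "{..<g} = {k\<in>{..<g}. t k = 1} \<union> {k\<in>{..<g}. 1 - t k = 1}" using t01 by auto
  then have "card {..<g} = card ({k\<in>{..<g}. t k = 1} \<union> {k\<in>{..<g}. 1 - t k = 1})" by (rule arg_cong)
  also have "\<dots> = ?h + ?h'" by (rule card_Un_disjoint) auto
  finally have sum: "g = ?h + ?h'" by simp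
  have rat: "pform A (f' x) y \<in> \<rat>" if f': "symmetric_idempotent A f'" and x: "x \<in> plat A" and y: "y \<in> plat A" for f' x y
  proof -
    note D = symmetric_idempotentD[OF f']
    obtain m :: nat where m: "m > 0" "real m *\<^sub>R f' x \<in> plat A" using D(7) x by auto
    have V: "x \<in> pspace A" "y \<in> pspace A" using x y lattice_subset by auto
    have "real m * pform A (f' x) y \<in> \<int>" using form_integral[OF m(2) y] D(2)[OF V(1)] V(2) by (simp add: F_scale)
    then have "real m * pform A (f' x) y / real m \<in> \<rat>" using Ints_subset_Rats by (intro Rats_divide) auto
    then show ?thesis using m(1) by simp
  qed
  have adm: "admissible ds Z ?h (gamma bs (\<lambda>x y. pform A (f x) y))"
    by (rule idempotent_admissible) (use rat[OF f] t01 in auto)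
  interpret I: eigen_pav A ds bs Z e "one_minus A f" "\<lambda>k. 1 - t k" by (rule eigen_pav_one_minus[OF f e])
  have adm': "admissible ds Z ?h' (gamma bs (\<lambda>x y. pform A (one_minus A f x) y))"
    by (rule I.idempotent_admissible) (use rat[OF one_minus_symmetric_idempotent[OF f]] t01 in auto)
  show ?thesis
  proof (cases "?h \<le> (g + 1) div 2")
    case True
    then have "?h \<in> dim_range g" using \<open>?h > 0\<close> \<open>?h' > 0\<close> sum by (simp add: dim_range_def)
    then show ?thesis using adm by blast
  next
    case False
    then have "?h' \<in> dim_range g" using \<open>?h > 0\<close> \<open>?h' > 0\<close> sum by (simp add: dim_range_def)
    then show ?thesis using adm' by blast
  qed
qed

text \<open>A subvariety Y is the image of its norm idempotent, and an idempotent other than 0 and 1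
  would produce an admissible form.\<close>

lemma simple_if_no_admissible:
  assumes none: "\<not> (\<exists>n\<in>dim_range g. \<exists>\<omega>. admissible ds Z n \<omega>)" and "pspace A \<noteq> {0}"
  shows "simple_variety A"
  unfolding simple_variety_def
proof (intro conjI allI impI)
  fix Y assume Y: "abelian_subvariety A Y"
  note f = norm_idempotent_symmetric[OF Y]
  show "pspace Y = {0} \<or> pspace Y = pspace A"
  proof (cases "\<exists>x\<in>pspace A. norm_idempotent A Y x \<noteq> 0")
    case True
    then have "\<not> (\<exists>x\<in>pspace A. norm_idempotent A Y x \<noteq> x)"
      using nontrivial_idempotent_admissible[OF f(1)] none by blast
    then have "norm_idempotent A Y ` pspace A = pspace A" by force
    then show ?thesis using f(2) by simp
  next
    case False
    then have "norm_idempotent A Y ` pspace A = {0}" using V_closed(1) by force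
    then show ?thesis using f(2) by simp
  qed
qed (fact assms(2))

end

section \<open>The decomposition procedure\<close>

lemma (in pav) idempotent_orthogonal:
  assumes "symmetric_idempotent A f"
  shows "orthogonal_spaces A (Im_variety A f) (Im_variety A (one_minus A f))"
proof -
  note f = symmetric_idempotentD[OF assms]
  have "pform A (f x) (y - f y) = 0" if "x \<in> pspace A" "y \<in> pspace A" for x y
  proof -
    have "pform A (f x) (f y) = pform A (f x) y"
      using f(5)[OF f(2)[OF that(1)] that(2)] f(6)[OF that(1)] by simp
    then show ?thesis using that f(2) by (simp add: F_diff)
  qed
  then show ?thesis by (auto simp: orthogonal_spaces_def Im_variety_def one_minus_def)
qed

text \<open>A denominator m of f is also one for 1 - f, so m l = m f(l) + m (l - f(l)) is the
  required decomposition.\<close>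

lemma (in pav) idempotent_lattice_sum:
  assumes "symmetric_idempotent A f"
  shows "\<exists>m::nat. m > 0 \<and> (\<forall>l\<in>plat A. real m *\<^sub>R l \<in> lattice_sum [Im_variety A f, Im_variety A (one_minus A f)])"
proof -
  note f = symmetric_idempotentD[OF assms] and h = symmetric_idempotentD[OF one_minus_symmetric_idempotent[OF assms]]
  obtain m :: nat where m: "m > 0" "\<forall>x\<in>plat A. real m *\<^sub>R f x \<in> plat A" using f(7) by blast
  have scR: "k (r *\<^sub>R x) = r *\<^sub>R k x" if "symmetric_idempotent A k" "x \<in> pspace A" for k r x
    using symmetric_idempotentD(4)[OF that, of "complex_of_real r"] by (simp add: scaleR_scaleC)
  have "real m *\<^sub>R l \<in> lattice_sum [Im_variety A f, Im_variety A (one_minus A f)]" if l: "l \<in> plat A" for l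
  proof -
    have lV: "l \<in> pspace A" using l lattice_subset by blast
    have a: "real m *\<^sub>R f l \<in> plat (Im_variety A f)"
      using m(2) l scR[OF assms lV, of "real m"] V_closed(4)[OF lV, of "real m"]
      by (auto simp: Im_variety_def intro: image_eqI[of _ _ "real m *\<^sub>R l"])
    have "real m *\<^sub>R one_minus A f l = real m *\<^sub>R l - real m *\<^sub>R f l"
      using lV by (simp add: one_minus_def scaleR_diff_right)
    also have "\<dots> \<in> plat A"
      by (rule add_subgroup_closed(2)[OF lattice_subgroup add_subgroup_scale_nat[OF lattice_subgroup l]])
        (use m(2) l in blast)
    finally have b: "real m *\<^sub>R one_minus A f l \<in> plat (Im_variety A (one_minus A f))"
      using scR[OF one_minus_symmetric_idempotent[OF assms] lV, of "real m"] V_closed(4)[OF lV, of "real m"]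
      by (auto simp: Im_variety_def intro: image_eqI[of _ _ "real m *\<^sub>R l"])
    have "real m *\<^sub>R l = real m *\<^sub>R f l + (real m *\<^sub>R one_minus A f l + 0)"
      using lV by (simp add: one_minus_def scaleR_diff_right)
    then show ?thesis unfolding lattice_sum.simps using a b by blast
  qed
  then show ?thesis using m(1) by blast
qed

definition valid_piece :: "'v::complex_vector pav \<Rightarrow> 'v piece \<Rightarrow> bool" where
  "valid_piece A = (\<lambda>(B, ds, bs, Z). abelian_subvariety A B \<and> pspace B \<noteq> {0} \<and>
     symplectic_basis B ds bs \<and> Z \<in> carrier_mat (length ds) (length ds) \<and>
     is_period_matrix B (normal_basis ds bs) bs (normal_period_mat ds Z))"

text \<open>Invariant of the procedure. Nonzero orthogonal pieces bound the length; the integer N,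
  which certifies that the sum of the lattices has finite index, gives the isogeny at the
  end.\<close>

definition valid_state :: "'v::complex_vector pav \<Rightarrow> 'v piece list \<Rightarrow> bool" where
  "valid_state A S \<longleftrightarrow> (\<forall>p\<in>set S. valid_piece A p) \<and> sorted_wrt (orthogonal_spaces A) (map fst S) \<and>
     (\<exists>N::nat. N > 0 \<and> (\<forall>l\<in>plat A. real N *\<^sub>R l \<in> lattice_sum (map fst S)))"

lemma (in pav) valid_piece_period_pav:
  "valid_piece A (B, ds, bs, Z) \<Longrightarrow> period_pav B ds bs Z"
  by (intro period_pav.intro symplectic_pavI abelian_subvariety_pav[OF pav_axioms] period_pav_axioms.intro)
    (auto simp: valid_piece_def)

context period_pav
begin

lemma admissible_pieces:
  assumes n: "n \<in> dim_range (length ds)" and adm: "admissible ds Z n \<omega>"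
  defines "f \<equiv> varphi A (form_of A bs \<omega>)"
  shows "symmetric_idempotent A f" "A_omega A bs \<omega> = Im_variety A f" "A_omega_c A bs \<omega> = Im_variety A (one_minus A f)"
    "abelian_subvariety A (A_omega A bs \<omega>)" "abelian_subvariety A (A_omega_c A bs \<omega>)"
    "pspace (A_omega A bs \<omega>) \<noteq> {0}" "pspace (A_omega_c A bs \<omega>) \<noteq> {0}"
proof -
  have n': "1 \<le> n" "n < g" using n by (auto simp: dim_range_def g_def)
  note f = admissible_idempotent[OF n' adm, folded f_def]
  show "symmetric_idempotent A f" by (rule f)
  show A: "A_omega A bs \<omega> = Im_variety A f" "A_omega_c A bs \<omega> = Im_variety A (one_minus A f)"
    by (simp_all add: A_omega_def A_omega_c_def f_def)
  show "abelian_subvariety A (A_omega A bs \<omega>)" "abelian_subvariety A (A_omega_c A bs \<omega>)"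
    unfolding A by (intro Im_variety_subvariety f one_minus_symmetric_idempotent)+
  obtain x y where x: "x \<in> pspace A" "f x \<noteq> 0" and y: "y \<in> pspace A" "f y \<noteq> y" using f(2,3) by blast
  have "f x \<in> pspace (A_omega A bs \<omega>)" using x(1) by (simp add: A(1) Im_variety_def)
  then show "pspace (A_omega A bs \<omega>) \<noteq> {0}" using x(2) by (metis singletonD)
  have "one_minus A f y \<in> pspace (A_omega_c A bs \<omega>)" using y(1) by (simp add: A(2) Im_variety_def)
  moreover have "one_minus A f y \<noteq> 0" using y by (simp add: one_minus_def)
  ultimately show "pspace (A_omega_c A bs \<omega>) \<noteq> {0}" by (metis singletonD)
qed

lemma computed_piece_valid:
  assumes sub: "abelian_subvariety A B" and ne: "pspace B \<noteq> {0}"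
    and comp: "computed_piece ds bs Z (B, ns, us, W)"
  shows "valid_piece A (B, ns, us, W)"
proof -
  from comp obtain P1 P2 where s: "symplectic_basis B ns us"
    and P: "P1 \<in> carrier_mat (length bs) (length ns)" "P2 \<in> carrier_mat (length bs) (length ns)"
      "coordinate_matrix bs us (join_cols P1 P2)" and eq: "induced_period_eq ds Z ns P1 P2 W"
    by (auto simp: computed_piece_def)
  have sB: "symplectic_pav B ns us" by (rule symplectic_pavI[OF abelian_subvariety_pav[OF pav_axioms sub] s])
  show ?thesis
    using induced_period_eq_iff[OF symplectic_pav_axioms sB Z period P, of W] eq sub ne s
    by (simp add: valid_piece_def)
qed

text \<open>An admissible form can thus always be followed by a step: every subvariety has a
  symplectic basis, its coordinates in \<open>bs\<close> are integers, and the equation for W is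
  solvable.\<close>

lemma computed_piece_exists:
  assumes sub: "abelian_subvariety A B"
  shows "\<exists>ns us W. computed_piece ds bs Z (B, ns, us, W)"
proof -
  interpret B: pav B by (rule abelian_subvariety_pav[OF pav_axioms sub])
  obtain ns us where s: "symplectic_basis B ns us" using B.exists_symplectic_basis by blast
  interpret S: symplectic_pav B ns us by (rule symplectic_pavI[OF B.pav_axioms s])
  have "set us \<subseteq> plat B" using S.basis zbasis_subset by (auto simp: is_lattice_basis_iff)
  also have "\<dots> \<subseteq> plat A" using sub by (auto simp: abelian_subvariety_def)
  finally obtain P1 P2 where P: "P1 \<in> carrier_mat (length bs) (length ns)" "P2 \<in> carrier_mat (length bs) (length ns)"
      "coordinate_matrix bs us (join_cols P1 P2)"
    using exists_coordinate_matrix[OF basis, of us "length ns"] S.length_bs by auto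
  obtain W where "induced_period_eq ds Z ns P1 P2 W"
    using induced_period_matrix[OF symplectic_pav_axioms S.symplectic_pav_axioms Z period P] by blast
  then show ?thesis using s P unfolding computed_piece_def prod.case by blast
qed

end

text \<open>Orthogonality to the other pieces is inherited, since both new pieces lie in B and all
  pieces carry the same form. The integer N is multiplied by a denominator m of the new
  idempotent.\<close>

lemma (in pav) split_step_valid:
  assumes S: "valid_state A S" and step: "split_step S S'"
  shows "valid_state A S' \<and> length S' = Suc (length S)"
  using step
proof cases
  case (split n ds Z \<omega> p B bs q xs ys)
  have vB: "valid_piece A (B, ds, bs, Z)" using S split(1) by (simp add: valid_state_def)
  interpret B: period_pav B ds bs Z by (rule valid_piece_period_pav[OF vB])
  have subB: "abelian_subvariety A B" using vB by (simp add: valid_piece_def)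
  have fB: "pform B = pform A" "plat B \<subseteq> plat A" using subB by (auto simp: abelian_subvariety_def)
  note C = B.admissible_pieces[OF split(3,4)]
  let ?f = "varphi B (form_of B bs \<omega>)"
  obtain B1 n1 u1 W1 where p: "p = (B1, n1, u1, W1)" by (cases p)
  obtain B2 n2 u2 W2 where q: "q = (B2, n2, u2, W2)" by (cases q)
  have B12: "B1 = A_omega B bs \<omega>" "B2 = A_omega_c B bs \<omega>" using split(5,6) p q by simp_all
  have "valid_piece B p" "valid_piece B q"
    using B.computed_piece_valid C(4-7) split(7,8) p q B12 by auto
  then have vpq: "valid_piece A p" "valid_piece A q"
    using abelian_subvariety_trans[OF subB] by (auto simp: valid_piece_def p q)
  have sg: "add_subgroup (plat D)" if D: "D \<in> fst ` set S" for D
  proof -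
    obtain r where "r \<in> set S" "D = fst r" using D by blast
    then have "abelian_subvariety A D" using S by (cases r) (auto simp: valid_state_def valid_piece_def)
    then show ?thesis using pav.lattice_subgroup[OF abelian_subvariety_pav[OF pav_axioms]] by blast
  qed
  have B12': "pspace B1 \<subseteq> pspace B" "pspace B2 \<subseteq> pspace B"
    using C(4,5) B12 by (auto simp: abelian_subvariety_def)
  have o12: "orthogonal_spaces A B1 B2"
    using B.idempotent_orthogonal[OF C(1)] C(2,3) B12 fB by (simp add: orthogonal_spaces_def)
  have sorted: "sorted_wrt (orthogonal_spaces A) (map fst (xs @ [p, q] @ ys))"
  proof -
    have "sorted_wrt (orthogonal_spaces A) (map fst (xs @ [(B, ds, bs, Z)] @ ys))"
      using S split(1) by (simp add: valid_state_def)
    then show ?thesis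
      using o12 B12' by (auto simp: sorted_wrt_append p q orthogonal_spaces_def subset_iff)
  qed
  obtain N :: nat where N: "N > 0" "\<And>l. l \<in> plat A \<Longrightarrow> real N *\<^sub>R l \<in> lattice_sum (map fst S)"
    using S by (auto simp: valid_state_def)
  obtain m :: nat where m: "m > 0" "\<And>l. l \<in> plat B \<Longrightarrow> real m *\<^sub>R l \<in> lattice_sum [B1, B2]"
    using B.idempotent_lattice_sum[OF C(1)] C(2,3) B12 by auto
  have "real (m * N) *\<^sub>R l \<in> lattice_sum (map fst (xs @ [p, q] @ ys))" if l: "l \<in> plat A" for l
  proof -
    have "real N *\<^sub>R l \<in> lattice_sum (map fst xs @ [B] @ map fst ys)" using N(2)[OF l] split(1) by simp
    then obtain a b c where abc: "a \<in> lattice_sum (map fst xs)" "b \<in> plat B" "c \<in> lattice_sum (map fst ys)"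
      "real N *\<^sub>R l = a + (b + c)"
      unfolding lattice_sum_append by auto
    have "real m *\<^sub>R a \<in> lattice_sum (map fst xs)"
      by (rule lattice_sum_scale[OF _ abc(1)], rule sg) (use split(1) in auto)
    moreover have "real m *\<^sub>R c \<in> lattice_sum (map fst ys)"
      by (rule lattice_sum_scale[OF _ abc(3)], rule sg) (use split(1) in auto)
    moreover have "real m *\<^sub>R b \<in> lattice_sum [B1, B2]" by (rule m(2)[OF abc(2)])
    moreover have "real (m * N) *\<^sub>R l = real m *\<^sub>R a + (real m *\<^sub>R b + real m *\<^sub>R c)"
    proof -
      have "real (m * N) *\<^sub>R l = real m *\<^sub>R (real N *\<^sub>R l)" by simp
      then show ?thesis unfolding abc(4) scaleR_add_right .
    qed
    ultimately have "real (m * N) *\<^sub>R l \<in> lattice_sum (map fst xs @ ([B1, B2] @ map fst ys))"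
      unfolding lattice_sum_append by blast
    then show ?thesis by (simp add: p q)
  qed
  then have "\<exists>N::nat. N > 0 \<and> (\<forall>l\<in>plat A. real N *\<^sub>R l \<in> lattice_sum (map fst S'))"
    using m(1) N(1) split(2) by (intro exI[of _ "m * N"]) simp
  moreover have "\<forall>r\<in>set S'. valid_piece A r"
    using S vpq split(1,2) by (auto simp: valid_state_def)
  ultimately show ?thesis using sorted split(1,2) by (simp add: valid_state_def)
qed

lemma (in pav) valid_state_length:
  assumes "valid_state A S"
  shows "length S \<le> cdim (pspace A)"
proof -
  have "length (map fst S) \<le> cdim (pspace A)"
    by (rule orthogonal_length_le) (use assms in \<open>auto simp: valid_state_def valid_piece_def\<close>)
  then show ?thesis by simp
qed

lemma (in pav) split_step_possible:
  assumes S: "valid_state A S" and ns: "\<not> stopped S"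
  shows "\<exists>S'. split_step S S'"
proof -
  obtain B ds bs Z n \<omega> where BS: "(B, ds, bs, Z) \<in> set S" and n: "n \<in> dim_range (length ds)" "admissible ds Z n \<omega>"
    using ns unfolding stopped_def by blast
  obtain xs ys where "S = xs @ (B, ds, bs, Z) # ys" using split_list[OF BS] by blast
  then have split: "S = xs @ [(B, ds, bs, Z)] @ ys" by simp
  have vB: "valid_piece A (B, ds, bs, Z)" using S BS by (simp add: valid_state_def)
  interpret B: period_pav B ds bs Z by (rule valid_piece_period_pav[OF vB])
  note C = B.admissible_pieces[OF n]
  obtain n1 u1 W1 where p: "computed_piece ds bs Z (A_omega B bs \<omega>, n1, u1, W1)"
    using B.computed_piece_exists[OF C(4)] by blast
  obtain n2 u2 W2 where q: "computed_piece ds bs Z (A_omega_c B bs \<omega>, n2, u2, W2)"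
    using B.computed_piece_exists[OF C(5)] by blast
  have "split_step S (xs @ [(A_omega B bs \<omega>, n1, u1, W1), (A_omega_c B bs \<omega>, n2, u2, W2)] @ ys)"
    unfolding split by (rule split_step.split[OF n _ _ p q]) simp_all
  then show ?thesis ..
qed

text \<open>Each piece carries a period matrix of its own, so the simplicity criterion applies to it
  as a polarized variety.\<close>

lemma (in pav) stopped_state:
  assumes S: "valid_state A S" and st: "stopped S"
  shows "(\<forall>B\<in>set (map fst S). abelian_subvariety A B \<and> simple_variety B) \<and> sum_is_isogeny A (map fst S)"
proof
  have v: "abelian_subvariety A B \<and> simple_variety B" if BS: "(B, ds, bs, Z) \<in> set S" for B ds bs Z
  proof -
    have vB: "valid_piece A (B, ds, bs, Z)" using S BS by (simp add: valid_state_def)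
    interpret B: period_pav B ds bs Z by (rule valid_piece_period_pav[OF vB])
    have "\<not> (\<exists>n\<in>dim_range B.g. \<exists>\<omega>. admissible ds Z n \<omega>)"
      using st BS unfolding stopped_def B.g_def by blast
    then have "simple_variety B" using B.simple_if_no_admissible vB by (simp add: valid_piece_def)
    then show ?thesis using vB by (simp add: valid_piece_def)
  qed
  then show *: "\<forall>B\<in>set (map fst S). abelian_subvariety A B \<and> simple_variety B" by auto
  obtain N :: nat where N: "N > 0" "\<And>l. l \<in> plat A \<Longrightarrow> real N *\<^sub>R l \<in> lattice_sum (map fst S)"
    using S by (auto simp: valid_state_def)
  show "sum_is_isogeny A (map fst S)"
    by (rule orthogonal_sum_is_isogeny[OF _ _ N]) (use * S in \<open>auto simp: valid_state_def\<close>)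
qed

theorem mainTheorem1:
  fixes A :: "'v::complex_vector pav" and ds :: "nat list" and bs :: "'v list"
    and Z :: "complex mat" and g :: nat
  assumes "polarized_abelian_variety A"
    and "g = cdim (pspace A)" and "g \<ge> 1"
    and "symplectic_basis A ds bs"
    and "Z \<in> siegel_space g"
    and "is_period_matrix A (normal_basis ds bs) bs (normal_period_mat ds Z)"
  shows
    "((\<not> (\<exists>n\<in>dim_range g. \<exists>\<omega>. admissible ds Z n \<omega>)) \<longrightarrow> simple_variety A)
   \<and> (\<forall>n\<in>dim_range g. \<forall>\<omega>. admissible ds Z n \<omega> \<longrightarrow>
        (let f = varphi A (form_of A bs \<omega>) in
           symmetric_idempotent A f \<and> symmetric_idempotent A (one_minus A f)) \<and>
        complementary_subvarieties A (A_omega A bs \<omega>) (A_omega_c A bs \<omega>) \<and>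
        sum_is_isogeny A [A_omega A bs \<omega>, A_omega_c A bs \<omega>])
   \<and> (\<forall>n\<in>dim_range g. \<forall>\<omega>. admissible ds Z n \<omega> \<longrightarrow>
        (\<forall>B\<in>{A_omega A bs \<omega>, A_omega_c A bs \<omega>}. \<forall>h ns us P1 P2.
           h = cdim (pspace B) \<longrightarrow>
           symplectic_basis B ns us \<longrightarrow>
           P1 \<in> carrier_mat (2 * g) h \<longrightarrow> P2 \<in> carrier_mat (2 * g) h \<longrightarrow>
           coordinate_matrix bs us (join_cols P1 P2) \<longrightarrow>
           (\<exists>W\<in>siegel_space h.
              induced_period_eq ds Z ns P1 P2 W \<and>
              (\<forall>W'. induced_period_eq ds Z ns P1 P2 W' \<longrightarrow> W' = W) \<and>
              is_period_matrix B (normal_basis ns us) us (normal_period_mat ns W))))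
   \<and> ((\<nexists>S. S 0 = [(A, ds, bs, Z)] \<and> (\<forall>k::nat. split_step (S k) (S (Suc k)))) \<and>
      (\<forall>S. split_step\<^sup>*\<^sup>* [(A, ds, bs, Z)] S \<longrightarrow>
         (\<not> stopped S \<longrightarrow> (\<exists>S'. split_step S S')) \<and>
         (stopped S \<longrightarrow>
            (\<forall>B\<in>set (map fst S). abelian_subvariety A B \<and> simple_variety B) \<and>
            sum_is_isogeny A (map fst S))))"
proof -
  interpret A: pav A by unfold_locales (rule assms(1))
  have g: "g = length ds" using assms(2,4) by (simp add: symplectic_basis_def)
  have Zc: "Z \<in> carrier_mat (length ds) (length ds)" using assms(5) g by (simp add: siegel_space_def)
  \<comment> \<open>Here \<open>g \<ge> 1\<close> enters: it makes A nonzero, as is required of a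
    simple variety and of a piece.\<close>
  have ne: "pspace A \<noteq> {0}"
  proof
    assume "pspace A = {0}"
    then have "cdim (pspace A) = 0"
      using complex_vector.dim_span_eq_card_independent[OF complex_vector.independent_empty] by simp
    then show False using assms(2,3) by simp
  qed
  have vA: "valid_piece A (A, ds, bs, Z)"
    using A.abelian_subvariety_refl ne assms(4,6) Zc by (simp add: valid_piece_def)
  interpret P: period_pav A ds bs Z by (rule A.valid_piece_period_pav[OF vA])
  have gg: "P.g = g" by (simp add: P.g_def g)
  have one: "simple_variety A" if "\<not> (\<exists>n\<in>dim_range g. \<exists>\<omega>. admissible ds Z n \<omega>)"
    using P.simple_if_no_admissible that ne gg by simp
  have two: "(let f = varphi A (form_of A bs \<omega>) in
           symmetric_idempotent A f \<and> symmetric_idempotent A (one_minus A f)) \<and>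
        complementary_subvarieties A (A_omega A bs \<omega>) (A_omega_c A bs \<omega>) \<and>
        sum_is_isogeny A [A_omega A bs \<omega>, A_omega_c A bs \<omega>]"
    if "n \<in> dim_range g" "admissible ds Z n \<omega>" for n \<omega>
  proof -
    note C = P.admissible_pieces[OF that[unfolded g]]
    let ?f = "varphi A (form_of A bs \<omega>)"
    obtain m :: nat where m: "m > 0" "\<And>l. l \<in> plat A \<Longrightarrow> real m *\<^sub>R l \<in> lattice_sum [A_omega A bs \<omega>, A_omega_c A bs \<omega>]"
      using A.idempotent_lattice_sum[OF C(1)] C(2,3) by auto
    have "sum_is_isogeny A [A_omega A bs \<omega>, A_omega_c A bs \<omega>]"
      by (rule A.orthogonal_sum_is_isogeny[OF _ _ m])
        (use C(4,5) A.idempotent_orthogonal[OF C(1)] C(2,3) in auto)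
    then show ?thesis
      using C(1-3) A.one_minus_symmetric_idempotent[OF C(1)] A.complementary_Im[OF C(1)] by (simp add: Let_def)
  qed
  have three: "\<exists>W\<in>siegel_space h. induced_period_eq ds Z ns P1 P2 W \<and>
        (\<forall>W'. induced_period_eq ds Z ns P1 P2 W' \<longrightarrow> W' = W) \<and>
        is_period_matrix B (normal_basis ns us) us (normal_period_mat ns W)"
    if n: "n \<in> dim_range g" "admissible ds Z n \<omega>" and B: "B \<in> {A_omega A bs \<omega>, A_omega_c A bs \<omega>}"
      and h: "h = cdim (pspace B)" and s: "symplectic_basis B ns us"
      and P: "P1 \<in> carrier_mat (2 * g) h" "P2 \<in> carrier_mat (2 * g) h" "coordinate_matrix bs us (join_cols P1 P2)"
    for n \<omega> B h ns us P1 P2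
  proof -
    note C = P.admissible_pieces[OF n[unfolded g]]
    have subB: "abelian_subvariety A B" using B C(4,5) by blast
    have sB: "symplectic_pav B ns us" by (rule symplectic_pavI[OF abelian_subvariety_pav[OF A.pav_axioms subB] s])
    have hn: "h = length ns" using h s by (simp add: symplectic_basis_def)
    have lb: "length bs = 2 * g" using P.length_bs_g gg by simp
    show ?thesis
      using induced_period_matrix[OF P.symplectic_pav_axioms sB Zc P.period, of P1 P2] P unfolding hn lb by blast
  qed
  have v0: "valid_state A [(A, ds, bs, Z)]"
    unfolding valid_state_def using vA by (auto intro!: exI[of _ 1])
  have reach: "valid_state A S" if "split_step\<^sup>*\<^sup>* [(A, ds, bs, Z)] S" for S
    using that by (induction rule: rtranclp_induct) (use v0 A.split_step_valid in auto)
  have "False" if S: "S 0 = [(A, ds, bs, Z)]" "\<And>k::nat. split_step (S k) (S (Suc k))" for S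
  proof -
    have "valid_state A (S k) \<and> length (S k) = Suc k" for k
    proof (induction k)
      case (Suc k) then show ?case using A.split_step_valid[OF _ S(2)[of k]] by simp
    qed (use S(1) v0 in simp)
    \<comment> \<open>After dim A steps there would be dim A + 1 pieces, one more than orthogonality
      allows.\<close>
    then show False using A.valid_state_length[of "S (cdim (pspace A))"] by simp
  qed
  then have four: "\<nexists>S. S 0 = [(A, ds, bs, Z)] \<and> (\<forall>k::nat. split_step (S k) (S (Suc k)))" by blast
  have five: "(\<not> stopped S \<longrightarrow> (\<exists>S'. split_step S S')) \<and>
         (stopped S \<longrightarrow>
            (\<forall>B\<in>set (map fst S). abelian_subvariety A B \<and> simple_variety B) \<and>
            sum_is_isogeny A (map fst S))" if "split_step\<^sup>*\<^sup>* [(A, ds, bs, Z)] S" for S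
    using A.split_step_possible[OF reach[OF that]] A.stopped_state[OF reach[OF that]] by blast
  show ?thesis
    by (intro conjI; (intro impI allI ballI)?; (rule one | rule two | rule three | rule four | rule five); assumption?)
qed

end
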